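(* Let $G$ be a lcsc group, let $P_0 = P_0(G,H,\Gamma,W_0) \subset G$ be a regular model set, let $X := X_{P_0}$ be its hull, $X^\times := X^\times_{P_0}$ its punctured hull, and $Y := (G\times H)/\Gamma$ with its unique $(G\times H)$-invariant probability measure $m_Y$. Then there exists a unique $G$-invariant probability measure $\nu$ on $X^\times$, and for every admissible probability measure $\mu$ on $G$ the measure $\nu$ is also the unique $\mu$-stationary probability measure on $X^\times$. Moreover, $(X^\times,\nu)$ is measurably $G$-isomorphic to $(Y,m_Y)$. In particular, $L^2(X^\times,\nu) \cong L^2(Y,m_Y)$ as unitary $G$-representations. Moreover, if $P_0$ is uniform, then $X^\times = X$ is a compact minimal $G$-space.
   Context: lcsc means locally compact second countable. $m_G$ denotes a left Haar measure on $G$. A lattice in a lcsc group $L$ is a discrete subgroup $\Gamma<L$ such that $L/\Gamma$ admits an $L$-invariant probability measure; it is uniform if $L/\Gamma$ is compact. A cut-and-project scheme is a triple $(G,H,\Gamma)$ with $G,H$ lcsc groups and $\Gamma<G\times H$ a lattice such that the coordinate projection $\pi_G$ is injective on $\Gamma$ and $\pi_H(\Gamma)$ is dense in $H$. Put $\Gamma_G=\pi_G(\Gamma)$ and $\tau := \pi_H\circ(\pi_G|_\Gamma)^{-1}:\Gamma_G\to H$. Given a compact window $W_0\subset H$, put $P_0(G,H,\Gamma,W_0):=\tau^{-1}(W_0)\subset G$. It is called a regular model set if $W_0$ has non-empty interior, is Jordan-measurable ($m_H(\partial W_0)=0$), has dense interior ($W_0$ is the closure of its interior), has trivial stabilizer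 $\{h\in H : hW_0=W_0\}=\{e\}$, and is $\Gamma$-regular: $\partial W_0\cap\pi_H(\Gamma)=\emptyset$. It is uniform if $\Gamma$ is a uniform lattice in $G\times H$. The Chabauty--Fell topology on the set $\mathcal C(G)$ of closed subsets of $G$ is generated by the sets $\{C : C\cap V\neq\emptyset\}$ ($V\subset G$ open) and $\{C : C\cap K=\emptyset\}$ ($K\subset G$ compact). $G$ acts on $\mathcal C(G)$ by left translation. The hull $X_{P_0}$ is the closure of the orbit $G.P_0$ in $\mathcal C(G)$, and the punctured hull is $X_{P_0}^\times := X_{P_0}\setminus\{\emptyset\}$. $G$ acts on $Y$ by left multiplication in the first factor. A probability measure $\mu$ on $G$ is admissible if its support generates $G$ and it is absolutely continuous with respect to $m_G$. A probability measure $\nu$ on a measurable $G$-space is $\mu$-stationary if $\mu*\nu=\nu$, where $\mu*\nu=\int_G g_*\nu\,d\mu(g)$. A $G$-space is minimal if every $G$-orbit is dense. *)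

theory Defs
  imports "HOL-Probability.Probability"
begin

section \<open>Locally compact second countable groups\<close>

text \<open>
  Groups are written additively, following the library class \<open>topological_group_add\<close>, which
  does not assume commutativity: \<open>g + h\<close> is the group product $gh$, \<open>- g\<close> is $g^{-1}$ and
  \<open>0\<close> is the neutral element $e$.
\<close>

class lcsc_group = topological_group_add + t2_space + second_countable_topology +
  assumes locally_compact: "\<exists>U K. open U \<and> compact K \<and> x \<in> U \<and> U \<subseteq> K"

lemma locally_compact_space_lcsc_group:
  "locally_compact_space (euclidean :: 'a::lcsc_group topology)"
  unfolding locally_compact_space_def using locally_compact by auto

instance prod :: (topological_monoid_add, topological_monoid_add) topological_monoid_add
proof
  fix a b :: "'a \<times> 'b"
  have 1: "((\<lambda>x. fst x) \<longlongrightarrow> a) (nhds a \<times>\<^sub>F nhds b)" "((\<lambda>x. snd x) \<longlongrightarrow> b) (nhds a \<times>\<^sub>F nhds b)"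
    by (rule filterlim_fst, rule filterlim_snd)
  have "((\<lambda>x. (fst (fst x) + fst (snd x), snd (fst x) + snd (snd x)))
      \<longlongrightarrow> (fst a + fst b, snd a + snd b)) (nhds a \<times>\<^sub>F nhds b)"
    by (intro tendsto_intros 1)
  then show "((\<lambda>x. fst x + snd x) \<longlongrightarrow> a + b) (nhds a \<times>\<^sub>F nhds b)"
    by (simp add: plus_prod_def)
qed

instance prod :: (topological_group_add, topological_group_add) topological_group_add
proof
  fix a :: "'a \<times> 'b"
  have "((\<lambda>x. (- fst x, - snd x)) \<longlongrightarrow> (- fst a, - snd a)) (nhds a)"
    by (intro tendsto_intros filterlim_ident)
  then show "(uminus \<longlongrightarrow> - a) (nhds a)"
    by (simp add: uminus_prod_def[abs_def])
qed

instance prod :: (lcsc_group, lcsc_group) lcsc_group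
proof
  fix x :: "'a \<times> 'b"
  have "locally_compact_space (prod_topology (euclidean :: 'a topology) (euclidean :: 'b topology))"
    by (rule locally_compact_space_prod_topology[THEN iffD2, OF disjI2])
      (intro conjI locally_compact_space_lcsc_group)
  then show "\<exists>U K. open U \<and> compact K \<and> x \<in> U \<and> U \<subseteq> K"
    unfolding locally_compact_space_def prod_topology_euclidean topspace_euclidean
      open_openin[symmetric] compactin_euclidean_iff by (rule bspec[OF _ UNIV_I])
qed

definition add_subgroup :: "'a::group_add set \<Rightarrow> bool" where
  "add_subgroup K \<longleftrightarrow> 0 \<in> K \<and> (\<forall>x\<in>K. \<forall>y\<in>K. x + y \<in> K) \<and> (\<forall>x\<in>K. - x \<in> K)"

definition translate :: "'a::group_add \<Rightarrow> 'a set \<Rightarrow> 'a set" where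
  "translate g A = (+) g ` A"

text \<open>
  No outer or inner regularity is required: on an lcsc space every Borel measure
  that is finite on compact sets is regular.
\<close>

definition left_haar_measure :: "'a::lcsc_group measure \<Rightarrow> bool" where
  "left_haar_measure m \<longleftrightarrow>
     sets m = sets borel \<and>
     emeasure m UNIV \<noteq> 0 \<and>
     (\<forall>K. compact K \<longrightarrow> emeasure m K < \<infinity>) \<and>
     (\<forall>g. distr m m ((+) g) = m)"

section \<open>Group actions\<close>

definition orbit :: "('g \<Rightarrow> 'x \<Rightarrow> 'x) \<Rightarrow> 'x \<Rightarrow> 'x set" where
  "orbit act x = range (\<lambda>g. act g x)"

definition G_space :: "'x topology \<Rightarrow> ('g::topological_group_add \<Rightarrow> 'x \<Rightarrow> 'x) \<Rightarrow> bool" where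
  "G_space T act \<longleftrightarrow>
     (\<forall>x\<in>topspace T. act 0 x = x) \<and>
     (\<forall>g h. \<forall>x\<in>topspace T. act (g + h) x = act g (act h x)) \<and>
     continuous_map (prod_topology euclidean T) T (\<lambda>(g, x). act g x)"

definition minimal_G_space :: "'x topology \<Rightarrow> ('g::topological_group_add \<Rightarrow> 'x \<Rightarrow> 'x) \<Rightarrow> bool" where
  "minimal_G_space T act \<longleftrightarrow>
     G_space T act \<and> (\<forall>x\<in>topspace T. T closure_of (orbit act x) = topspace T)"

definition borel_of :: "'x topology \<Rightarrow> 'x measure" where
  "borel_of T = sigma (topspace T) {U. openin T U}"

definition borel_prob_on :: "'x topology \<Rightarrow> 'x measure \<Rightarrow> bool" where
  "borel_prob_on T \<nu> \<longleftrightarrow> prob_space \<nu> \<and> sets \<nu> = sets (borel_of T)"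

definition invariant_prob :: "'x topology \<Rightarrow> ('g \<Rightarrow> 'x \<Rightarrow> 'x) \<Rightarrow> 'x measure \<Rightarrow> bool" where
  "invariant_prob T act \<nu> \<longleftrightarrow> borel_prob_on T \<nu> \<and> (\<forall>g. distr \<nu> \<nu> (act g) = \<nu>)"

definition measure_support :: "'a::topological_space measure \<Rightarrow> 'a set" where
  "measure_support \<mu> = {x. \<forall>U. open U \<and> x \<in> U \<longrightarrow> emeasure \<mu> U \<noteq> 0}"

definition admissible :: "'g::lcsc_group measure \<Rightarrow> 'g measure \<Rightarrow> bool" where
  "admissible m\<^sub>G \<mu> \<longleftrightarrow>
     prob_space \<mu> \<and> sets \<mu> = sets borel \<and>
     add_subgroup hull (measure_support \<mu>) = UNIV \<and>
     absolutely_continuous m\<^sub>G \<mu>"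

definition act_convolution :: "'g measure \<Rightarrow> ('g \<Rightarrow> 'x \<Rightarrow> 'x) \<Rightarrow> 'x measure \<Rightarrow> 'x measure" where
  "act_convolution \<mu> act \<nu> =
     measure_of (space \<nu>) (sets \<nu>) (\<lambda>A. \<integral>\<^sup>+ g. emeasure (distr \<nu> \<nu> (act g)) A \<partial>\<mu>)"

definition stationary_prob ::
    "'x topology \<Rightarrow> ('g \<Rightarrow> 'x \<Rightarrow> 'x) \<Rightarrow> 'g measure \<Rightarrow> 'x measure \<Rightarrow> bool" where
  "stationary_prob T act \<mu> \<nu> \<longleftrightarrow> borel_prob_on T \<nu> \<and> act_convolution \<mu> act \<nu> = \<nu>"

text \<open>
  Two probability-measure-preserving actions are identified by an equivariant bimeasurable
  bijection \<open>\<phi>\<close> between invariant measurable sets of full measure.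
\<close>

definition measurably_isomorphic ::
    "('g \<Rightarrow> 'x \<Rightarrow> 'x) \<Rightarrow> 'x measure \<Rightarrow> ('g \<Rightarrow> 'y \<Rightarrow> 'y) \<Rightarrow> 'y measure \<Rightarrow> bool" where
  "measurably_isomorphic actX M actY N \<longleftrightarrow>
     (\<exists>X' Y' \<phi>.
        X' \<in> sets M \<and> (AE x in M. x \<in> X') \<and> (\<forall>g. actX g ` X' = X') \<and>
        Y' \<in> sets N \<and> (AE y in N. y \<in> Y') \<and> (\<forall>g. actY g ` Y' = Y') \<and>
        bij_betw \<phi> X' Y' \<and>
        \<phi> \<in> restrict_space M X' \<rightarrow>\<^sub>M restrict_space N Y' \<and>
        the_inv_into X' \<phi> \<in> restrict_space N Y' \<rightarrow>\<^sub>M restrict_space M X' \<and>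
        distr (restrict_space M X') (restrict_space N Y') \<phi> = restrict_space N Y' \<and>
        (\<forall>g. \<forall>x\<in>X'. \<phi> (actX g x) = actY g (\<phi> x)))"

section \<open>The Koopman representation\<close>

definition square_integrable :: "'x measure \<Rightarrow> ('x \<Rightarrow> complex) set" where
  "square_integrable M = {f \<in> borel_measurable M. integrable M (\<lambda>x. (cmod (f x))\<^sup>2)}"

definition L2_class :: "'x measure \<Rightarrow> ('x \<Rightarrow> complex) \<Rightarrow> ('x \<Rightarrow> complex) set" where
  "L2_class M f = {f' \<in> square_integrable M. AE x in M. f' x = f x}"

definition L2 :: "'x measure \<Rightarrow> ('x \<Rightarrow> complex) set set" where
  "L2 M = L2_class M ` square_integrable M"

text \<open>
  The operations below are lifted from functions to almost-everywhere classes; each union is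
  over representatives of the same resulting class.
\<close>

definition L2_add ::
    "'x measure \<Rightarrow> ('x \<Rightarrow> complex) set \<Rightarrow> ('x \<Rightarrow> complex) set \<Rightarrow> ('x \<Rightarrow> complex) set" where
  "L2_add M A B = (\<Union>f\<in>A. \<Union>g\<in>B. L2_class M (\<lambda>x. f x + g x))"

definition L2_scale ::
    "'x measure \<Rightarrow> complex \<Rightarrow> ('x \<Rightarrow> complex) set \<Rightarrow> ('x \<Rightarrow> complex) set" where
  "L2_scale M c A = (\<Union>f\<in>A. L2_class M (\<lambda>x. c * f x))"

definition L2_inner ::
    "'x measure \<Rightarrow> ('x \<Rightarrow> complex) set \<Rightarrow> ('x \<Rightarrow> complex) set \<Rightarrow> complex" where
  "L2_inner M A B = (THE z. \<forall>f\<in>A. \<forall>g\<in>B. z = (\<integral>x. f x * cnj (g x) \<partial>M))"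

definition koopman :: "'x measure \<Rightarrow> ('g::group_add \<Rightarrow> 'x \<Rightarrow> 'x) \<Rightarrow> 'g \<Rightarrow>
    ('x \<Rightarrow> complex) set \<Rightarrow> ('x \<Rightarrow> complex) set" where
  "koopman M act g A = (\<Union>f\<in>A. L2_class M (\<lambda>x. f (act (- g) x)))"

definition L2_unitarily_equivalent ::
    "('g::group_add \<Rightarrow> 'x \<Rightarrow> 'x) \<Rightarrow> 'x measure \<Rightarrow> ('g \<Rightarrow> 'y \<Rightarrow> 'y) \<Rightarrow> 'y measure \<Rightarrow> bool" where
  "L2_unitarily_equivalent actX M actY N \<longleftrightarrow>
     (\<exists>U. bij_betw U (L2 M) (L2 N) \<and>
        (\<forall>A\<in>L2 M. \<forall>B\<in>L2 M. U (L2_add M A B) = L2_add N (U A) (U B)) \<and>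
        (\<forall>c. \<forall>A\<in>L2 M. U (L2_scale M c A) = L2_scale N c (U A)) \<and>
        (\<forall>A\<in>L2 M. \<forall>B\<in>L2 M. L2_inner N (U A) (U B) = L2_inner M A B) \<and>
        (\<forall>g. \<forall>A\<in>L2 M. U (koopman M actX g A) = koopman N actY g (U A)))"

section \<open>Lattices\<close>

text \<open>
  $L/\Gamma$ is the set of left cosets \<open>translate g \<Gamma>\<close> with the quotient topology;
  \<open>translate\<close> is then also the left action of $L$ on it.
\<close>

definition coset_topology :: "'a::topological_group_add set \<Rightarrow> 'a set topology" where
  "coset_topology \<Gamma> = topology (\<lambda>U.
     U \<subseteq> range (\<lambda>g. translate g \<Gamma>) \<and> open {g. translate g \<Gamma> \<in> U})"

lemma openin_coset_topology:
  "openin (coset_topology \<Gamma>) U \<longleftrightarrow>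
     U \<subseteq> range (\<lambda>g. translate g \<Gamma>) \<and> open {g. translate g \<Gamma> \<in> U}"
proof -
  have "istopology (\<lambda>U. U \<subseteq> range (\<lambda>g. translate g \<Gamma>) \<and> open {g. translate g \<Gamma> \<in> U})"
    unfolding istopology_def
  proof (intro conjI allI impI; (elim conjE)?)
    fix S T assume "open {g. translate g \<Gamma> \<in> S}" "open {g. translate g \<Gamma> \<in> T}"
    then have "open ({g. translate g \<Gamma> \<in> S} \<inter> {g. translate g \<Gamma> \<in> T})" by (rule open_Int)
    then show "open {g. translate g \<Gamma> \<in> S \<inter> T}" by (simp add: Int_def)
  next
    fix \<K> assume *: "\<forall>K\<in>\<K>. K \<subseteq> range (\<lambda>g. translate g \<Gamma>) \<and> open {g. translate g \<Gamma> \<in> K}"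
    have "{g. translate g \<Gamma> \<in> \<Union>\<K>} = (\<Union>K\<in>\<K>. {g. translate g \<Gamma> \<in> K})" by auto
    then show "open {g. translate g \<Gamma> \<in> \<Union>\<K>}" using * by (simp add: open_UN)
  qed auto
  then show ?thesis by (simp add: coset_topology_def topology_inverse')
qed

lemma topspace_coset_topology: "topspace (coset_topology \<Gamma>) = range (\<lambda>g. translate g \<Gamma>)"
  by (rule antisym) (auto simp: topspace_def openin_coset_topology)

lemma quotient_map_coset_topology:
  "quotient_map euclidean (coset_topology \<Gamma>) (\<lambda>g. translate g \<Gamma>)"
  by (simp add: quotient_map_def topspace_coset_topology openin_coset_topology)

definition lattice_in :: "'a::lcsc_group set \<Rightarrow> bool" where
  "lattice_in \<Gamma> \<longleftrightarrow>
     add_subgroup \<Gamma> \<and> topological_space_class.discrete \<Gamma> \<and> (\<exists>m. invariant_prob (coset_topology \<Gamma>) translate m)"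

definition uniform_lattice :: "'a::lcsc_group set \<Rightarrow> bool" where
  "uniform_lattice \<Gamma> \<longleftrightarrow> lattice_in \<Gamma> \<and> compact_space (coset_topology \<Gamma>)"

section \<open>Model sets and their hulls\<close>

definition cut_and_project_scheme :: "('g::lcsc_group \<times> 'h::lcsc_group) set \<Rightarrow> bool" where
  "cut_and_project_scheme \<Gamma> \<longleftrightarrow>
     lattice_in \<Gamma> \<and> inj_on fst \<Gamma> \<and> closure (snd ` \<Gamma>) = UNIV"

definition star_map :: "('g \<times> 'h) set \<Rightarrow> 'g \<Rightarrow> 'h" where
  "star_map \<Gamma> x = snd (the_inv_into \<Gamma> fst x)"

definition model_set :: "('g \<times> 'h) set \<Rightarrow> 'h set \<Rightarrow> 'g set" where
  "model_set \<Gamma> W = {x \<in> fst ` \<Gamma>. star_map \<Gamma> x \<in> W}"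

definition regular_model_set_data ::
    "'h::lcsc_group measure \<Rightarrow> ('g::lcsc_group \<times> 'h) set \<Rightarrow> 'h set \<Rightarrow> bool" where
  "regular_model_set_data m\<^sub>H \<Gamma> W \<longleftrightarrow>
     cut_and_project_scheme \<Gamma> \<and>
     compact W \<and>
     interior W \<noteq> {} \<and>
     emeasure m\<^sub>H (frontier W) = 0 \<and>
     closure (interior W) = W \<and>
     {h. translate h W = W} = {0} \<and>
     frontier W \<inter> snd ` \<Gamma> = {}"

definition fell_topology :: "'a::topological_space set topology" where
  "fell_topology = topology_generated_by
     ({{C. closed C \<and> C \<inter> V \<noteq> {}} |V. open V} \<union> {{C. closed C \<and> C \<inter> K = {}} |K. compact K})"

lemma topspace_fell_topology: "topspace fell_topology = {C. closed C}"
proof -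
  have "closed C \<Longrightarrow> C \<in> topspace fell_topology" for C :: "'a set"
    unfolding fell_topology_def topology_generated_by_topspace
    by (rule UnionI[of "{C. closed C \<and> C \<inter> {} = {}}"], rule UnI2, rule CollectI,
        rule exI[of _ "{}"]) simp_all
  moreover have "C \<in> topspace fell_topology \<Longrightarrow> closed C" for C :: "'a set"
    unfolding fell_topology_def topology_generated_by_topspace by auto
  ultimately show ?thesis by (intro set_eqI iffI CollectI) simp_all
qed

definition hull_of :: "'g::lcsc_group set \<Rightarrow> 'g set set" where
  "hull_of P = fell_topology closure_of (orbit translate P)"

definition punctured_hull_of :: "'g::lcsc_group set \<Rightarrow> 'g set set" where
  "punctured_hull_of P = hull_of P - {{}}"

end

theory Submission
  imports Defs
begin

text \<open>
  To a coset \<open>y = (g, h)\<Gamma>\<close> belong the two patches \<open>P_int y \<subseteq> P_cl y\<close> cut out by the interior of the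
  window and by the window itself. If \<open>g\<^sub>n P\<^sub>0\<close> converges to a non-empty \<open>P\<close>, then \<open>g\<^sub>n \<Gamma>\<close> stays in
  a compact part of \<open>Y\<close> and every limit \<open>y\<close> satisfies \<open>P_int y \<subseteq> P \<subseteq> P_cl y\<close>; since the window has
  trivial stabilizer, \<open>P\<close> determines \<open>y\<close>. This gives a continuous equivariant map \<open>\<beta>\<close> from the
  punctured hull to \<open>Y\<close>, which is one-to-one over the cosets avoiding the boundary of the window,
  and these form an invariant set of full measure.

  It remains to see that \<open>m\<^sub>Y\<close> is the only stationary probability measure on \<open>Y\<close>. Smoothing a
  stationary measure along the commuting action of \<open>H\<close> makes it absolutely continuous. A level
  set of the density of an absolutely continuous stationary measure is invariant, hence null or
  conull because \<open>\<pi>\<^sub>H(\<Gamma>)\<close> is dense in \<open>H\<close>. So all smoothed measures equal \<open>m\<^sub>Y\<close>, and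
  lower semicontinuity of the measure of translated open sets removes the smoothing.
\<close>

section \<open>Topological groups\<close>

text \<open>A limit of translates of the model set is ambiguous only over the frontier of the
  window: a limit determines a coset, but a coset need not determine a limit. The measure theory
  therefore takes place on \<open>Y\<close> and is carried to the punctured hull by an almost
  inverse of \<beta>. A stationary measure on the hull pushes forward to the invariant one, which
  does not charge the singular cosets, and this allows it to be recovered from its image.

  On \<open>Y\<close> the obstacle is that a stationary measure could be singular. The law \<mu> is
  absolutely continuous along \<open>G\<close> only; smoothing supplies the missing direction
  \<open>H\<close> and preserves stationarity because the two actions commute. Of the density only
  the level 1 matters: two probability measures agree as soon as one has density at most 1 with
  respect to the other.

  Neither group is assumed unimodular. Haar measure is inverted or translated on the right only at
  the level of null sets, which both operations preserve. Translation is used through lower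
  semicontinuity on open sets, which suffices to pass from a dense subgroup to the whole
  group.\<close>

lemma closed_projection_compact:
  fixes C :: "('a::topological_space \<times> 'b::topological_space) set"
  assumes "compact K" "closed C"
  shows "closed {y. \<exists>x\<in>K. (x, y) \<in> C}"
proof -
  have "open (- {y. \<exists>x\<in>K. (x, y) \<in> C})"
  proof (subst open_subopen, intro ballI)
    fix y assume y: "y \<in> - {y. \<exists>x\<in>K. (x, y) \<in> C}"
    \<comment> \<open>Tube lemma: each point of \<open>K\<close> gets a box around it and
      \<open>y\<close> that avoids \<open>C\<close>. Finitely many boxes cover \<open>K\<close>, and
      the intersection of their second sides is the neighbourhood sought.\<close>
    have "\<exists>U V. open U \<and> open V \<and> x \<in> U \<and> y \<in> V \<and> U \<times> V \<subseteq> - C" if "x \<in> K" for x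
    proof -
      have "(x, y) \<in> - C" using y that by blast
      with assms(2) obtain A B where "open A" "open B" "(x, y) \<in> A \<times> B" "A \<times> B \<subseteq> - C"
        by (metis open_Compl open_prod_elim)
      then show ?thesis by (intro exI[of _ A] exI[of _ B]) simp
    qed
    then obtain U V where UV: "\<And>x. x \<in> K \<Longrightarrow> open (U x) \<and> open (V x) \<and> x \<in> U x \<and> y \<in> V x \<and> U x \<times> V x \<subseteq> - C"
      by metis
    obtain D where D: "D \<subseteq> K" "finite D" "K \<subseteq> (\<Union>x\<in>D. U x)"
      by (rule compactE_image[OF assms(1), of K U]) (use UV in auto)
    have "(\<Inter>x\<in>D. V x) \<subseteq> - {y. \<exists>x\<in>K. (x, y) \<in> C}"
    proof (intro subsetI ComplI)
      fix z assume z: "z \<in> (\<Inter>x\<in>D. V x)" "z \<in> {y. \<exists>x\<in>K. (x, y) \<in> C}"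
      then obtain x where x: "x \<in> K" "(x, z) \<in> C" by blast
      then obtain d where d: "d \<in> D" "x \<in> U d" using D(3) by blast
      then have "(x, z) \<in> U d \<times> V d" using z by simp
      then show False using UV[of d] d D(1) x(2) by blast
    qed
    moreover have "open (\<Inter>x\<in>D. V x)" using D UV by (intro open_INT) auto
    moreover have "y \<in> (\<Inter>x\<in>D. V x)" using D UV by auto
    ultimately show "\<exists>T. open T \<and> y \<in> T \<and> T \<subseteq> - {y. \<exists>x\<in>K. (x, y) \<in> C}" by blast
  qed
  then show ?thesis by (simp add: closed_open)
qed

text \<open>A point \<open>y\<close> is a sum of this form iff \<open>- k + y\<close> lies in
  \<open>C\<close> for some \<open>k\<close> in \<open>K\<close>, which is a projection along the
  compact \<open>K\<close>. With \<Gamma> for \<open>C\<close> it makes saturations of compact sets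
  closed.\<close>

lemma compact_plus_closed:
  fixes K C :: "'a::topological_group_add set"
  assumes "compact K" "closed C"
  shows "closed {k + c |k c. k \<in> K \<and> c \<in> C}"
proof -
  have "closed ((\<lambda>(x, y). - x + y) -` C :: ('a \<times> 'a) set)"
    unfolding case_prod_unfold
    by (intro closed_vimage assms continuous_intros)
  from closed_projection_compact[OF assms(1) this]
  have "closed {y. \<exists>x\<in>K. - x + y \<in> C}" by simp
  also have "{y. \<exists>x\<in>K. - x + y \<in> C} = {k + c |k c. k \<in> K \<and> c \<in> C}"
  proof (intro set_eqI iffI; clarsimp)
    fix y x assume "x \<in> K" "- x + y \<in> C"
    then show "\<exists>k c. y = k + c \<and> k \<in> K \<and> c \<in> C"
      by (intro exI[of _ x] exI[of _ "- x + y"]) simp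
  next
    fix k c assume "k \<in> K" "c \<in> C"
    then show "\<exists>x\<in>K. - x + (k + c) \<in> C" by (intro bexI[of _ k]) simp_all
  qed
  finally show ?thesis .
qed

lemma open_translate_vimage:
  fixes U :: "'a::topological_group_add set"
  assumes "open U"
  shows "open {x. a + x + b \<in> U}"
proof -
  have "open ((\<lambda>x. a + x + b) -` U)" by (intro open_vimage assms continuous_intros)
  then show ?thesis by (simp add: vimage_def)
qed

lemma add_subgroupD:
  assumes "add_subgroup K"
  shows "0 \<in> K" "x \<in> K \<Longrightarrow> y \<in> K \<Longrightarrow> x + y \<in> K" "x \<in> K \<Longrightarrow> - x \<in> K"
    "x \<in> K \<Longrightarrow> y \<in> K \<Longrightarrow> x - y \<in> K"
proof -
  show "x \<in> K \<Longrightarrow> y \<in> K \<Longrightarrow> x - y \<in> K"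
    using assms unfolding add_subgroup_def by (metis diff_conv_add_uminus)
qed (use assms in \<open>auto simp: add_subgroup_def\<close>)

text \<open>Discreteness of a subgroup is uniform: two points of \<Gamma> whose difference lies in
  the neighbourhood \<open>T\<close> of 0 coincide. Every point thus has a neighbourhood with at
  most one point of \<Gamma>, and outside \<Gamma> that point can be removed.\<close>

lemma closed_discrete_subgroup:
  fixes \<Gamma> :: "'a::{topological_group_add, t2_space} set"
  assumes "add_subgroup \<Gamma>" "topological_space_class.discrete \<Gamma>"
  shows "closed \<Gamma>"
proof -
  obtain T where T: "open T" "T \<inter> \<Gamma> = {0}"
    using assms by (auto simp: add_subgroup_def topological_space_class.discrete_def isolated_in_def)
  have "open (- \<Gamma>)"
  proof (subst open_subopen, intro ballI)
    fix x assume x: "x \<in> - \<Gamma>"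
    have "open ((\<lambda>(a, b). a - b) -` T :: ('a \<times> 'a) set)"
      unfolding case_prod_unfold diff_conv_add_uminus by (intro open_vimage T continuous_intros)
    moreover have "(x, x) \<in> (\<lambda>(a, b). a - b) -` T" using T(2) by auto
    ultimately obtain A B where AB: "open A" "open B" "x \<in> A" "x \<in> B" "A \<times> B \<subseteq> (\<lambda>(a, b). a - b) -` T"
      by (elim open_prod_elim) auto
    have uniq: "a = b" if "a \<in> A \<inter> B \<inter> \<Gamma>" "b \<in> A \<inter> B \<inter> \<Gamma>" for a b
    proof -
      have "a - b \<in> T" using that AB(5) by auto
      moreover have "a - b \<in> \<Gamma>" using that add_subgroupD[OF assms(1)] by auto
      ultimately have "a - b \<in> {0}" unfolding T(2)[symmetric] by blast
      then show "a = b" by simp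
    qed
    have "finite (A \<inter> B \<inter> \<Gamma>)"
    proof (cases "\<exists>a. a \<in> A \<inter> B \<inter> \<Gamma>")
      case True
      then obtain a where "a \<in> A \<inter> B \<inter> \<Gamma>" ..
      then have "A \<inter> B \<inter> \<Gamma> \<subseteq> {a}" using uniq by blast
      then show ?thesis by (rule finite_subset) simp
    next
      case False
      then have "A \<inter> B \<inter> \<Gamma> = {}" by blast
      then show ?thesis by simp
    qed
    then have "open (A \<inter> B - (A \<inter> B \<inter> \<Gamma>))" using AB by (intro open_Diff open_Int finite_imp_closed)
    then show "\<exists>T. open T \<and> x \<in> T \<and> T \<subseteq> - \<Gamma>" using AB x by blast
  qed
  then show ?thesis by (simp add: closed_open)
qed

lemma countable_discrete:
  fixes S :: "'a::second_countable_topology set"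
  assumes "topological_space_class.discrete S"
  shows "countable S"
proof -
  obtain \<B> :: "'a set set" where B: "countable \<B>" "topological_basis \<B>"
    using ex_countable_basis by blast
  have "\<exists>b\<in>\<B>. b \<inter> S = {x}" if x: "x \<in> S" for x
  proof -
    obtain T where "open T" "T \<inter> S = {x}" using assms x by (auto simp: topological_space_class.discrete_def isolated_in_def)
    then obtain b where "b \<in> \<B>" "x \<in> b" "b \<subseteq> T" using B(2)
      by (metis IntD1 insertI1 topological_basisE)
    then show ?thesis using \<open>T \<inter> S = {x}\<close> x by blast
  qed
  then obtain b where b: "\<And>x. x \<in> S \<Longrightarrow> b x \<in> \<B> \<and> b x \<inter> S = {x}" by metis
  then have "inj_on b S" by (intro inj_onI) (metis singleton_inject)
  moreover have "b ` S \<subseteq> \<B>" using b by auto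
  ultimately show ?thesis using B(1) by (meson countable_image_inj_on countable_subset)
qed

lemma compact_neighbourhood:
  fixes x :: "'a::lcsc_group"
  assumes "open U" "x \<in> U"
  obtains V K where "open V" "compact K" "x \<in> V" "V \<subseteq> K" "K \<subseteq> U"
proof -
  have "Hausdorff_space (euclidean :: 'a topology)"
    unfolding Hausdorff_space_def disjnt_def using hausdorff by (metis open_openin)
  then have "neighbourhood_base_of (compactin euclidean) (euclidean :: 'a topology)"
    using locally_compact_space_neighbourhood_base[of "euclidean :: 'a topology"]
      locally_compact_space_lcsc_group[where 'a='a] by blast
  then show ?thesis using assms that
    unfolding neighbourhood_base_of by (metis compactin_euclidean_iff open_openin)
qed

text \<open>Lindelof applied to compact neighbourhoods inside \<open>U\<close>. It serves to write
  open sets of cosets as countable unions of closed ones, and to show that the singular cosets form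
  a Borel set.\<close>

lemma open_sigma_compact:
  fixes U :: "'a::lcsc_group set"
  assumes "open U"
  obtains K :: "nat \<Rightarrow> 'a set" where "\<And>n. compact (K n)" "(\<Union>n. K n) = U"
proof -
  have "\<exists>V K. open V \<and> compact K \<and> x \<in> V \<and> V \<subseteq> K \<and> K \<subseteq> U" if "x \<in> U" for x
    using compact_neighbourhood[OF assms that] by metis
  then obtain V K where VK: "\<And>x. x \<in> U \<Longrightarrow> open (V x) \<and> compact (K x) \<and> x \<in> V x \<and> V x \<subseteq> K x \<and> K x \<subseteq> U"
    by metis
  obtain \<F> where F: "\<F> \<subseteq> V ` U" "countable \<F>" "\<Union>\<F> = \<Union>(V ` U)"
    using Lindelof[of "V ` U"] VK by blast
  then obtain D where D: "countable D" "D \<subseteq> U" "\<F> = V ` D"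
    by (metis countable_subset_image)
  have U: "(\<Union>x\<in>D. K x) = U"
  proof (intro equalityI subsetI)
    fix x assume "x \<in> U"
    then have "x \<in> \<Union>\<F>" unfolding F(3) using VK by blast
    then obtain d where "d \<in> D" "x \<in> V d" unfolding D(3) by blast
    then show "x \<in> (\<Union>x\<in>D. K x)" using VK D(2) by blast
  qed (use VK D(2) in blast)
  show ?thesis
  proof (cases "D = {}")
    case True
    then show ?thesis using U that[of "\<lambda>_. {}"] by simp
  next
    case False
    then have "range (from_nat_into D) = D" using D by (simp add: range_from_nat_into)
    then have "(\<Union>n. K (from_nat_into D n)) = U" using U by (metis image_image)
    moreover have "compact (K (from_nat_into D n))" for n
      using VK D from_nat_into[OF False] by blast
    ultimately show ?thesis by (intro that[of "\<lambda>n. K (from_nat_into D n)"])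
  qed
qed

lemma dense_meets_open:
  assumes "closure D = UNIV" "open U" "U \<noteq> {}"
  shows "\<exists>d\<in>D. d \<in> U"
proof -
  have "U \<inter> D \<noteq> {}"
    using assms by (simp add: open_Int_closure_eq_empty[OF assms(2), symmetric])
  then show ?thesis by blast
qed

section \<open>Borel measures on topological spaces\<close>

lemma sets_borel_of: "sets (borel_of T) = sigma_sets (topspace T) {U. openin T U}"
  unfolding borel_of_def by (rule sets_measure_of) (auto dest: openin_subset)

lemma space_borel_of [simp]: "space (borel_of T) = topspace T"
  unfolding borel_of_def by (rule space_measure_of) (auto dest: openin_subset)

lemma openin_sets_borel_of: "openin T U \<Longrightarrow> U \<in> sets (borel_of T)"
  unfolding sets_borel_of by blast

lemma closedin_sets_borel_of: "closedin T C \<Longrightarrow> C \<in> sets (borel_of T)"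
  using openin_sets_borel_of[of T "topspace T - C"] closedin_subset[of T C]
    sets.compl_sets[of "topspace T - C" "borel_of T"]
  by (simp add: closedin_def double_diff)

lemma borel_of_euclidean: "borel_of euclidean = borel"
  unfolding borel_of_def borel_def by simp

lemma measurable_into_borel_of:
  assumes "f \<in> space M \<rightarrow> topspace T" "\<And>U. openin T U \<Longrightarrow> f -` U \<inter> space M \<in> sets M"
  shows "f \<in> M \<rightarrow>\<^sub>M borel_of T"
  by (rule measurable_sigma_sets[OF sets_borel_of]) (use assms in \<open>auto dest: openin_subset\<close>)

lemma measurable_borel_of_continuous_map:
  assumes "continuous_map T T' f"
  shows "f \<in> borel_of T \<rightarrow>\<^sub>M borel_of T'"
proof (rule measurable_into_borel_of)
  show "f \<in> space (borel_of T) \<rightarrow> topspace T'" using assms by (auto simp: continuous_map_def)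
  fix U assume "openin T' U"
  then have "openin T {x \<in> topspace T. f x \<in> U}" using assms by (auto simp: continuous_map_def)
  moreover have "f -` U \<inter> space (borel_of T) = {x \<in> topspace T. f x \<in> U}" by auto
  ultimately show "f -` U \<inter> space (borel_of T) \<in> sets (borel_of T)"
    by (simp add: openin_sets_borel_of)
qed

lemma borel_measure_eqI:
  assumes "sets M = sets (borel_of T)" "sets N = sets (borel_of T)"
    and "emeasure M (topspace T) \<noteq> \<infinity>"
    and "\<And>U. openin T U \<Longrightarrow> emeasure M U = emeasure N U"
  shows "M = N"
  by (rule measure_eqI_generator_eq[where E="{U. openin T U}" and \<Omega>="topspace T" and A="\<lambda>_. topspace T"])
    (use assms sets_borel_of[of T] in \<open>auto simp: Int_stable_def dest: openin_subset\<close>)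

lemma borel_prob_onD:
  assumes "borel_prob_on T \<nu>"
  shows "prob_space \<nu>" "sets \<nu> = sets (borel_of T)" "space \<nu> = topspace T"
  using assms sets_eq_imp_space_eq[of \<nu> "borel_of T"] by (auto simp: borel_prob_on_def)

lemma emeasure_distr_borel_of:
  assumes "continuous_map T T' f" "sets M = sets (borel_of T)" "sets N = sets (borel_of T')"
    "A \<in> sets (borel_of T')"
  shows "emeasure (distr M N f) A = emeasure M (f -` A \<inter> topspace T)"
proof -
  have "f \<in> M \<rightarrow>\<^sub>M N"
    using measurable_borel_of_continuous_map[OF assms(1)] measurable_cong_sets[OF assms(2,3)] by blast
  then show ?thesis
    using assms sets_eq_imp_space_eq[OF assms(2)] by (subst emeasure_distr) auto
qed

section \<open>Continuous actions\<close>

lemma G_spaceD: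
  assumes "G_space T act"
  shows "x \<in> topspace T \<Longrightarrow> act g x \<in> topspace T"
    "x \<in> topspace T \<Longrightarrow> act 0 x = x"
    "x \<in> topspace T \<Longrightarrow> act (g + h) x = act g (act h x)"
    "x \<in> topspace T \<Longrightarrow> act (- g) (act g x) = x"
    "x \<in> topspace T \<Longrightarrow> act g (act (- g) x) = x"
    "continuous_map (prod_topology euclidean T) T (\<lambda>(g, x). act g x)"
    "continuous_map T T (act g)"
    "x \<in> topspace T \<Longrightarrow> continuous_map euclidean T (\<lambda>g. act g x)"
proof -
  show *: "continuous_map (prod_topology euclidean T) T (\<lambda>(g, x). act g x)"
    and "x \<in> topspace T \<Longrightarrow> act 0 x = x"
    and "x \<in> topspace T \<Longrightarrow> act (g + h) x = act g (act h x)"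
    and "x \<in> topspace T \<Longrightarrow> act (- g) (act g x) = x"
    and "x \<in> topspace T \<Longrightarrow> act g (act (- g) x) = x"
    using assms unfolding G_space_def by (auto, (metis left_minus right_minus)+)
  show "continuous_map T T (act g)"
    using continuous_map_compose[OF _ *, of T "\<lambda>x. (g, x)"]
    by (simp add: continuous_map_pairwise comp_def)
  then show "x \<in> topspace T \<Longrightarrow> act g x \<in> topspace T" by (auto simp: continuous_map_def)
  show "x \<in> topspace T \<Longrightarrow> continuous_map euclidean T (\<lambda>g. act g x)"
    using continuous_map_compose[OF _ *, of euclidean "\<lambda>g. (g, x)"]
    by (simp add: continuous_map_pairwise comp_def)
qed

text \<open>No countable base is assumed for \<open>T\<close>, so an open set of the product is not
  evidently in the product \<sigma>-algebra. A countable base of the group suffices: each basic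
  \<open>b\<close> is paired with the largest open \<open>V b\<close> such that the box
  \<open>b \<times> V b\<close> stays inside, and these boxes exhaust the set.\<close>

lemma G_space_measurable:
  fixes act :: "'g::{topological_group_add, second_countable_topology} \<Rightarrow> 'x \<Rightarrow> 'x"
  assumes "G_space T act"
  shows "(\<lambda>(g, x). act g x) \<in> borel \<Otimes>\<^sub>M borel_of T \<rightarrow>\<^sub>M borel_of T"
proof (rule measurable_into_borel_of)
  show "(\<lambda>(g, x). act g x) \<in> space (borel \<Otimes>\<^sub>M borel_of T) \<rightarrow> topspace T"
    using G_spaceD(1)[OF assms] by (auto simp: space_pair_measure)
  fix U assume U: "openin T U"
  obtain \<B> :: "'g set set" where B: "countable \<B>" "topological_basis \<B>"
    using ex_countable_basis by blast
  define O' where "O' = {p \<in> topspace (prod_topology euclidean T). (case p of (g, x) \<Rightarrow> act g x) \<in> U}"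
  have O': "openin (prod_topology euclidean T) O'"
    using G_spaceD(6)[OF assms] U unfolding O'_def continuous_map_def by blast
  define V where "V b = \<Union>{V. openin T V \<and> b \<times> V \<subseteq> O'}" for b
  have "openin T (V b)" for b unfolding V_def by auto
  then have "b \<times> V b \<in> sets (borel \<Otimes>\<^sub>M borel_of T)" if "b \<in> \<B>" for b
    using that B(2) by (intro pair_measureI openin_sets_borel_of borel_open topological_basis_open)
  then have "(\<Union>b\<in>\<B>. b \<times> V b) \<in> sets (borel \<Otimes>\<^sub>M borel_of T)"
    using B(1) by (intro sets.countable_UN') auto
  moreover have "(\<Union>b\<in>\<B>. b \<times> V b) = O'"
  proof (intro equalityI subsetI)
    fix p assume "p \<in> O'"
    then obtain A W where AW: "open A" "openin T W" "p \<in> A \<times> W" "A \<times> W \<subseteq> O'"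
      using O' unfolding openin_prod_topology_alt by (cases p) (metis mem_Sigma_iff open_openin)
    obtain b where b: "b \<in> \<B>" "fst p \<in> b" "b \<subseteq> A"
      using AW B(2) by (metis mem_Times_iff topological_basisE)
    then have "snd p \<in> V b" using AW unfolding V_def by (auto simp: mem_Times_iff)
    then show "p \<in> (\<Union>b\<in>\<B>. b \<times> V b)" using b by (auto simp: mem_Times_iff)
  qed (auto simp: V_def)
  moreover have "(\<lambda>(g, x). act g x) -` U \<inter> space (borel \<Otimes>\<^sub>M borel_of T) = O'"
    by (auto simp: O'_def space_pair_measure)
  ultimately show "(\<lambda>(g, x). act g x) -` U \<inter> space (borel \<Otimes>\<^sub>M borel_of T) \<in> sets (borel \<Otimes>\<^sub>M borel_of T)"
    by simp
qed

lemma G_space_measurable':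
  fixes act :: "'g::{topological_group_add, second_countable_topology} \<Rightarrow> 'x \<Rightarrow> 'x"
  assumes "G_space T act" "sets \<mu> = sets borel" "sets \<nu> = sets (borel_of T)"
  shows "(\<lambda>(g, x). act g x) \<in> \<mu> \<Otimes>\<^sub>M \<nu> \<rightarrow>\<^sub>M \<nu>" "act g \<in> \<nu> \<rightarrow>\<^sub>M \<nu>"
proof -
  show "(\<lambda>(g, x). act g x) \<in> \<mu> \<Otimes>\<^sub>M \<nu> \<rightarrow>\<^sub>M \<nu>"
    using G_space_measurable[OF assms(1)]
      measurable_cong_sets[OF sets_pair_measure_cong[OF assms(2,3)] assms(3)] by blast
  show "act g \<in> \<nu> \<rightarrow>\<^sub>M \<nu>"
    using measurable_borel_of_continuous_map[OF G_spaceD(7)[OF assms(1)]]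
      measurable_cong_sets[OF assms(3) assms(3)] by blast
qed

lemma act_set_measurable:
  assumes "G_space T act" "A \<in> sets (borel_of T)"
  shows "act g -` A \<inter> topspace T \<in> sets (borel_of T)"
  using measurable_sets[OF measurable_borel_of_continuous_map[OF G_spaceD(7)[OF assms(1)]] assms(2)]
  by simp

lemma act_openin: "G_space T act \<Longrightarrow> openin T U \<Longrightarrow> openin T (act g -` U \<inter> topspace T)"
  using G_spaceD(7)[of T act g] by (auto simp: continuous_map_def vimage_def Int_def conj_commute)

lemma act_vimage_vimage:
  assumes "G_space T act"
  shows "act h -` (act g -` A \<inter> topspace T) \<inter> topspace T = act (g + h) -` A \<inter> topspace T"
  using G_spaceD(1,3)[OF assms] by auto

lemma act_vimage_0:
  assumes "G_space T act" "A \<subseteq> topspace T"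
  shows "act 0 -` A \<inter> topspace T = A"
  using G_spaceD(2)[OF assms(1)] assms(2) by auto

text \<open>A set function given to \<open>measure_of\<close> defines the expected measure only if
  it is countably additive. Identifying it with the image of a product measure settles this.\<close>

lemma emeasure_act_convolution:
  fixes act :: "'g::{topological_group_add, second_countable_topology} \<Rightarrow> 'x \<Rightarrow> 'x"
  assumes G: "G_space T act" and \<mu>: "sets \<mu> = sets borel"
    and \<nu>: "sets \<nu> = sets (borel_of T)" "sigma_finite_measure \<nu>"
  shows "act_convolution \<mu> act \<nu> = distr (\<mu> \<Otimes>\<^sub>M \<nu>) \<nu> (\<lambda>(g, x). act g x)"
    and "A \<in> sets (borel_of T) \<Longrightarrow>
      emeasure (act_convolution \<mu> act \<nu>) A = (\<integral>\<^sup>+ g. emeasure \<nu> (act g -` A \<inter> topspace T) \<partial>\<mu>)"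
proof -
  interpret sigma_finite_measure \<nu> by fact
  note meas = G_space_measurable'[OF G \<mu> \<nu>(1)]
  have sp: "space \<nu> = topspace T" "space \<mu> = UNIV"
    using sets_eq_imp_space_eq[OF \<nu>(1)] sets_eq_imp_space_eq[OF \<mu>] by auto
  have eq: "emeasure (distr (\<mu> \<Otimes>\<^sub>M \<nu>) \<nu> (\<lambda>(g, x). act g x)) A
      = (\<integral>\<^sup>+ g. emeasure (distr \<nu> \<nu> (act g)) A \<partial>\<mu>)" if "A \<in> sets \<nu>" for A
  proof -
    have "emeasure (distr (\<mu> \<Otimes>\<^sub>M \<nu>) \<nu> (\<lambda>(g, x). act g x)) A
        = (\<integral>\<^sup>+ g. emeasure \<nu> (Pair g -` ((\<lambda>(g, x). act g x) -` A \<inter> space (\<mu> \<Otimes>\<^sub>M \<nu>))) \<partial>\<mu>)"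
      unfolding emeasure_distr[OF meas(1) that]
      by (rule emeasure_pair_measure_alt[OF measurable_sets[OF meas(1) that]])
    also have "\<dots> = (\<integral>\<^sup>+ g. emeasure (distr \<nu> \<nu> (act g)) A \<partial>\<mu>)"
      using meas(2) that
      by (intro nn_integral_cong, subst emeasure_distr)
        (auto simp: space_pair_measure sp intro!: arg_cong[of _ _ "emeasure \<nu>"])
    finally show ?thesis .
  qed
  show *: "act_convolution \<mu> act \<nu> = distr (\<mu> \<Otimes>\<^sub>M \<nu>) \<nu> (\<lambda>(g, x). act g x)"
    unfolding act_convolution_def
    by (rule trans[OF measure_of_eq distr_def[symmetric]])
     (use eq emeasure_distr[OF meas(1)] in \<open>auto simp: sets.sigma_sets_eq dest: sets.sets_into_space\<close>)
  show "emeasure (act_convolution \<mu> act \<nu>) A = (\<integral>\<^sup>+ g. emeasure \<nu> (act g -` A \<inter> topspace T) \<partial>\<mu>)"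
    if "A \<in> sets (borel_of T)"
    unfolding * eq[OF that[folded \<nu>(1)]] using that
    by (intro nn_integral_cong emeasure_distr_borel_of[OF G_spaceD(7)[OF G] \<nu>(1) \<nu>(1)])
qed

lemma borel_prob_on_act_convolution:
  fixes act :: "'g::{topological_group_add, second_countable_topology} \<Rightarrow> 'x \<Rightarrow> 'x"
  assumes "G_space T act" "prob_space \<mu>" "sets \<mu> = sets borel" "borel_prob_on T \<nu>"
  shows "borel_prob_on T (act_convolution \<mu> act \<nu>)"
proof -
  note \<nu> = borel_prob_onD[OF assms(4)]
  interpret P: pair_prob_space \<mu> \<nu>
    using assms(2) \<nu>(1) by (simp add: pair_prob_space_def pair_sigma_finite_def prob_space_imp_sigma_finite)
  show ?thesis
    unfolding borel_prob_on_def emeasure_act_convolution(1)[OF assms(1,3) \<nu>(2) prob_space_imp_sigma_finite[OF \<nu>(1)]]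
    using P.prob_space_distr[OF G_space_measurable'(1)[OF assms(1,3) \<nu>(2)]] \<nu>(2) by simp
qed

lemma stationary_prob_iff:
  fixes act :: "'g::{topological_group_add, second_countable_topology} \<Rightarrow> 'x \<Rightarrow> 'x"
  assumes "G_space T act" "sets \<mu> = sets borel"
  shows "stationary_prob T act \<mu> \<nu> \<longleftrightarrow> borel_prob_on T \<nu> \<and>
    (\<forall>A\<in>sets (borel_of T). (\<integral>\<^sup>+ g. emeasure \<nu> (act g -` A \<inter> topspace T) \<partial>\<mu>) = emeasure \<nu> A)"
proof (cases "borel_prob_on T \<nu>")
  case True
  note \<nu> = borel_prob_onD[OF True]
  note conv = emeasure_act_convolution[OF assms \<nu>(2) prob_space_imp_sigma_finite[OF \<nu>(1)]]
  have "act_convolution \<mu> act \<nu> = \<nu> \<longleftrightarrow>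
      (\<forall>A\<in>sets (borel_of T). emeasure (act_convolution \<mu> act \<nu>) A = emeasure \<nu> A)"
    using \<nu>(2) by (auto intro!: measure_eqI simp: conv(1))
  then show ?thesis unfolding stationary_prob_def using conv(2) True by simp
qed (simp add: stationary_prob_def)

lemma invariant_prob_iff:
  assumes "G_space T act"
  shows "invariant_prob T act \<nu> \<longleftrightarrow> borel_prob_on T \<nu> \<and>
    (\<forall>g. \<forall>A\<in>sets (borel_of T). emeasure \<nu> (act g -` A \<inter> topspace T) = emeasure \<nu> A)"
proof (cases "borel_prob_on T \<nu>")
  case True
  note \<nu> = borel_prob_onD[OF True]
  have "distr \<nu> \<nu> (act g) = \<nu> \<longleftrightarrow>
      (\<forall>A\<in>sets (borel_of T). emeasure (distr \<nu> \<nu> (act g)) A = emeasure \<nu> A)" for g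
    using \<nu>(2) by (auto intro!: measure_eqI)
  then show ?thesis unfolding invariant_prob_def
    using emeasure_distr_borel_of[OF G_spaceD(7)[OF assms] \<nu>(2) \<nu>(2)] True by simp
qed (simp add: invariant_prob_def)

lemma invariant_imp_stationary:
  fixes act :: "'g::{topological_group_add, second_countable_topology} \<Rightarrow> 'x \<Rightarrow> 'x"
  assumes "G_space T act" "prob_space \<mu>" "sets \<mu> = sets borel" "invariant_prob T act \<nu>"
  shows "stationary_prob T act \<mu> \<nu>"
proof -
  interpret prob_space \<mu> by fact
  show ?thesis
    using assms(4) unfolding stationary_prob_iff[OF assms(1,3)] invariant_prob_iff[OF assms(1)]
    by (simp add: emeasure_space_1)
qed

text \<open>Lower semicontinuity in \<open>g\<close>, by Fatou's lemma.\<close>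

lemma eventually_less_emeasure_act:
  fixes act :: "'g::lcsc_group \<Rightarrow> 'x \<Rightarrow> 'x"
  assumes G: "G_space T act" and \<nu>: "sets \<nu> = sets (borel_of T)" and U: "openin T U"
    and c: "c < emeasure \<nu> (act g -` U \<inter> topspace T)"
  shows "\<forall>\<^sub>F g' in nhds g. c < emeasure \<nu> (act g' -` U \<inter> topspace T)"
proof -
  have sp: "space \<nu> = topspace T" using sets_eq_imp_space_eq[OF \<nu>] by auto
  have meas: "act g -` U \<inter> topspace T \<in> sets \<nu>" for g
    using act_openin[OF G U] \<nu> openin_sets_borel_of by metis
  show ?thesis unfolding eventually_nhds_iff_sequentially
  proof (intro allI impI)
    fix f assume f: "f \<longlonglongrightarrow> g"
    define u where "u = (\<lambda>n. indicator (act (f n) -` U \<inter> topspace T) :: 'x \<Rightarrow> ennreal)"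
    have "emeasure \<nu> (act g -` U \<inter> topspace T) = (\<integral>\<^sup>+x. indicator (act g -` U \<inter> topspace T) x \<partial>\<nu>)"
      using meas by simp
    also have "\<dots> \<le> (\<integral>\<^sup>+x. liminf (\<lambda>n. u n x) \<partial>\<nu>)"
    proof (rule nn_integral_mono)
      fix x assume "x \<in> space \<nu>"
      then have x: "x \<in> topspace T" by (simp add: sp)
      show "indicator (act g -` U \<inter> topspace T) x \<le> liminf (\<lambda>n. u n x)"
      proof (cases "act g x \<in> U")
        case True
        have "open {g. act g x \<in> U}"
          using G_spaceD(8)[OF G x] U by (auto simp: continuous_map_def)
        then have "\<forall>\<^sub>F n in sequentially. act (f n) x \<in> U"
          using f True topological_tendstoD[OF f] by fastforce
        then have "\<forall>\<^sub>F n in sequentially. 1 \<le> u n x"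
          by eventually_elim (use x in \<open>auto simp: u_def indicator_def\<close>)
        then have "1 \<le> liminf (\<lambda>n. u n x)" by (rule Liminf_bounded)
        then show ?thesis by (auto simp: indicator_def)
      qed auto
    qed
    also have "\<dots> \<le> liminf (\<lambda>n. \<integral>\<^sup>+x. u n x \<partial>\<nu>)"
      by (rule nn_integral_liminf) (simp add: u_def borel_measurable_indicator[OF meas])
    also have "(\<lambda>n. \<integral>\<^sup>+x. u n x \<partial>\<nu>) = (\<lambda>n. emeasure \<nu> (act (f n) -` U \<inter> topspace T))"
      using meas by (auto simp: u_def)
    finally have "c < liminf (\<lambda>n. emeasure \<nu> (act (f n) -` U \<inter> topspace T))"
      using c by order
    then show "\<forall>\<^sub>F n in sequentially. c < emeasure \<nu> (act (f n) -` U \<inter> topspace T)"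
      by (rule less_LiminfD)
  qed
qed

text \<open>If translation by some \<open>g\<close> increased the measure of an open set, lower
  semicontinuity would spread the increase to a neighbourhood of \<open>g\<close>, which contains a
  point of \<open>D\<close>. Applying the resulting inequality to \<open>- g\<close> gives the
  reverse one.\<close>

lemma emeasure_act_dense:
  fixes act :: "'g::lcsc_group \<Rightarrow> 'x \<Rightarrow> 'x"
  assumes G: "G_space T act" and \<nu>: "sets \<nu> = sets (borel_of T)" and D: "closure D = UNIV"
    and inv: "\<And>d U. d \<in> D \<Longrightarrow> openin T U \<Longrightarrow> emeasure \<nu> (act d -` U \<inter> topspace T) = emeasure \<nu> U"
    and U: "openin T U"
  shows "emeasure \<nu> (act g -` U \<inter> topspace T) = emeasure \<nu> U"
proof -
  have le: "emeasure \<nu> (act g -` U \<inter> topspace T) \<le> emeasure \<nu> U" if U: "openin T U" for g U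
  proof (rule ccontr)
    assume "\<not> ?thesis"
    then have "\<forall>\<^sub>F g' in nhds g. emeasure \<nu> U < emeasure \<nu> (act g' -` U \<inter> topspace T)"
      by (intro eventually_less_emeasure_act[OF G \<nu> U]) simp
    then obtain S where S: "open S" "g \<in> S" "\<And>g'. g' \<in> S \<Longrightarrow> emeasure \<nu> U < emeasure \<nu> (act g' -` U \<inter> topspace T)"
      unfolding eventually_nhds by blast
    obtain d where "d \<in> D" "d \<in> S" using dense_meets_open[OF D S(1)] S(2) by blast
    then show False using S(3)[of d] inv[OF _ U] by simp
  qed
  have "emeasure \<nu> U = emeasure \<nu> (act (- g) -` (act g -` U \<inter> topspace T) \<inter> topspace T)"
    unfolding act_vimage_vimage[OF G] using act_vimage_0[OF G openin_subset[OF U]] by simp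
  also have "\<dots> \<le> emeasure \<nu> (act g -` U \<inter> topspace T)" by (rule le[OF act_openin[OF G U]])
  finally show ?thesis using le[OF U] by (rule antisym[rotated])
qed

lemma add_subgroup_closure:
  fixes D :: "'g::topological_group_add set"
  assumes "add_subgroup D"
  shows "add_subgroup (closure D)"
  unfolding add_subgroup_def
proof (intro conjI ballI)
  note D = add_subgroupD[OF assms]
  show "0 \<in> closure D" using D(1) closure_subset by blast
  have "(\<lambda>(x, y). x + y) ` closure (D \<times> D) \<subseteq> closure D"
    by (rule image_closure_subset) (use D(2) in \<open>auto simp: case_prod_unfold intro!: continuous_intros closure_subset[THEN subsetD]\<close>)
  then show "x + y \<in> closure D" if "x \<in> closure D" "y \<in> closure D" for x y
    using that unfolding closure_Times by blast
  have "uminus ` closure D \<subseteq> closure D"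
    by (rule image_closure_subset) (use D(3) in \<open>auto intro!: continuous_intros closure_subset[THEN subsetD]\<close>)
  then show "- x \<in> closure D" if "x \<in> closure D" for x using that by blast
qed

text \<open>The closure of \<open>S\<close> is a closed set of full measure, so it contains the
  support; being a subgroup, it contains what the support generates.\<close>

lemma admissible_dense:
  assumes "admissible m \<mu>" and "add_subgroup S" and "AE g in \<mu>. g \<in> S"
  shows "closure S = UNIV"
proof -
  have \<mu>: "sets \<mu> = sets borel" "add_subgroup hull (measure_support \<mu>) = UNIV"
    using assms(1) by (auto simp: admissible_def)
  have "measure_support \<mu> \<subseteq> closure S"
  proof
    fix x assume x: "x \<in> measure_support \<mu>"
    show "x \<in> closure S"
    proof (rule ccontr)
      assume "x \<notin> closure S"
      then have "emeasure \<mu> (- closure S) \<noteq> 0"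
        using x by (simp add: measure_support_def open_Compl)
      moreover have "AE g in \<mu>. g \<notin> - closure S" using assms(3) closure_subset by (auto elim: eventually_mono)
      then have "emeasure \<mu> (- closure S) = 0"
        by (subst (asm) AE_iff_null_sets[symmetric]) (auto simp: \<mu>)
      ultimately show False by blast
    qed
  qed
  then have "add_subgroup hull (measure_support \<mu>) \<subseteq> closure S"
    by (intro hull_minimal add_subgroup_closure assms)
  then show ?thesis using \<mu>(2) by auto
qed

text \<open>Both integrals compute the product measure of the set of pairs \<open>(k, y)\<close>
  with \<open>act k y \<in> B\<close>. This is the bridge between measures on the space and Haar
  measure along orbits.\<close>

lemma act_fubini:
  fixes act :: "'g::{topological_group_add, second_countable_topology} \<Rightarrow> 'x \<Rightarrow> 'x"
  assumes G: "G_space T act" and \<mu>: "sets \<mu> = sets borel" "sigma_finite_measure \<mu>"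
    and \<nu>: "sets \<nu> = sets (borel_of T)" "sigma_finite_measure \<nu>"
    and B: "B \<in> sets (borel_of T)"
  shows "(\<integral>\<^sup>+ k. emeasure \<nu> (act k -` B \<inter> topspace T) \<partial>\<mu>) = (\<integral>\<^sup>+ y. emeasure \<mu> {k. act k y \<in> B} \<partial>\<nu>)"
    and "(\<lambda>k. emeasure \<nu> (act k -` B \<inter> topspace T)) \<in> borel_measurable borel"
    and "(\<lambda>y. emeasure \<mu> {k. act k y \<in> B}) \<in> borel_measurable (borel_of T)"
    and "y \<in> topspace T \<Longrightarrow> {k. act k y \<in> B} \<in> sets borel"
proof -
  interpret pair_sigma_finite \<mu> \<nu>
    using \<mu> \<nu> by (simp add: pair_sigma_finite_def)
  have sp: "space \<nu> = topspace T" "space \<mu> = UNIV"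
    using sets_eq_imp_space_eq[OF \<nu>(1)] sets_eq_imp_space_eq[OF \<mu>(1)] by auto
  define Q where "Q = (\<lambda>(k, y). act k y) -` B \<inter> space (\<mu> \<Otimes>\<^sub>M \<nu>)"
  have Q: "Q \<in> sets (\<mu> \<Otimes>\<^sub>M \<nu>)"
    unfolding Q_def using B \<nu>(1) by (intro measurable_sets[OF G_space_measurable'(1)[OF G \<mu>(1) \<nu>(1)]]) simp
  have 1: "Pair k -` Q = act k -` B \<inter> topspace T" for k
    by (auto simp: Q_def space_pair_measure sp)
  have 2: "(\<lambda>k. (k, y)) -` Q = {k. act k y \<in> B}" if "y \<in> topspace T" for y
    using that by (auto simp: Q_def space_pair_measure sp)
  show "(\<integral>\<^sup>+ k. emeasure \<nu> (act k -` B \<inter> topspace T) \<partial>\<mu>) = (\<integral>\<^sup>+ y. emeasure \<mu> {k. act k y \<in> B} \<partial>\<nu>)"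
    using emeasure_pair_measure_alt2[OF Q] M2.emeasure_pair_measure_alt[OF Q]
    by (simp add: 1 2 sp cong: nn_integral_cong_simp)
  show "(\<lambda>k. emeasure \<nu> (act k -` B \<inter> topspace T)) \<in> borel_measurable borel"
    using M2.measurable_emeasure_Pair[OF Q]
    by (subst measurable_cong_sets[OF \<mu>(1)[symmetric] refl]) (simp add: 1)
  have "(\<lambda>y. emeasure \<mu> ((\<lambda>k. (k, y)) -` Q)) \<in> borel_measurable \<nu>"
    by (rule measurable_emeasure_Pair2[OF Q])
  then have "(\<lambda>y. emeasure \<mu> {k. act k y \<in> B}) \<in> borel_measurable \<nu>"
    by (subst measurable_cong[of _ _ "\<lambda>y. emeasure \<mu> ((\<lambda>k. (k, y)) -` Q)"]) (simp_all add: 2 sp)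
  then show "(\<lambda>y. emeasure \<mu> {k. act k y \<in> B}) \<in> borel_measurable (borel_of T)"
    using measurable_cong_sets[OF \<nu>(1) refl] by blast
  show "{k. act k y \<in> B} \<in> sets borel" if "y \<in> topspace T"
    using measurable_sets[OF measurable_borel_of_continuous_map[OF G_spaceD(8)[OF G that]] B]
    by (simp add: vimage_def borel_of_euclidean)
qed

section \<open>Haar measure\<close>

lemma G_space_left_translation: "G_space euclidean ((+) :: 'a::topological_group_add \<Rightarrow> 'a \<Rightarrow> 'a)"
proof -
  have "continuous_on UNIV (\<lambda>p :: 'a \<times> 'a. fst p + snd p)" by (intro continuous_intros)
  then show ?thesis
    unfolding G_space_def prod_topology_euclidean case_prod_unfold by (simp add: add.assoc)
qed

lemma translate_sets_borel:
  fixes A :: "'a::{topological_monoid_add, second_countable_topology} set"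
  assumes "A \<in> sets borel"
  shows "(+) g -` A \<in> sets borel"
proof -
  have "(+) g \<in> borel_measurable borel"
    by (intro borel_measurable_continuous_onI continuous_intros)
  from measurable_sets[OF this assms] show ?thesis by simp
qed

lemma uminus_sets_borel:
  fixes A :: "'a::topological_group_add set"
  assumes "A \<in> sets borel"
  shows "uminus -` A \<in> sets borel"
proof -
  have "uminus \<in> borel_measurable (borel :: 'a measure)"
    by (intro borel_measurable_continuous_onI continuous_intros)
  from measurable_sets[OF this assms] show ?thesis by simp
qed

lemma open_relatively_compact_cover:
  obtains A :: "nat \<Rightarrow> 'a::lcsc_group set"
  where "\<And>n. open (A n)" "\<And>n. \<exists>K. compact K \<and> A n \<subseteq> K" "(\<Union>n. A n) = UNIV"
proof -
  define \<V> where "\<V> = {V :: 'a set. open V \<and> (\<exists>K. compact K \<and> V \<subseteq> K)}"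
  obtain \<F> where F: "\<F> \<subseteq> \<V>" "countable \<F>" "\<Union>\<F> = \<Union>\<V>"
    using Lindelof[of \<V>] by (auto simp: \<V>_def)
  have "\<Union>\<V> = UNIV"
  proof (intro equalityI subsetI)
    fix x :: 'a
    obtain V K where "open V" "compact K" "x \<in> V" "V \<subseteq> K"
      using compact_neighbourhood[of UNIV x] by auto
    then show "x \<in> \<Union>\<V>" unfolding \<V>_def by blast
  qed simp
  then have ne: "\<F> \<noteq> {}" and un: "\<Union>\<F> = UNIV" using F(3) by auto
  have "from_nat_into \<F> n \<in> \<V>" for n using from_nat_into[OF ne] F(1) by blast
  moreover have "(\<Union>n. from_nat_into \<F> n) = UNIV"
    using range_from_nat_into[OF ne F(2)] un by simp
  ultimately show ?thesis using that[of "from_nat_into \<F>"] by (auto simp: \<V>_def)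
qed

lemma emeasure_relatively_compact_finite:
  fixes m :: "'a::lcsc_group measure"
  assumes "sets m = sets borel" "\<And>K. compact K \<Longrightarrow> emeasure m K < \<infinity>" "compact K" "A \<subseteq> K"
  shows "emeasure m A \<noteq> \<infinity>"
proof -
  have "emeasure m A \<le> emeasure m K"
    using assms(1,3,4) by (intro emeasure_mono) (auto intro: borel_compact)
  also have "\<dots> < \<infinity>" using assms by auto
  finally show ?thesis by simp
qed

lemma sigma_finite_finite_on_compact:
  fixes m :: "'a::lcsc_group measure"
  assumes "sets m = sets borel" "\<And>K. compact K \<Longrightarrow> emeasure m K < \<infinity>"
  shows "sigma_finite_measure m"
proof -
  obtain A :: "nat \<Rightarrow> 'a set" where A: "\<And>n. open (A n)" "\<And>n. \<exists>K. compact K \<and> A n \<subseteq> K" "(\<Union>n. A n) = UNIV"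
    using open_relatively_compact_cover by metis
  have "emeasure m (A n) \<noteq> \<infinity>" for n
    using A(2)[of n] emeasure_relatively_compact_finite[OF assms] by blast
  then show ?thesis
    using A sets_eq_imp_space_eq[OF assms(1)] assms(1)
    by (intro sigma_finite_measure.intro exI[of _ "range A"]) auto
qed

lemma translation_invariant_of_open:
  fixes m :: "'a::lcsc_group measure"
  assumes m: "sets m = sets borel" "\<And>K. compact K \<Longrightarrow> emeasure m K < \<infinity>"
    and inv: "\<And>g U. open U \<Longrightarrow> emeasure m ((+) g -` U) = emeasure m U"
  shows "distr m m ((+) g) = m"
proof -
  obtain A :: "nat \<Rightarrow> 'a set" where A: "\<And>n. open (A n)" "\<And>n. \<exists>K. compact K \<and> A n \<subseteq> K" "(\<Union>n. A n) = UNIV"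
    using open_relatively_compact_cover by metis
  have fin: "emeasure m (A n) \<noteq> \<infinity>" for n
    using A(2)[of n] emeasure_relatively_compact_finite[OF m] by blast
  have meas: "(+) g \<in> m \<rightarrow>\<^sub>M m"
    using G_space_measurable'(2)[OF G_space_left_translation] m(1) by (simp add: borel_of_euclidean)
  have eq: "emeasure (distr m m ((+) g)) U = emeasure m U" if "open U" for U
    using that meas m(1) sets_eq_imp_space_eq[OF m(1)] inv[OF that] by (subst emeasure_distr) auto
  show ?thesis
    by (rule measure_eqI_generator_eq[where E="{U. open U}" and \<Omega>=UNIV and A=A])
      (use A fin eq m(1) in \<open>auto simp: Int_stable_def borel_def\<close>)
qed

context
  fixes m :: "'a::lcsc_group measure"
  assumes m: "left_haar_measure m"
begin

lemma left_haar_measure_sets: "sets m = sets borel" "space m = UNIV"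
  using m sets_eq_imp_space_eq[of m borel] by (auto simp: left_haar_measure_def)

lemma left_haar_measure_sigma_finite: "sigma_finite_measure m"
  using m by (intro sigma_finite_finite_on_compact) (auto simp: left_haar_measure_def)

lemma left_haar_measure_UNIV: "emeasure m UNIV \<noteq> 0"
  using m by (auto simp: left_haar_measure_def)

lemma left_haar_measure_translate:
  assumes "A \<in> sets borel"
  shows "emeasure m ((+) g -` A) = emeasure m A"
proof -
  have "emeasure m A = emeasure (distr m m ((+) g)) A"
    using m by (simp add: left_haar_measure_def)
  also have "\<dots> = emeasure m ((+) g -` A \<inter> space m)"
    using assms G_space_measurable'(2)[OF G_space_left_translation, of m m g] left_haar_measure_sets
    by (intro emeasure_distr) (auto simp: borel_of_euclidean)
  finally show ?thesis using left_haar_measure_sets by simp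
qed

text \<open>Integrate the indicator of \<open>- y + x \<in> E\<close> in both orders.\<close>

lemma left_invariant_null_uminus:
  assumes l: "sets l = sets borel" "sigma_finite_measure l" "emeasure l UNIV \<noteq> 0"
    and inv: "\<And>g A. A \<in> sets borel \<Longrightarrow> emeasure l ((+) g -` A) = emeasure l A"
    and E: "E \<in> sets borel" "emeasure l E = 0"
  shows "emeasure m (uminus -` E) = 0"
proof -
  interpret pair_sigma_finite l m
    using l left_haar_measure_sigma_finite by (simp add: pair_sigma_finite_def)
  have "(\<lambda>(x, y). - y + x) \<in> borel_measurable (borel :: ('a \<times> 'a) measure)"
    unfolding case_prod_unfold by (intro borel_measurable_continuous_onI continuous_intros)
  from measurable_sets[OF this E(1)]
  have "(\<lambda>(x, y). - y + x) -` E \<in> sets (borel :: ('a \<times> 'a) measure)" by simp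
  then have Q: "(\<lambda>(x, y). - y + x) -` E \<in> sets (l \<Otimes>\<^sub>M m)"
    unfolding borel_prod[symmetric] sets_pair_measure_cong[OF l(1) left_haar_measure_sets(1)] .
  have 1: "Pair x -` (\<lambda>(x, y). - y + x) -` E = (+) (- x) -` (uminus -` E)" for x
    by (auto simp: minus_add)
  have 2: "(\<lambda>x. (x, y)) -` (\<lambda>(x, y). - y + x) -` E = (+) (- y) -` E" for y by auto
  have "emeasure l UNIV * emeasure m (uminus -` E) = (\<integral>\<^sup>+x. emeasure m (uminus -` E) \<partial>l)"
    using sets_eq_imp_space_eq[OF l(1)] by (simp add: mult.commute)
  also have "\<dots> = emeasure (l \<Otimes>\<^sub>M m) ((\<lambda>(x, y). - y + x) -` E)"
    unfolding M2.emeasure_pair_measure_alt[OF Q] 1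
    using left_haar_measure_translate[OF uminus_sets_borel[OF E(1)]] by simp
  also have "\<dots> = 0"
    unfolding emeasure_pair_measure_alt2[OF Q] 2 using inv[OF E(1)] E(2) by simp
  finally show ?thesis using l(3) by simp
qed

text \<open>Takes the place of the modular function: in a group that is not unimodular inversion
  changes Haar measure, but not its null sets.\<close>

lemma left_haar_null_uminus:
  assumes "E \<in> sets borel" "emeasure m E = 0"
  shows "emeasure m (uminus -` E) = 0"
  using left_invariant_null_uminus[OF left_haar_measure_sets(1) left_haar_measure_sigma_finite
      left_haar_measure_UNIV left_haar_measure_translate assms] by blast

text \<open>Right translation is left translation conjugated by inversion.\<close>

lemma left_haar_null_right_translate:
  assumes E: "E \<in> sets borel" "emeasure m E = 0"
  shows "emeasure m ((\<lambda>x. x + h) -` E) = 0"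
proof -
  have F: "uminus -` E \<in> sets borel" by (rule uminus_sets_borel[OF E(1)])
  have "emeasure m ((+) (- h) -` (uminus -` E)) = 0"
    using left_haar_measure_translate[OF F] left_haar_null_uminus[OF E] by simp
  moreover have "(+) (- h) -` (uminus -` E) \<in> sets borel"
    by (rule translate_sets_borel[OF F])
  ultimately have "emeasure m (uminus -` ((+) (- h) -` (uminus -` E))) = 0"
    by (intro left_haar_null_uminus)
  moreover have "uminus -` ((+) (- h) -` (uminus -` E)) = (\<lambda>x. x + h) -` E"
    by (auto simp: minus_add)
  ultimately show ?thesis by simp
qed

text \<open>The translates of \<open>U\<close> cover the group and by Lindelof countably many do, so
  a null \<open>U\<close> would make the whole measure vanish.\<close>

lemma left_haar_open_pos:
  assumes U: "open U" "U \<noteq> {}"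
  shows "emeasure m U \<noteq> 0"
proof
  assume 0: "emeasure m U = 0"
  obtain u where u: "u \<in> U" using U by blast
  have op: "open ((+) g -` U)" for g
    by (intro open_vimage U continuous_intros)
  obtain \<F> where F: "\<F> \<subseteq> range (\<lambda>g. (+) g -` U)" "countable \<F>" "\<Union>\<F> = \<Union>(range (\<lambda>g. (+) g -` U))"
    using Lindelof[of "range (\<lambda>g. (+) g -` U)"] op by blast
  have "x \<in> (+) (u - x) -` U" for x using u by simp
  then have "\<Union>\<F> = UNIV" unfolding F(3) by blast
  moreover have "\<Union>\<F> \<in> null_sets m"
    using F op 0 left_haar_measure_translate[of U] U left_haar_measure_sets
    by (intro null_sets_UN'[of \<F> "\<lambda>x. x", simplified]) (auto simp: null_sets_def)
  ultimately show False using left_haar_measure_UNIV by auto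
qed

text \<open>The restriction of Haar measure to \<open>\<psi>\<close> is again left invariant, so its null sets
  are those of \<open>m\<close> unless it vanishes.\<close>

lemma left_haar_dense_invariant:
  assumes D: "closure D = UNIV" and \<psi>: "\<psi> \<in> sets borel"
    and inv: "\<And>d x. d \<in> D \<Longrightarrow> d + x \<in> \<psi> \<longleftrightarrow> x \<in> \<psi>"
  shows "emeasure m \<psi> = 0 \<or> emeasure m (- \<psi>) = 0"
proof (cases "emeasure m \<psi> = 0")
  case False
  define l where "l = density m (indicator \<psi>)"
  have sets_l: "sets l = sets borel" by (simp add: l_def left_haar_measure_sets)
  have l: "emeasure l A = emeasure m (\<psi> \<inter> A)" if "A \<in> sets borel" for A
    unfolding l_def using that \<psi> borel_measurable_indicator[of \<psi> m]
    by (subst emeasure_density) (auto simp: left_haar_measure_sets indicator_inter_arith[symmetric])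
  have fin: "emeasure l K < \<infinity>" if K: "compact K" for K
  proof -
    have "emeasure l K \<le> emeasure m K"
      using K \<psi> compact_imp_closed[OF K] by (subst l) (auto simp: left_haar_measure_sets intro!: emeasure_mono)
    also have "\<dots> < \<infinity>" using m K by (auto simp: left_haar_measure_def)
    finally show ?thesis .
  qed
  have "emeasure l ((+) d -` U) = emeasure l U" if "d \<in> D" "open U" for d U
  proof -
    have eq: "\<psi> \<inter> (+) d -` U = (+) d -` (\<psi> \<inter> U)" using inv[OF that(1)] by auto
    have "emeasure l ((+) d -` U) = emeasure m ((+) d -` (\<psi> \<inter> U))"
      unfolding eq[symmetric] using that by (intro l translate_sets_borel) auto
    also have "\<dots> = emeasure m (\<psi> \<inter> U)"
      using that \<psi> by (intro left_haar_measure_translate) auto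
    also have "\<dots> = emeasure l U" using that by (simp add: l)
    finally show ?thesis .
  qed
  then have "emeasure l ((+) g -` U) = emeasure l U" if "open U" for g U
    using emeasure_act_dense[OF G_space_left_translation _ D, of l U g] that sets_l
    by (simp add: borel_of_euclidean)
  then have "distr l l ((+) g) = l" for g
    using translation_invariant_of_open[OF sets_l fin] by blast
  then have trans: "emeasure l ((+) g -` A) = emeasure l A" if "A \<in> sets borel" for g A
    using that sets_l sets_eq_imp_space_eq[OF sets_l]
      emeasure_distr[OF G_space_measurable'(2)[OF G_space_left_translation, of l l g]]
    by (metis borel_of_euclidean Int_UNIV_right space_borel)
  have "emeasure l UNIV \<noteq> 0" using False by (simp add: l)
  moreover have "emeasure l (- \<psi>) = 0" using \<psi> by (simp add: l)
  \<comment> \<open>The measure \<open>l\<close> vanishes on the complement of \<psi>. Comparing the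
    null sets of \<open>l\<close> and \<open>m\<close> costs one inversion, which a second inversion
    undoes.\<close>
  ultimately have "emeasure m (uminus -` (- \<psi>)) = 0"
    using left_invariant_null_uminus[OF sets_l sigma_finite_finite_on_compact[OF sets_l fin] _ trans, of "- \<psi>"] \<psi>
    by auto
  then have "emeasure m (uminus -` (uminus -` (- \<psi>))) = 0"
    by (rule left_haar_null_uminus[OF uminus_sets_borel[OF borel_comp[OF \<psi>]]])
  moreover have "uminus -` (uminus -` (- \<psi>)) = - \<psi>" by auto
  ultimately show ?thesis by simp
qed simp

end

lemma left_haar_measure_pair:
  fixes m :: "'a::lcsc_group measure" and n :: "'b::lcsc_group measure"
  assumes m: "left_haar_measure m" and n: "left_haar_measure n"
  shows "left_haar_measure (m \<Otimes>\<^sub>M n)"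
proof -
  interpret pair_sigma_finite m n
    using left_haar_measure_sigma_finite[OF m] left_haar_measure_sigma_finite[OF n]
    by (simp add: pair_sigma_finite_def)
  note s = left_haar_measure_sets[OF m] left_haar_measure_sets[OF n]
  have sets: "sets (m \<Otimes>\<^sub>M n) = sets borel"
    unfolding borel_prod[symmetric] by (rule sets_pair_measure_cong) (use s in auto)
  have "emeasure (m \<Otimes>\<^sub>M n) UNIV = emeasure m UNIV * emeasure n UNIV"
    using M2.emeasure_pair_measure_Times[of UNIV m UNIV] s by simp
  then have "emeasure (m \<Otimes>\<^sub>M n) UNIV \<noteq> 0"
    using left_haar_measure_UNIV[OF m] left_haar_measure_UNIV[OF n] by simp
  moreover have "emeasure (m \<Otimes>\<^sub>M n) K < \<infinity>" if K: "compact K" for K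
  proof -
    have c: "compact (fst ` K)" "compact (snd ` K)"
      using K by (auto intro!: compact_continuous_image continuous_intros)
    then have "fst ` K \<in> sets m" "snd ` K \<in> sets n" by (auto simp: s compact_imp_closed)
    moreover have "K \<subseteq> fst ` K \<times> snd ` K" by force
    ultimately have "emeasure (m \<Otimes>\<^sub>M n) K \<le> emeasure m (fst ` K) * emeasure n (snd ` K)"
      by (subst M2.emeasure_pair_measure_Times[symmetric]) (auto intro!: emeasure_mono)
    also have "\<dots> < \<infinity>"
      using c m n by (auto simp: left_haar_measure_def ennreal_mult_less_top)
    finally show ?thesis .
  qed
  moreover have "distr (m \<Otimes>\<^sub>M n) (m \<Otimes>\<^sub>M n) ((+) g) = m \<Otimes>\<^sub>M n" for g
  proof -
    have 1: "distr m m ((+) (fst g)) = m" "distr n n ((+) (snd g)) = n"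
      using m n by (auto simp: left_haar_measure_def)
    have "distr m m ((+) (fst g)) \<Otimes>\<^sub>M distr n n ((+) (snd g))
        = distr (m \<Otimes>\<^sub>M n) (m \<Otimes>\<^sub>M n) (\<lambda>(x, y). (fst g + x, snd g + y))"
    proof (rule pair_measure_distr)
      show "(+) (fst g) \<in> m \<rightarrow>\<^sub>M m" "(+) (snd g) \<in> n \<rightarrow>\<^sub>M n"
        using G_space_measurable'(2)[OF G_space_left_translation] s by (auto simp: borel_of_euclidean)
    qed (simp add: 1 M2.sigma_finite_measure_axioms)
    moreover have "(\<lambda>(x, y). (fst g + x, snd g + y)) = (+) g"
      by (auto simp: plus_prod_def)
    ultimately show ?thesis by (simp add: 1)
  qed
  ultimately show ?thesis using sets by (simp add: left_haar_measure_def)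
qed

section \<open>Coset spaces\<close>

lemma G_space_hom:
  fixes act :: "'g::topological_group_add \<Rightarrow> 'x \<Rightarrow> 'x" and f :: "'k::topological_group_add \<Rightarrow> 'g"
  assumes "G_space T act" "continuous_on UNIV f" "f 0 = 0" "\<And>a b. f (a + b) = f a + f b"
  shows "G_space T (\<lambda>k. act (f k))"
proof -
  have "continuous_map (prod_topology euclidean T) (prod_topology euclidean T) (\<lambda>p. (f (fst p), snd p))"
    using continuous_map_compose[OF continuous_map_fst, of euclidean euclidean f T] assms(2)
    by (auto simp: continuous_map_pairwise comp_def continuous_map_snd)
  from continuous_map_compose[OF this G_spaceD(6)[OF assms(1)]]
  have "continuous_map (prod_topology euclidean T) T (\<lambda>(k, x). act (f k) x)"
    by (simp add: comp_def case_prod_unfold)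
  then show ?thesis
    using G_spaceD(2,3)[OF assms(1)] assms(3,4) unfolding G_space_def by simp
qed

lemma invariant_prob_hom:
  "invariant_prob T act \<nu> \<Longrightarrow> invariant_prob T (\<lambda>k. act (f k)) \<nu>"
  by (simp add: invariant_prob_def)

lemma translate_translate: "translate g (translate h A) = translate (g + h) A"
  by (auto simp: translate_def image_image add.assoc)

lemma translate_0 [simp]: "translate 0 A = A"
  by (auto simp: translate_def)

lemma mem_translate: "x \<in> translate g A \<longleftrightarrow> - g + x \<in> A" for x :: "'a::group_add"
proof
  assume "- g + x \<in> A"
  then have "g + (- g + x) \<in> translate g A" unfolding translate_def by blast
  then show "x \<in> translate g A" by (simp add: add.assoc[symmetric])
qed (auto simp: translate_def add.assoc[symmetric])

lemma translate_subset_iff: "translate g A \<subseteq> translate g B \<longleftrightarrow> A \<subseteq> (B :: 'a::group_add set)"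
  unfolding translate_def by (rule inj_image_subset_iff) (simp add: inj_on_def)

locale closed_subgroup =
  fixes \<Gamma> :: "'a::lcsc_group set"
  assumes subgroup: "add_subgroup \<Gamma>" and closed: "closed \<Gamma>"
begin

abbreviation "\<pi> \<equiv> \<lambda>l. translate l \<Gamma>"

lemma mem_coset: "x \<in> \<pi> l \<longleftrightarrow> (\<exists>\<gamma>\<in>\<Gamma>. x = l + \<gamma>)"
  by (auto simp: translate_def)

lemma coset_eq_iff: "\<pi> l = \<pi> k \<longleftrightarrow> k \<in> \<pi> l"
proof
  assume "\<pi> l = \<pi> k"
  then show "k \<in> \<pi> l" using add_subgroupD(1)[OF subgroup] by (auto simp: mem_translate)
next
  assume "k \<in> \<pi> l"
  then obtain \<gamma> where \<gamma>: "\<gamma> \<in> \<Gamma>" "k = l + \<gamma>" by (auto simp: mem_coset)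
  have "\<Gamma> = translate \<gamma> \<Gamma>"
    using add_subgroupD[OF subgroup] \<gamma>(1)
    by (auto simp: mem_translate) (metis add.assoc add_0 right_minus add_minus_cancel)
  then show "\<pi> l = \<pi> k" using \<gamma>(2) by (simp flip: translate_translate)
qed

lemma coset_add: "\<gamma> \<in> \<Gamma> \<Longrightarrow> \<pi> (l + \<gamma>) = \<pi> l"
  using coset_eq_iff mem_coset by metis

lemma closed_coset: "closed (\<pi> l)"
proof -
  have "closed ((\<lambda>x. - l + x) -` \<Gamma>)" by (intro closed_vimage closed continuous_intros)
  moreover have "(\<lambda>x. - l + x) -` \<Gamma> = \<pi> l" by (auto simp: mem_translate)
  ultimately show ?thesis by simp
qed

text \<open>This is the saturation of \<open>O'\<close> under \<Gamma>, a union of right translates.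
  Together with \<open>coset_mem_image\<close> it says that the quotient map is open.\<close>

lemma open_meets: "open O' \<Longrightarrow> open {l. \<pi> l \<inter> O' \<noteq> {}}"
proof -
  assume "open O'"
  then have "open (\<Union>\<gamma>\<in>\<Gamma>. {l. 0 + l + \<gamma> \<in> O'})" by (intro open_UN ballI open_translate_vimage)
  moreover have "{l. \<pi> l \<inter> O' \<noteq> {}} = (\<Union>\<gamma>\<in>\<Gamma>. {l. 0 + l + \<gamma> \<in> O'})"
    unfolding translate_def by auto
  ultimately show ?thesis by simp
qed

lemma closed_meets: "compact K \<Longrightarrow> closed {l. \<pi> l \<inter> K \<noteq> {}}"
proof -
  assume "compact K"
  from compact_plus_closed[OF this closed] have "closed {k + c |k c. k \<in> K \<and> c \<in> \<Gamma>}" .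
  moreover have "{k + c |k c. k \<in> K \<and> c \<in> \<Gamma>} = {l. \<pi> l \<inter> K \<noteq> {}}"
  proof (intro set_eqI iffI)
    fix l assume "l \<in> {l. \<pi> l \<inter> K \<noteq> {}}"
    then obtain \<gamma> where "\<gamma> \<in> \<Gamma>" "l + \<gamma> \<in> K" by (auto simp: mem_coset)
    moreover have "l = (l + \<gamma>) + - \<gamma>" by (simp add: add.assoc)
    moreover have "- \<gamma> \<in> \<Gamma>" using calculation(1) add_subgroupD(3)[OF subgroup] by blast
    ultimately show "l \<in> {k + c |k c. k \<in> K \<and> c \<in> \<Gamma>}" by blast
  next
    fix l assume "l \<in> {k + c |k c. k \<in> K \<and> c \<in> \<Gamma>}"
    then obtain k c where kc: "k \<in> K" "c \<in> \<Gamma>" "l = k + c" by blast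
    then have "k = l + - c" by (simp add: add.assoc)
    then have "k \<in> \<pi> l" using kc add_subgroupD(3)[OF subgroup] mem_coset by blast
    then show "l \<in> {l. \<pi> l \<inter> K \<noteq> {}}" using kc by blast
  qed
  ultimately show ?thesis by simp
qed

lemma coset_mem_image: "\<pi> l \<in> \<pi> ` S \<longleftrightarrow> \<pi> l \<inter> S \<noteq> {}"
  using coset_eq_iff by (auto simp: image_iff)

lemma topspace_Y: "topspace (coset_topology \<Gamma>) = range \<pi>"
  by (rule topspace_coset_topology)

lemma open_image: "open S \<Longrightarrow> openin (coset_topology \<Gamma>) (\<pi> ` S)"
  unfolding openin_coset_topology coset_mem_image by (simp add: open_meets image_mono)

text \<open>The form in which the separation of the coset space enters; it rests on the closedness
  of \<Gamma> through \<open>closed_meets\<close>.\<close>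

lemma closedin_compact_image: "compact S \<Longrightarrow> closedin (coset_topology \<Gamma>) (\<pi> ` S)"
proof -
  assume "compact S"
  then have "open (- {l. \<pi> l \<inter> S \<noteq> {}})" by (intro open_Compl closed_meets)
  moreover have "{l. \<pi> l \<in> range \<pi> - \<pi> ` S} = - {l. \<pi> l \<inter> S \<noteq> {}}"
    using coset_mem_image by blast
  ultimately show ?thesis
    unfolding closedin_def topspace_Y openin_coset_topology by auto
qed

lemma openin_vimage: "openin (coset_topology \<Gamma>) U \<Longrightarrow> open {l. \<pi> l \<in> U}"
  by (simp add: openin_coset_topology)

text \<open>Plays the role of inner regularity: an inequality of measures on closed sets passes to
  open sets along an increasing union.\<close>

lemma openin_sigma_closedin:
  assumes "openin (coset_topology \<Gamma>) U"
  obtains F :: "nat \<Rightarrow> 'a set set" where "\<And>n. closedin (coset_topology \<Gamma>) (F n)" "(\<Union>n. F n) = U"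
proof -
  obtain K :: "nat \<Rightarrow> 'a set" where K: "\<And>n. compact (K n)" "(\<Union>n. K n) = {l. \<pi> l \<in> U}"
    using open_sigma_compact[OF openin_vimage[OF assms]] by metis
  have "(\<Union>n. \<pi> ` K n) = \<pi> ` {l. \<pi> l \<in> U}" unfolding K(2)[symmetric] by blast
  also have "\<dots> = U" using assms by (auto simp: openin_coset_topology)
  finally show ?thesis using that[of "\<lambda>n. \<pi> ` K n"] closedin_compact_image[OF K(1)] by blast
qed

lemma G_space_coset: "G_space (coset_topology \<Gamma>) translate"
proof -
  have "continuous_map (prod_topology euclidean (coset_topology \<Gamma>)) (coset_topology \<Gamma>) (\<lambda>(g, y). translate g y)"
    unfolding continuous_map_def
  proof (intro conjI allI impI)
    show "(\<lambda>(g, y). translate g y) \<in> topspace (prod_topology euclidean (coset_topology \<Gamma>)) \<rightarrow> topspace (coset_topology \<Gamma>)"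
      by (auto simp: topspace_Y translate_translate)
    fix U assume U: "openin (coset_topology \<Gamma>) U"
    let ?S = "{x \<in> topspace (prod_topology euclidean (coset_topology \<Gamma>)). (case x of (g, y) \<Rightarrow> translate g y) \<in> U}"
    show "openin (prod_topology euclidean (coset_topology \<Gamma>)) ?S"
    proof (subst openin_subopen, intro ballI)
      fix p assume p: "p \<in> ?S"
      then obtain g l where gl: "p = (g, \<pi> l)" "\<pi> (g + l) \<in> U"
        by (auto simp: topspace_Y translate_translate)
      have "open ((\<lambda>(g, l). g + l) -` {l. \<pi> l \<in> U})"
        unfolding case_prod_unfold by (intro open_vimage openin_vimage[OF U] continuous_intros)
      moreover have "(g, l) \<in> (\<lambda>(g, l). g + l) -` {l. \<pi> l \<in> U}" using gl by simp
      ultimately obtain A B where AB: "open A" "open B" "(g, l) \<in> A \<times> B"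
          "A \<times> B \<subseteq> (\<lambda>(g, l). g + l) -` {l. \<pi> l \<in> U}"
        by (metis open_prod_elim)
      have "openin (prod_topology euclidean (coset_topology \<Gamma>)) (A \<times> \<pi> ` B)"
        using AB by (simp add: openin_prod_Times_iff open_image)
      moreover have "p \<in> A \<times> \<pi> ` B" using AB gl by auto
      moreover have "A \<times> \<pi> ` B \<subseteq> ?S"
        using AB(4) by (auto simp: topspace_Y translate_translate)
      ultimately show "\<exists>T. openin (prod_topology euclidean (coset_topology \<Gamma>)) T \<and> p \<in> T \<and> T \<subseteq> ?S"
        by blast
    qed
  qed
  then show ?thesis unfolding G_space_def by (simp add: translate_translate)
qed

end

text \<open>By invariance and Fubini, \<open>emeasure m B\<close> times the Haar mass of the group
  is the integral over \<open>y\<close> of the Haar measure of \<open>{g. act g y \<in> B}\<close>.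
  The mass may be infinite, but it is not zero.\<close>

lemma null_of_AE_orbit:
  fixes act :: "'g::lcsc_group \<Rightarrow> 'x \<Rightarrow> 'x"
  assumes G: "G_space T act" and k: "left_haar_measure k" and m: "invariant_prob T act m"
    and B: "B \<in> sets (borel_of T)" and null: "\<And>y. y \<in> topspace T \<Longrightarrow> emeasure k {g. act g y \<in> B} = 0"
  shows "emeasure m B = 0"
proof -
  note m' = m[unfolded invariant_prob_iff[OF G]]
  note mD = borel_prob_onD[OF conjunct1[OF m']]
  have "emeasure m B * emeasure k UNIV = (\<integral>\<^sup>+ g. emeasure m (act g -` B \<inter> topspace T) \<partial>k)"
    using m' B by (simp add: left_haar_measure_sets[OF k])
  also have "\<dots> = (\<integral>\<^sup>+ y. emeasure k {g. act g y \<in> B} \<partial>m)"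
    by (rule act_fubini(1)[OF G left_haar_measure_sets(1)[OF k] left_haar_measure_sigma_finite[OF k]
          mD(2) prob_space_imp_sigma_finite[OF mD(1)] B])
  also have "\<dots> = (\<integral>\<^sup>+ y. 0 \<partial>m)" by (intro nn_integral_cong null) (simp add: mD)
  finally show ?thesis using left_haar_measure_UNIV[OF k] by simp
qed

text \<open>The identity behind \<open>null_of_AE_orbit\<close>, read backwards, gives the claim for
  almost every point, hence for some \<open>x\<close>. Transitivity and right translation of Haar
  null sets carry it from \<open>x\<close> to every \<open>y\<close>.\<close>

lemma AE_orbit_of_null:
  fixes act :: "'g::lcsc_group \<Rightarrow> 'x \<Rightarrow> 'x"
  assumes G: "G_space T act" and k: "left_haar_measure k" and m: "invariant_prob T act m"
    and B: "B \<in> sets (borel_of T)" and null: "emeasure m B = 0"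
    and trans: "\<And>x y. x \<in> topspace T \<Longrightarrow> y \<in> topspace T \<Longrightarrow> \<exists>g. act g x = y"
    and y: "y \<in> topspace T"
  shows "emeasure k {g. act g y \<in> B} = 0"
proof -
  note m' = m[unfolded invariant_prob_iff[OF G]]
  note mD = borel_prob_onD[OF conjunct1[OF m']]
  note fub = act_fubini[OF G left_haar_measure_sets(1)[OF k] left_haar_measure_sigma_finite[OF k]
          mD(2) prob_space_imp_sigma_finite[OF mD(1)] B]
  interpret prob_space m by (rule mD(1))
  have "(\<integral>\<^sup>+ y. emeasure k {g. act g y \<in> B} \<partial>m) = 0"
    unfolding fub(1)[symmetric] using m' B null by simp
  then have "AE y in m. emeasure k {g. act g y \<in> B} = 0"
    using fub(3) by (subst (asm) nn_integral_0_iff_AE) (simp_all cong: measurable_cong_sets add: mD(2))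
  then obtain x where x: "x \<in> topspace T" "emeasure k {g. act g x \<in> B} = 0"
    using eventually_happens'[OF ae_filter_bot eventually_conj[OF AE_space]] mD(3) by auto
  obtain h where h: "act h x = y" using trans x(1) y by blast
  have "{g. act g y \<in> B} = (\<lambda>g. g + h) -` {g. act g x \<in> B}"
    using G_spaceD(3)[OF G x(1)] h by auto
  then show ?thesis using left_haar_null_right_translate[OF k fub(4)[OF x(1)] x(2), of h] by simp
qed

section \<open>Stationary measures on the coset space\<close>

locale irreducible_lattice = closed_subgroup \<Gamma>
  for \<Gamma> :: "('g::lcsc_group \<times> 'h::lcsc_group) set" +
  fixes m\<^sub>G :: "'g measure" and m\<^sub>H :: "'h measure" and m :: "('g \<times> 'h) set measure"
  assumes haar_G: "left_haar_measure m\<^sub>G" and haar_H: "left_haar_measure m\<^sub>H"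
    and dense: "closure (snd ` \<Gamma>) = UNIV"
    and inv: "invariant_prob (coset_topology \<Gamma>) translate m"
begin

abbreviation "Y \<equiv> coset_topology \<Gamma>"
abbreviation act\<^sub>G :: "'g \<Rightarrow> ('g \<times> 'h) set \<Rightarrow> ('g \<times> 'h) set" where "act\<^sub>G \<equiv> \<lambda>g. translate (g, 0)"
abbreviation act\<^sub>H :: "'h \<Rightarrow> ('g \<times> 'h) set \<Rightarrow> ('g \<times> 'h) set" where "act\<^sub>H \<equiv> \<lambda>h. translate (0, h)"

lemma G_space_G: "G_space Y act\<^sub>G"
  by (rule G_space_hom[OF G_space_coset]) (auto intro!: continuous_intros simp: zero_prod_def)

lemma G_space_H: "G_space Y act\<^sub>H"
  by (rule G_space_hom[OF G_space_coset]) (auto intro!: continuous_intros simp: zero_prod_def)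

lemmas inv_G = invariant_prob_hom[OF inv, of "\<lambda>g. (g, 0)"]
lemmas inv_H = invariant_prob_hom[OF inv, of "\<lambda>h. (0, h)"]

lemma m_prob: "borel_prob_on Y m" using inv by (simp add: invariant_prob_def)

lemmas m_props = borel_prob_onD[OF m_prob]

sublocale m: prob_space m by (rule m_props(1))

lemma m_act: "A \<in> sets (borel_of Y) \<Longrightarrow> emeasure m (translate l -` A \<inter> topspace Y) = emeasure m A"
  using inv unfolding invariant_prob_iff[OF G_space_coset] by blast

lemma coset_trans: "x \<in> topspace Y \<Longrightarrow> y \<in> topspace Y \<Longrightarrow> \<exists>g. translate g x = y"
proof -
  assume "x \<in> topspace Y" "y \<in> topspace Y"
  then obtain k l where "x = \<pi> k" "y = \<pi> l" by (auto simp: topspace_Y)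
  then have "translate (l + - k) x = y" by (simp add: translate_translate add.assoc)
  then show ?thesis ..
qed

lemma continuous_map_coset:
  "continuous_on UNIV f \<Longrightarrow> continuous_map euclidean Y (\<lambda>x. \<pi> (f x))"
  using continuous_map_compose[OF _ quotient_imp_continuous_map[OF quotient_map_coset_topology[of \<Gamma>]], of euclidean f]
  by (simp add: comp_def)

text \<open>A \<open>G\<close>-invariant set is determined by the cosets \<open>\<pi> (0, h)\<close>
  in it, because every coset is a \<open>G\<close>-translate of one of these. The sign in
  \<open>- h\<close> makes the right action of \<Gamma> on representatives appear as left
  translation on \<open>H\<close>, as needed later; inversion does not affect null sets.\<close>

lemma ergodic_strict:
  assumes B: "B \<in> sets (borel_of Y)"
    and inv: "\<And>g y. y \<in> topspace Y \<Longrightarrow> act\<^sub>G g y \<in> B \<longleftrightarrow> y \<in> B"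
    and null: "emeasure m\<^sub>H {h. \<pi> (0, - h) \<in> B} = 0"
  shows "emeasure m B = 0"
proof (rule null_of_AE_orbit[OF G_space_H haar_H inv_H B])
  have cm: "continuous_map euclidean Y (\<lambda>h. \<pi> (0, - h))"
    by (intro continuous_map_coset continuous_intros)
  have \<psi>: "{h. \<pi> (0, - h) \<in> B} \<in> sets borel"
    using measurable_sets[OF measurable_borel_of_continuous_map[OF cm] B]
    by (simp add: borel_of_euclidean vimage_def)
  fix y assume "y \<in> topspace Y"
  then obtain g k where y: "y = \<pi> (g, k)" by (auto simp: topspace_Y)
  have "act\<^sub>H h y \<in> B \<longleftrightarrow> \<pi> (0, h + k) \<in> B" for h
  proof -
    have "act\<^sub>H h y = act\<^sub>G g (\<pi> (0, h + k))" by (simp add: y translate_translate)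
    then show ?thesis using inv[of "\<pi> (0, h + k)" g] by (simp add: topspace_Y)
  qed
  then have "{h. act\<^sub>H h y \<in> B} = (\<lambda>h. h + k) -` uminus -` {h. \<pi> (0, - h) \<in> B}"
    by auto
  then show "emeasure m\<^sub>H {h. act\<^sub>H h y \<in> B} = 0"
    using left_haar_null_right_translate[OF haar_H uminus_sets_borel[OF \<psi>]
      left_haar_null_uminus[OF haar_H \<psi> null]] by simp
qed

text \<open>\<open>A\<close> is replaced by the strictly invariant set of those \<open>y\<close> for which \<open>g y \<in> A\<close> for almost all
  \<open>g\<close>; this set comes from a subset of \<open>H\<close> invariant under the dense group \<open>\<pi>\<^sub>H(\<Gamma>)\<close>.\<close>

lemma ergodic:
  assumes A: "A \<in> sets (borel_of Y)"
    and ainv: "\<And>g. emeasure m (A - act\<^sub>G g -` A) = 0"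
  shows "emeasure m A = 0 \<or> emeasure m (topspace Y - A) = 0"
proof -
  define Ac where "Ac = topspace Y - A"
  have Ac: "Ac \<in> sets (borel_of Y)" unfolding Ac_def using A sets.compl_sets[OF A] by simp
  have Asub: "A \<subseteq> topspace Y" using sets.sets_into_space[OF A] by simp
  note Gm = left_haar_measure_sets(1)[OF haar_G] left_haar_measure_sigma_finite[OF haar_G]
  note fub = act_fubini[OF G_space_G Gm m_props(2) m.sigma_finite_measure_axioms]
  define A' where "A' = {y \<in> topspace Y. emeasure m\<^sub>G {g. act\<^sub>G g y \<in> Ac} = 0}"
  have "(\<lambda>y. emeasure m\<^sub>G {g. act\<^sub>G g y \<in> Ac}) -` {0} \<inter> space (borel_of Y) \<in> sets (borel_of Y)"
    by (rule measurable_sets[OF fub(3)[OF Ac]]) simp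
  then have A': "A' \<in> sets (borel_of Y)" by (simp add: A'_def vimage_def Int_def conj_commute)
  have A'inv: "act\<^sub>G g y \<in> A' \<longleftrightarrow> y \<in> A'" if y: "y \<in> topspace Y" for g y
  proof -
    have imp: "act\<^sub>G g y \<in> A'" if "y \<in> A'" for g y
    proof -
      have y: "y \<in> topspace Y" "emeasure m\<^sub>G {g. act\<^sub>G g y \<in> Ac} = 0" using that by (auto simp: A'_def)
      have "{g'. act\<^sub>G g' (act\<^sub>G g y) \<in> Ac} = (\<lambda>g'. g' + g) -` {g. act\<^sub>G g y \<in> Ac}"
        by (auto simp: translate_translate)
      then show ?thesis
        using left_haar_null_right_translate[OF haar_G fub(4)[OF Ac y(1)] y(2), of g] y(1)
          G_spaceD(1)[OF G_space_G] by (simp add: A'_def)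
    qed
    show ?thesis using imp[of y g] imp[of "act\<^sub>G g y" "- g"] G_spaceD(4)[OF G_space_G y] by auto
  qed
  define \<psi> where "\<psi> = {h. \<pi> (0, - h) \<in> A'}"
  have cm: "continuous_map euclidean Y (\<lambda>h. \<pi> (0, - h))"
    by (intro continuous_map_coset continuous_intros)
  have \<psi>: "\<psi> \<in> sets borel"
    using measurable_sets[OF measurable_borel_of_continuous_map[OF cm] A']
    by (simp add: borel_of_euclidean vimage_def \<psi>_def)
  have \<psi>inv: "d + x \<in> \<psi> \<longleftrightarrow> x \<in> \<psi>" if d: "d \<in> snd ` \<Gamma>" for d x
  proof -
    obtain c where c: "(c, d) \<in> \<Gamma>" using d by auto
    have "- (c, d) \<in> \<Gamma>" using add_subgroupD(3)[OF subgroup c] .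
    then have "\<pi> ((0, - x) + - (c, d)) = \<pi> (0, - x)" by (rule coset_add)
    then have "\<pi> (- c, - x + - d) = \<pi> (0, - x)" by simp
    moreover have "\<pi> (- c, - x + - d) = act\<^sub>G (- c) (\<pi> (0, - (d + x)))"
      by (simp add: translate_translate minus_add)
    ultimately show ?thesis
      unfolding \<psi>_def using A'inv[of "\<pi> (0, - (d + x))" "- c"] by (simp add: topspace_Y)
  qed
  have "emeasure m\<^sub>H \<psi> = 0 \<or> emeasure m\<^sub>H (- \<psi>) = 0"
    by (rule left_haar_dense_invariant[OF haar_H dense \<psi>]) (rule \<psi>inv)
  then have dich: "emeasure m A' = 0 \<or> emeasure m (topspace Y - A') = 0"
  proof (elim disj_forward)
    assume "emeasure m\<^sub>H \<psi> = 0"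
    then show "emeasure m A' = 0" using ergodic_strict[OF A' A'inv] by (simp add: \<psi>_def)
  next
    assume "emeasure m\<^sub>H (- \<psi>) = 0"
    moreover have "- \<psi> = {h. \<pi> (0, - h) \<in> topspace Y - A'}" by (auto simp: \<psi>_def topspace_Y)
    moreover have "topspace Y - A' \<in> sets (borel_of Y)" using sets.compl_sets[OF A'] by simp
    ultimately show "emeasure m (topspace Y - A') = 0"
      using A'inv G_spaceD(1)[OF G_space_G] by (intro ergodic_strict) auto
  qed
  have vim: "act\<^sub>G g -` B \<inter> topspace Y \<in> sets (borel_of Y)" if "B \<in> sets (borel_of Y)" for g B
    by (rule act_set_measurable[OF G_space_G that])
  interpret P: pair_sigma_finite m\<^sub>G m
    using Gm m.sigma_finite_measure_axioms by (simp add: pair_sigma_finite_def)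
  have meas_act: "{x \<in> space (m\<^sub>G \<Otimes>\<^sub>M m). act\<^sub>G (fst x) (snd x) \<in> B} \<in> sets (m\<^sub>G \<Otimes>\<^sub>M m)"
    if "B \<in> sets (borel_of Y)" for B
    using measurable_sets[OF G_space_measurable'(1)[OF G_space_G Gm(1) m_props(2)], of B] that
    by (simp add: m_props vimage_def Int_def conj_commute case_prod_unfold)
  have meas_snd: "{x \<in> space (m\<^sub>G \<Otimes>\<^sub>M m). snd x \<in> B} \<in> sets (m\<^sub>G \<Otimes>\<^sub>M m)"
    if "B \<in> sets (borel_of Y)" for B
    using measurable_sets[OF measurable_snd, of B m m\<^sub>G] that
    by (simp add: m_props vimage_def Int_def conj_commute)
  \<comment> \<open>Fubini exchanges the quantifiers: a set of \<open>y\<close> that is null for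
    each \<open>g\<close> becomes, for almost every \<open>y\<close>, a null set of
    \<open>g\<close>.\<close>
  have AE_swap: "AE y in m. AE g in m\<^sub>G. \<not> (y \<in> B \<and> act\<^sub>G g y \<in> C)"
    if B: "B \<in> sets (borel_of Y)" and C: "C \<in> sets (borel_of Y)"
      and null: "\<And>g. emeasure m (B \<inter> act\<^sub>G g -` C) = 0" for B C
  proof -
    have "{x \<in> space (m\<^sub>G \<Otimes>\<^sub>M m). \<not> (snd x \<in> B \<and> act\<^sub>G (fst x) (snd x) \<in> C)} \<in> sets (m\<^sub>G \<Otimes>\<^sub>M m)"
      by (intro sets.sets_Collect meas_act meas_snd B C)
    from P.AE_commute[OF this]
    have "(AE g in m\<^sub>G. AE y in m. \<not> (y \<in> B \<and> act\<^sub>G g y \<in> C)) \<longleftrightarrow>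
        (AE y in m. AE g in m\<^sub>G. \<not> (y \<in> B \<and> act\<^sub>G g y \<in> C))" .
    moreover have "AE y in m. \<not> (y \<in> B \<and> act\<^sub>G g y \<in> C)" for g
    proof -
      have "B \<inter> act\<^sub>G g -` C = B \<inter> (act\<^sub>G g -` C \<inter> topspace Y)"
        using sets.sets_into_space[OF B] by auto
      then have "B \<inter> act\<^sub>G g -` C \<in> null_sets m"
        using null[of g] vim[OF C, of g] B by (metis null_setsI m_props(2) sets.Int)
      from AE_not_in[OF this] show ?thesis by eventually_elim auto
    qed
    ultimately show ?thesis by simp
  qed
  have null1: "emeasure m (A \<inter> act\<^sub>G g -` Ac) = 0" for g
  proof -
    have "A \<inter> act\<^sub>G g -` Ac = A - act\<^sub>G g -` A"
      using G_spaceD(1)[OF G_space_G] Asub by (auto simp: Ac_def)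
    then show ?thesis using ainv by simp
  qed
  \<comment> \<open>The hypothesis concerns only points leaving \<open>A\<close>. Points entering
    \<open>A\<close> under \<open>g\<close> are those leaving it under \<open>- g\<close>, moved by
    \<open>- g\<close>, and \<open>m\<close> is invariant.\<close>
  have null2: "emeasure m (Ac \<inter> act\<^sub>G g -` A) = 0" for g
  proof -
    have "A \<inter> act\<^sub>G (- g) -` Ac = A \<inter> (act\<^sub>G (- g) -` Ac \<inter> topspace Y)" using Asub by auto
    then have "A \<inter> act\<^sub>G (- g) -` Ac \<in> sets (borel_of Y)" using A vim[OF Ac] by auto
    from m_act[OF this, of "(g, 0)"]
    have "emeasure m (act\<^sub>G g -` (A \<inter> act\<^sub>G (- g) -` Ac) \<inter> topspace Y) = 0"
      using null1 by simp
    moreover have "act\<^sub>G g -` (A \<inter> act\<^sub>G (- g) -` Ac) \<inter> topspace Y = Ac \<inter> act\<^sub>G g -` A"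
      using G_spaceD(4)[OF G_space_G] by (auto simp: Ac_def)
    ultimately show ?thesis by simp
  qed
  have gnull: "emeasure m\<^sub>G {g. act\<^sub>G g y \<in> C} = 0 \<longleftrightarrow> (AE g in m\<^sub>G. act\<^sub>G g y \<notin> C)"
    if "C \<in> sets (borel_of Y)" "y \<in> topspace Y" for C y
    using AE_iff_null_sets[of "{g. act\<^sub>G g y \<in> C}" "m\<^sub>G"] fub(4)[OF that] Gm(1)
    by (auto simp: null_sets_def)
  have nontriv: "\<not> (AE g in m\<^sub>G. False)"
    using AE_iff_null_sets[of UNIV m\<^sub>G] Gm(1) left_haar_measure_UNIV[OF haar_G] by (auto simp: null_sets_def)
  have "AE y in m. y \<in> A \<longleftrightarrow> y \<in> A'"
    using AE_swap[OF A Ac null1] AE_swap[OF Ac A null2] AE_space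
  proof eventually_elim
    case (elim y)
    then have y: "y \<in> topspace Y" by (simp add: m_props)
    \<comment> \<open>Otherwise almost every translate of \<open>y\<close> would lie neither in
      \<open>A\<close> nor in its complement, while Haar measure is nonzero.\<close>
    have not_A': "y \<notin> A'" if "y \<notin> A"
    proof
      assume "y \<in> A'"
      then have "AE g in m\<^sub>G. act\<^sub>G g y \<notin> Ac" using gnull[OF Ac y] by (simp add: A'_def)
      moreover have "AE g in m\<^sub>G. act\<^sub>G g y \<notin> A" using elim(2) that y by (simp add: Ac_def)
      ultimately have "AE g in m\<^sub>G. False"
        by eventually_elim (use G_spaceD(1)[OF G_space_G y] in \<open>auto simp: Ac_def\<close>)
      then show False using nontriv by blast
    qed
    have "y \<in> A'" if "y \<in> A"
      using elim(1) that gnull[OF Ac y] y by (simp add: A'_def)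
    then show ?case using not_A' by blast
  qed
  then have "emeasure m A = emeasure m A'" "emeasure m (topspace Y - A) = emeasure m (topspace Y - A')"
    using A A' sets.compl_sets[OF A] sets.compl_sets[OF A']
    by (auto intro!: emeasure_eq_AE simp: m_props)
  then show ?thesis using dich by simp
qed

text \<open>The set \<open>A\<close> where the density \<open>f\<close> exceeds 1 is the smallest maximizer of \<open>l - m\<close>. By
  stationarity almost every translate of \<open>A\<close> is a maximizer as well, and it has the same
  \<open>m\<close>-measure as \<open>A\<close>, so it agrees with \<open>A\<close> up to a null set.\<close>

lemma stationary_abs_continuous_unique:
  assumes \<mu>: "admissible m\<^sub>G \<mu>" and l: "stationary_prob Y act\<^sub>G \<mu> l" and ac: "absolutely_continuous m l"
  shows "l = m"
proof -
  have \<mu>': "prob_space \<mu>" "sets \<mu> = sets borel" using \<mu> by (auto simp: admissible_def)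
  interpret \<mu>: prob_space \<mu> by (rule \<mu>')
  note l' = l[unfolded stationary_prob_iff[OF G_space_G \<mu>'(2)]]
  note lD = borel_prob_onD[OF conjunct1[OF l']]
  interpret l: prob_space l by (rule lD)
  have sets_lm: "sets l = sets m" using lD m_props by simp
  define f where "f = RN_deriv m l"
  have f: "f \<in> borel_measurable m" by (simp add: f_def)
  have dens: "density m f = l" unfolding f_def by (rule m.density_RN_deriv[OF ac sets_lm])
  have l_eq: "emeasure l B = (\<integral>\<^sup>+y. f y * indicator B y \<partial>m)" if "B \<in> sets m" for B
    unfolding dens[symmetric] by (rule emeasure_density[OF f that])
  define A where "A = {y \<in> space m. 1 < f y}"
  have A: "A \<in> sets m" unfolding A_def using f by measurable
  have A_borel: "A \<in> sets (borel_of Y)" using A m_props by simp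
  \<comment> \<open>On \<open>A\<close> the function \<open>f - 1\<close> is positive, so a part of
    \<open>A\<close> that gains no mass under \<open>l\<close> is null. This is where
    \<open>1 < f\<close> rather than \<open>1 \<le> f\<close> matters.\<close>
  have strict: "emeasure m D = 0" if D: "D \<in> sets m" "D \<subseteq> A" "emeasure l D \<le> emeasure m D" for D
  proof -
    have "emeasure l D = (\<integral>\<^sup>+y. indicator D y + (f y - 1) * indicator D y \<partial>m)"
      unfolding l_eq[OF D(1)] using D(2)
      by (intro nn_integral_cong) (auto simp: A_def indicator_def add_diff_inverse_ennreal dest!: less_imp_le)
    also have "\<dots> = emeasure m D + (\<integral>\<^sup>+y. (f y - 1) * indicator D y \<partial>m)"
      using D f by (subst nn_integral_add) auto
    finally have "emeasure m D + (\<integral>\<^sup>+y. (f y - 1) * indicator D y \<partial>m) \<le> emeasure m D + 0"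
      using D(3) by simp
    then have "(\<integral>\<^sup>+y. (f y - 1) * indicator D y \<partial>m) = 0"
      using m.emeasure_finite[of D] by (simp only: ennreal_add_left_cancel_le) simp
    then have "AE y in m. (f y - 1) * indicator D y = 0"
      using D f by (subst (asm) nn_integral_0_iff_AE) auto
    then have "AE y in m. y \<notin> D"
    proof eventually_elim
      case (elim y)
      show ?case
      proof
        assume "y \<in> D"
        then have "f y - 1 = 0" "1 < f y" using elim D(2) by (auto simp: A_def)
        then show False using diff_gr0_ennreal[of 1 "f y"] by simp
      qed
    qed
    then show ?thesis using AE_iff_null_sets[OF D(1)] by auto
  qed
  have le_out: "emeasure l D \<le> emeasure m D" if D: "D \<in> sets m" "D \<inter> A = {}" for D
  proof -
    have "emeasure l D \<le> (\<integral>\<^sup>+y. indicator D y \<partial>m)"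
      unfolding l_eq[OF D(1)] using D sets.sets_into_space[OF D(1)]
      by (intro nn_integral_mono) (auto simp: indicator_def A_def not_less disjoint_iff)
    then show ?thesis using D by simp
  qed
  have le_in: "emeasure m D \<le> emeasure l D" if D: "D \<in> sets m" "D \<subseteq> A" for D
  proof -
    have "(\<integral>\<^sup>+y. indicator D y \<partial>m) \<le> emeasure l D"
      unfolding l_eq[OF D(1)] using D
      by (intro nn_integral_mono) (auto simp: indicator_def A_def)
    then show ?thesis using D by simp
  qed
  define C where "C g = act\<^sub>G g -` A \<inter> topspace Y" for g
  have C: "C g \<in> sets m" for g
    unfolding C_def m_props(2) by (rule act_set_measurable[OF G_space_G A_borel])
  have mC: "emeasure m (C g) = emeasure m A" for g
    unfolding C_def by (rule m_act[OF A_borel])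
  have split: "emeasure n (B \<inter> E) + emeasure n (B - E) = emeasure n B"
    if "sets n = sets m" "B \<in> sets m" "E \<in> sets m" for n B E
    using that by (subst plus_emeasure) (auto intro!: arg_cong[of _ _ "emeasure n"])
  have sd: "emeasure m (C g - A) = emeasure m (A - C g)" for g
  proof -
    have "emeasure m (A \<inter> C g) + emeasure m (C g - A) = emeasure m (A \<inter> C g) + emeasure m (A - C g)"
      using split[OF refl C A, of g] split[OF refl A C, of g] mC[of g] by (simp add: Int_commute)
    then show ?thesis using m.emeasure_finite by (simp add: ennreal_add_left_cancel)
  qed
  \<comment> \<open>The sets \<open>C g\<close> and \<open>A\<close> have equal
    \<open>m\<close>-measure, hence so do \<open>C g - A\<close> and \<open>A - C g\<close>. On the
    former \<open>l\<close> is at most \<open>m\<close>, on the latter at least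
    \<open>m\<close>.\<close>
  have lC_le: "emeasure l (C g) \<le> emeasure l A" for g
  proof -
    have "emeasure l (C g - A) \<le> emeasure l (A - C g)"
    proof -
      have "emeasure l (C g - A) \<le> emeasure m (C g - A)" using C A by (intro le_out) auto
      also have "\<dots> = emeasure m (A - C g)" by (rule sd)
      also have "\<dots> \<le> emeasure l (A - C g)" using C A by (intro le_in) auto
      finally show ?thesis .
    qed
    then have "emeasure l (A \<inter> C g) + emeasure l (C g - A) \<le> emeasure l (A \<inter> C g) + emeasure l (A - C g)"
      by (rule add_left_mono)
    then show ?thesis
      using split[OF sets_lm C A, of g] split[OF sets_lm A C, of g] by (simp add: Int_commute)
  qed
  have Cmeas: "(\<lambda>g. emeasure l (C g)) \<in> borel_measurable \<mu>"
    unfolding C_def using act_fubini(2)[OF G_space_G \<mu>'(2) \<mu>.sigma_finite_measure_axioms lD(2) l.sigma_finite_measure_axioms A_borel]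
    by (subst measurable_cong_sets[OF \<mu>'(2) refl])
  \<comment> \<open>Stationarity says that \<open>emeasure l (C g)\<close> averages to
    \<open>emeasure l A\<close>. No value exceeds this average, so almost all attain it.\<close>
  have "(\<integral>\<^sup>+g. emeasure l A - emeasure l (C g) \<partial>\<mu>) = (\<integral>\<^sup>+g. emeasure l A \<partial>\<mu>) - (\<integral>\<^sup>+g. emeasure l (C g) \<partial>\<mu>)"
    using Cmeas lC_le l'[THEN conjunct2, rule_format, OF A_borel] l.emeasure_finite
    by (intro nn_integral_diff) (auto simp: C_def)
  also have "\<dots> = 0"
    using l'[THEN conjunct2, rule_format, OF A_borel] l.emeasure_finite[of A]
    by (simp add: C_def \<mu>.emeasure_space_1 diff_eq_0_iff_ennreal top.not_eq_extremum)
  finally have "AE g in \<mu>. emeasure l A - emeasure l (C g) = 0"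
    using Cmeas by (subst (asm) nn_integral_0_iff_AE) auto
  then have AEg: "AE g in \<mu>. emeasure m (A - C g) = 0"
  proof eventually_elim
    case (elim g)
    then have eq: "emeasure l (C g) = emeasure l A"
      using lC_le[of g] l.emeasure_finite[of A]
      by (metis antisym diff_eq_0_iff_ennreal top.not_eq_extremum)
    have "emeasure l (A \<inter> C g) + emeasure l (A - C g) = emeasure l (A \<inter> C g) + emeasure l (C g - A)"
      using split[OF sets_lm C A, of g] split[OF sets_lm A C, of g] eq by (simp add: Int_commute)
    then have "emeasure l (A - C g) = emeasure l (C g - A)"
      using l.emeasure_finite by (simp add: ennreal_add_left_cancel)
    also have "\<dots> \<le> emeasure m (C g - A)" using C A by (intro le_out) auto
    also have "\<dots> = emeasure m (A - C g)" by (rule sd)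
    finally show ?case by (intro strict) (use C A in auto)
  qed
  define n where "n = density m (indicator A)"
  have sets_n: "sets n = sets (borel_of Y)" by (simp add: n_def m_props)
  have n: "emeasure n B = emeasure m (A \<inter> B)" if "B \<in> sets (borel_of Y)" for B
    unfolding n_def using that A borel_measurable_indicator[OF A]
    by (subst emeasure_density) (auto simp: m_props indicator_inter_arith[symmetric])
  \<comment> \<open>The measure \<open>n\<close> is \<open>m\<close> restricted to \<open>A\<close>.
    Testing it on open sets makes \<open>S\<close> a subgroup, since preimages of open sets are
    open, and lets lower semicontinuity extend the invariance from the dense \<open>S\<close> to all
    of \<open>G\<close>.\<close>
  define S where "S = {g. \<forall>U. openin Y U \<longrightarrow> emeasure n (act\<^sub>G g -` U \<inter> topspace Y) = emeasure n U}"
  have vim: "act\<^sub>G g -` B \<inter> topspace Y \<in> sets (borel_of Y)" if "B \<in> sets (borel_of Y)" for g B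
    by (rule act_set_measurable[OF G_space_G that])
  have "AE g in \<mu>. g \<in> S"
    using AEg
  proof eventually_elim
    case (elim g)
    show ?case unfolding S_def
    proof (intro CollectI allI impI)
      fix U assume U: "openin Y U"
      then have Ub: "U \<in> sets (borel_of Y)" by (rule openin_sets_borel_of)
      let ?V = "act\<^sub>G g -` U \<inter> topspace Y"
      have V: "?V \<in> sets m" using vim[OF Ub] m_props by simp
      have "A - C g \<in> null_sets m" "C g - A \<in> null_sets m"
        using elim sd[of g] A C by (auto simp: null_sets_def)
      then have "AE y in m. y \<in> A \<longleftrightarrow> y \<in> C g"
        by (auto elim!: eventually_elim2 dest!: AE_not_in)
      then have "emeasure m (A \<inter> ?V) = emeasure m (C g \<inter> ?V)"
        using A C V by (intro emeasure_eq_AE) (auto elim!: eventually_mono)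
      also have "C g \<inter> ?V = act\<^sub>G g -` (A \<inter> U) \<inter> topspace Y" by (auto simp: C_def)
      also have "emeasure m \<dots> = emeasure m (A \<inter> U)"
        using A_borel Ub by (intro m_act) auto
      finally show "emeasure n ?V = emeasure n U" using n[OF vim[OF Ub]] n[OF Ub] by simp
    qed
  qed
  moreover have "add_subgroup S"
    unfolding add_subgroup_def
  proof (intro conjI ballI)
    show "0 \<in> S"
      unfolding S_def using act_vimage_0[OF G_space_G openin_subset] by (intro CollectI allI impI) simp
    show "x + y \<in> S" if xy: "x \<in> S" "y \<in> S" for x y
      unfolding S_def
    proof (intro CollectI allI impI)
      fix U assume U: "openin Y U"
      have "emeasure n (act\<^sub>G y -` (act\<^sub>G x -` U \<inter> topspace Y) \<inter> topspace Y)
          = emeasure n (act\<^sub>G x -` U \<inter> topspace Y)"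
        using xy(2) act_openin[OF G_space_G U, of x] unfolding S_def by blast
      also have "\<dots> = emeasure n U" using xy(1) U unfolding S_def by blast
      finally show "emeasure n (act\<^sub>G (x + y) -` U \<inter> topspace Y) = emeasure n U"
        unfolding act_vimage_vimage[OF G_space_G] .
    qed
    show "- x \<in> S" if x: "x \<in> S" for x
      unfolding S_def
    proof (intro CollectI allI impI)
      fix U assume U: "openin Y U"
      have "emeasure n (act\<^sub>G x -` (act\<^sub>G (- x) -` U \<inter> topspace Y) \<inter> topspace Y)
          = emeasure n (act\<^sub>G (- x) -` U \<inter> topspace Y)"
        using x act_openin[OF G_space_G U, of "- x"] unfolding S_def by blast
      then show "emeasure n (act\<^sub>G (- x) -` U \<inter> topspace Y) = emeasure n U"
        unfolding act_vimage_vimage[OF G_space_G] using act_vimage_0[OF G_space_G openin_subset[OF U]] by simp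
    qed
  qed
  ultimately have "closure S = UNIV" by (intro admissible_dense[OF \<mu>])
  then have n_open: "emeasure n (act\<^sub>G g -` U \<inter> topspace Y) = emeasure n U" if "openin Y U" for g U
    by (rule emeasure_act_dense[OF G_space_G sets_n]) (use that in \<open>auto simp: S_def\<close>)
  have "emeasure m (A - act\<^sub>G g -` A) = 0" for g
  proof -
    have "distr n n (act\<^sub>G g) = n"
    proof (rule borel_measure_eqI[where T=Y])
      fix U assume U: "openin Y U"
      show "emeasure (distr n n (act\<^sub>G g)) U = emeasure n U"
        using emeasure_distr_borel_of[OF G_spaceD(7)[OF G_space_G] sets_n sets_n openin_sets_borel_of[OF U]]
          n_open[OF U] by simp
    next
      have "emeasure (distr n n (act\<^sub>G g)) (topspace Y) = emeasure n (topspace Y)"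
        using emeasure_distr_borel_of[OF G_spaceD(7)[OF G_space_G] sets_n sets_n openin_sets_borel_of[OF openin_topspace]]
          n_open[OF openin_topspace] by simp
      then show "emeasure (distr n n (act\<^sub>G g)) (topspace Y) \<noteq> \<infinity>"
        using n[OF openin_sets_borel_of[OF openin_topspace]] m.emeasure_finite by simp
    qed (use sets_n in auto)
    then have "emeasure n A = emeasure (distr n n (act\<^sub>G g)) A" by simp
    also have "\<dots> = emeasure n (C g)"
      unfolding C_def by (rule emeasure_distr_borel_of[OF G_spaceD(7)[OF G_space_G] sets_n sets_n A_borel])
    finally have "emeasure m A = emeasure m (A \<inter> C g)"
      using n[OF A_borel] n[of "C g"] C m_props by simp
    moreover have "A - act\<^sub>G g -` A = A - A \<inter> C g"
      using sets.sets_into_space[OF A] by (auto simp: C_def m_props)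
    ultimately show ?thesis
      using A C by (simp only:) (subst emeasure_Diff, auto simp: m.emeasure_finite)
  qed
  \<comment> \<open>If \<open>A\<close> is null, then \<open>l\<close> is at most \<open>m\<close>,
    and equal total mass forces equality. If \<open>A\<close> is conull, then
    \<open>emeasure l A\<close> is at most 1, which is \<open>emeasure m A\<close>, so
    \<open>strict\<close> makes \<open>A\<close> null after all.\<close>
  from ergodic[OF A_borel this] show ?thesis
  proof
    assume 0: "emeasure m A = 0"
    then have lA: "emeasure l A = 0"
      using ac A unfolding absolutely_continuous_def by (auto simp: null_sets_def)
    have le: "emeasure l B \<le> emeasure m B" if B: "B \<in> sets m" for B
    proof -
      have "emeasure l (B \<inter> A) \<le> emeasure l A" using A sets_lm by (intro emeasure_mono) auto
      then have "emeasure l B = emeasure l (B - A)"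
        using split[OF sets_lm B A] lA by simp
      also have "\<dots> \<le> emeasure m (B - A)" using A B by (intro le_out) auto
      also have "\<dots> \<le> emeasure m B" using A B by (intro emeasure_mono) auto
      finally show ?thesis .
    qed
    show ?thesis
    proof (rule measure_eqI[OF sets_lm])
      fix B assume "B \<in> sets l"
      then have B: "B \<in> sets m" using sets_lm by simp
      have sp: "space l = space m" using sets_lm by (rule sets_eq_imp_space_eq)
      have "measure l B \<le> measure m B" "measure l (space m - B) \<le> measure m (space m - B)"
        using le[OF B] le[of "space m - B"] B
        by (simp_all add: l.emeasure_eq_measure m.emeasure_eq_measure)
      moreover have "measure l (space m - B) = 1 - measure l B" "measure m (space m - B) = 1 - measure m B"
        using l.prob_compl[of B] m.prob_compl[of B] B sets_lm sp by auto
      ultimately show "emeasure l B = emeasure m B"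
        by (simp add: l.emeasure_eq_measure m.emeasure_eq_measure)
    qed
  next
    assume 0: "emeasure m (topspace Y - A) = 0"
    have "emeasure m A = 1"
      using split[OF refl sets.top A] 0 m.emeasure_space_1 sets.sets_into_space[OF A]
      by (simp add: m_props Int_absorb1)
    then have "emeasure l A \<le> emeasure m A" using l.measure_le_1 by simp
    then have "emeasure m A = 0" using A by (intro strict) auto
    then show ?thesis using \<open>emeasure m A = 1\<close> by simp
  qed
qed

text \<open>If \<eta> exceeded \<open>m\<close> on an open \<open>U\<close>, it would exceed a
  constant \<open>c\<close> above \<open>emeasure m U\<close> on all translates of \<open>U\<close>
  by small \<open>h\<close>. Averaging over these \<open>h\<close> gives a stationary, absolutely
  continuous measure, which must be \<open>m\<close> and yet gives \<open>U\<close> at least the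
  mass \<open>c\<close>.\<close>

lemma stationary_unique:
  assumes \<mu>: "admissible m\<^sub>G \<mu>" and \<eta>: "stationary_prob Y act\<^sub>G \<mu> \<eta>"
  shows "\<eta> = m"
proof -
  have \<mu>': "prob_space \<mu>" "sets \<mu> = sets borel" "absolutely_continuous m\<^sub>G \<mu>"
    using \<mu> by (auto simp: admissible_def)
  interpret \<mu>: prob_space \<mu> by (rule \<mu>')
  note \<eta>' = \<eta>[unfolded stationary_prob_iff[OF G_space_G \<mu>'(2)]]
  note \<eta>D = borel_prob_onD[OF conjunct1[OF \<eta>']]
  interpret \<eta>: prob_space \<eta> by (rule \<eta>D)
  have le: "emeasure \<eta> U \<le> emeasure m U" if U: "openin Y U" for U
  proof (rule ccontr)
    assume "\<not> ?thesis"
    then obtain c where c: "emeasure m U < c" "c < emeasure \<eta> U"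
      using dense_order_class.dense[of "emeasure m U" "emeasure \<eta> U"] by (auto simp: not_le)
    have "c < emeasure \<eta> (act\<^sub>H 0 -` U \<inter> topspace Y)"
      using c act_vimage_0[OF G_space_H openin_subset[OF U]] by simp
    from eventually_less_emeasure_act[OF G_space_H \<eta>D(2) U this]
    obtain N where N: "open N" "0 \<in> N" "\<And>h. h \<in> N \<Longrightarrow> c < emeasure \<eta> (act\<^sub>H h -` U \<inter> topspace Y)"
      unfolding eventually_nhds by blast
    \<comment> \<open>\<open>V\<close> is open, hence of positive Haar measure, and lies in a
      compact set, hence of finite measure; the uniform distribution on it is then a probability
      measure.\<close>
    obtain V K where V: "open V" "compact K" "0 \<in> V" "V \<subseteq> K" "K \<subseteq> N"
      using compact_neighbourhood[OF N(1,2)] by metis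
    define \<rho> where "\<rho> = uniform_measure m\<^sub>H V"
    have sets_\<rho>: "sets \<rho> = sets borel" by (simp add: \<rho>_def left_haar_measure_sets[OF haar_H])
    have "emeasure m\<^sub>H V \<noteq> 0" using left_haar_open_pos[OF haar_H V(1)] V(3) by blast
    moreover have "emeasure m\<^sub>H V \<noteq> \<infinity>"
      using emeasure_relatively_compact_finite[OF left_haar_measure_sets(1)[OF haar_H] _ V(2,4)] haar_H
      by (auto simp: left_haar_measure_def)
    ultimately have "prob_space \<rho>" unfolding \<rho>_def by (rule prob_space_uniform_measure)
    then interpret \<rho>: prob_space \<rho> .
    define l where "l = act_convolution \<rho> act\<^sub>H \<eta>"
    have l_prob: "borel_prob_on Y l"
      unfolding l_def by (rule borel_prob_on_act_convolution[OF G_space_H \<open>prob_space \<rho>\<close> sets_\<rho> conjunct1[OF \<eta>']])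
    have l: "emeasure l A = (\<integral>\<^sup>+ h. emeasure \<eta> (act\<^sub>H h -` A \<inter> topspace Y) \<partial>\<rho>)" if "A \<in> sets (borel_of Y)" for A
      unfolding l_def by (rule emeasure_act_convolution(2)[OF G_space_H sets_\<rho> \<eta>D(2) \<eta>.sigma_finite_measure_axioms that])
    have vimG: "act\<^sub>G g -` B \<inter> topspace Y \<in> sets (borel_of Y)" if "B \<in> sets (borel_of Y)" for g B
      by (rule act_set_measurable[OF G_space_G that])
    have vimH: "act\<^sub>H h -` B \<inter> topspace Y \<in> sets (borel_of Y)" if "B \<in> sets (borel_of Y)" for h B
      by (rule act_set_measurable[OF G_space_H that])
    have vim_GH: "act\<^sub>H h -` (act\<^sub>G g -` A \<inter> topspace Y) \<inter> topspace Y = translate (g, h) -` A \<inter> topspace Y" for g h A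
      using act_vimage_vimage[OF G_space_coset, of "(0, h)" "(g, 0)"] by simp
    have vim_HG: "act\<^sub>G g -` (act\<^sub>H h -` A \<inter> topspace Y) \<inter> topspace Y = translate (g, h) -` A \<inter> topspace Y" for g h A
      using act_vimage_vimage[OF G_space_coset, of "(g, 0)" "(0, h)"] by simp
    interpret P: pair_sigma_finite \<mu> \<rho> ..
    interpret M: pair_sigma_finite m\<^sub>G m\<^sub>H
      using left_haar_measure_sigma_finite[OF haar_G] left_haar_measure_sigma_finite[OF haar_H]
      by (simp add: pair_sigma_finite_def)
    note haar_GH = left_haar_measure_pair[OF haar_G haar_H]
    note fub = act_fubini[OF G_space_coset left_haar_measure_sets(1)[OF haar_GH]
      left_haar_measure_sigma_finite[OF haar_GH] \<eta>D(2) \<eta>.sigma_finite_measure_axioms]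
    have lG: "emeasure l (act\<^sub>G g -` A \<inter> topspace Y) = (\<integral>\<^sup>+ h. emeasure \<eta> (translate (g, h) -` A \<inter> topspace Y) \<partial>\<rho>)"
      if "A \<in> sets (borel_of Y)" for A g
      unfolding l[OF vimG[OF that]] vim_GH ..
    \<comment> \<open>The actions of \<open>G\<close> and \<open>H\<close> commute, so the average
      over \<open>h\<close> can be taken after the average over \<open>g\<close>.\<close>
    have l_stat: "(\<integral>\<^sup>+ g. emeasure l (act\<^sub>G g -` A \<inter> topspace Y) \<partial>\<mu>) = emeasure l A"
      if A: "A \<in> sets (borel_of Y)" for A
    proof -
      have meas: "(\<lambda>(g, h). emeasure \<eta> (translate (g, h) -` A \<inter> topspace Y)) \<in> borel_measurable (\<mu> \<Otimes>\<^sub>M \<rho>)"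
        using fub(2)[OF A]
        unfolding borel_prod[symmetric] measurable_cong_sets[OF sets_pair_measure_cong[OF \<mu>'(2) sets_\<rho>] refl]
        by (simp add: case_prod_unfold)
      have "(\<integral>\<^sup>+ g. emeasure l (act\<^sub>G g -` A \<inter> topspace Y) \<partial>\<mu>)
          = (\<integral>\<^sup>+ h. \<integral>\<^sup>+ g. emeasure \<eta> (translate (g, h) -` A \<inter> topspace Y) \<partial>\<mu> \<partial>\<rho>)"
        unfolding lG[OF A] by (rule P.Fubini'[OF meas, symmetric])
      also have "\<dots> = (\<integral>\<^sup>+ h. emeasure \<eta> (act\<^sub>H h -` A \<inter> topspace Y) \<partial>\<rho>)"
        using \<eta>'[THEN conjunct2, rule_format, OF vimH[OF A]] unfolding vim_HG by simp
      finally show ?thesis by (simp add: l[OF A])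
    qed
    \<comment> \<open>By stationarity one more convolution with \<mu> does not change
      \<open>l\<close>. So \<open>l\<close> averages the translates of \<eta> by pairs
      \<open>(g, h)\<close> whose law is absolutely continuous with respect to Haar measure on
      \<open>G \<times> H\<close>, and by transitivity such an average does not charge
      \<open>m\<close>-null sets.\<close>
    have "absolutely_continuous m l"
      unfolding absolutely_continuous_def
    proof
      fix B assume "B \<in> null_sets m"
      then have B: "B \<in> sets (borel_of Y)" "emeasure m B = 0" by (auto simp: null_sets_def m_props)
      have "(\<integral>\<^sup>+ k. emeasure \<eta> (translate k -` B \<inter> topspace Y) \<partial>(m\<^sub>G \<Otimes>\<^sub>M m\<^sub>H)) = (\<integral>\<^sup>+ y. 0 \<partial>\<eta>)"
        unfolding fub(1)[OF B(1)]
        by (intro nn_integral_cong AE_orbit_of_null[OF G_space_coset haar_GH inv B coset_trans])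
          (simp_all add: \<eta>D)
      moreover have "(\<lambda>k. emeasure \<eta> (translate k -` B \<inter> topspace Y)) \<in> borel_measurable (m\<^sub>G \<Otimes>\<^sub>M m\<^sub>H)"
        using fub(2)[OF B(1)] by (subst measurable_cong_sets[OF left_haar_measure_sets(1)[OF haar_GH] refl])
      ultimately have "AE k in m\<^sub>G \<Otimes>\<^sub>M m\<^sub>H. emeasure \<eta> (translate k -` B \<inter> topspace Y) = 0"
        by (simp add: nn_integral_0_iff_AE)
      from M.AE_pair[OF this]
      have "AE g in m\<^sub>G. AE h in m\<^sub>H. emeasure \<eta> (translate (g, h) -` B \<inter> topspace Y) = 0" .
      then have "AE g in \<mu>. AE h in m\<^sub>H. emeasure \<eta> (translate (g, h) -` B \<inter> topspace Y) = 0"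
        using \<mu>' left_haar_measure_sets(1)[OF haar_G] by (intro absolutely_continuous_AE[OF _ \<mu>'(3)]) simp_all
      then have "AE g in \<mu>. emeasure l (act\<^sub>G g -` B \<inter> topspace Y) = 0"
      proof eventually_elim
        case (elim g)
        then have "AE h in \<rho>. emeasure \<eta> (translate (g, h) -` B \<inter> topspace Y) = 0"
          unfolding \<rho>_def using V(1) left_haar_measure_sets[OF haar_H]
          by (intro AE_uniform_measureI) (auto elim: eventually_mono)
        then have "(\<integral>\<^sup>+ h. emeasure \<eta> (translate (g, h) -` B \<inter> topspace Y) \<partial>\<rho>) = (\<integral>\<^sup>+ h. 0 \<partial>\<rho>)"
          by (intro nn_integral_cong_AE)
        then show ?case by (simp add: lG[OF B(1)])
      qed
      then have "(\<integral>\<^sup>+ g. emeasure l (act\<^sub>G g -` B \<inter> topspace Y) \<partial>\<mu>) = (\<integral>\<^sup>+ g. 0 \<partial>\<mu>)"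
        by (intro nn_integral_cong_AE)
      then show "B \<in> null_sets l"
        using l_stat[OF B(1)] B(1) borel_prob_onD(2)[OF l_prob] by (simp add: null_sets_def)
    qed
    then have "l = m"
      using l_stat l_prob by (intro stationary_abs_continuous_unique[OF \<mu>])
        (simp_all add: stationary_prob_iff[OF G_space_G \<mu>'(2)])
    have "c = (\<integral>\<^sup>+ h. c \<partial>\<rho>)" by (simp add: \<rho>.emeasure_space_1)
    also have "\<dots> \<le> (\<integral>\<^sup>+ h. emeasure \<eta> (act\<^sub>H h -` U \<inter> topspace Y) \<partial>\<rho>)"
    proof (rule nn_integral_mono_AE)
      show "AE h in \<rho>. c \<le> emeasure \<eta> (act\<^sub>H h -` U \<inter> topspace Y)"
        unfolding \<rho>_def using V N left_haar_measure_sets[OF haar_H]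
        by (intro AE_uniform_measureI AE_I2) (auto intro!: less_imp_le)
    qed
    also have "\<dots> = emeasure m U" using l[OF openin_sets_borel_of[OF U]] \<open>l = m\<close> by simp
    finally show False using c(1) by simp
  qed
  \<comment> \<open>Complements reverse the inequality on open sets. An increasing union of closed
    sets then yields the missing inequality for \<open>U\<close>.\<close>
  have closed_ge: "emeasure m F \<le> emeasure \<eta> F" if F: "closedin Y F" for F
  proof -
    have U: "openin Y (topspace Y - F)" using F by blast
    have Fs: "F \<in> sets m" "F \<in> sets \<eta>" using closedin_sets_borel_of[OF F] by (simp_all add: m_props \<eta>D)
    have "measure \<eta> (topspace Y - F) \<le> measure m (topspace Y - F)"
      using le[OF U] by (simp add: \<eta>.emeasure_eq_measure m.emeasure_eq_measure)
    then show ?thesis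
      using m.prob_compl[OF Fs(1)] \<eta>.prob_compl[OF Fs(2)]
      by (simp add: \<eta>.emeasure_eq_measure m.emeasure_eq_measure m_props \<eta>D)
  qed
  show ?thesis
  proof (rule borel_measure_eqI[where T=Y])
    fix U assume U: "openin Y U"
    obtain F :: "nat \<Rightarrow> ('g \<times> 'h) set set" where F: "\<And>n. closedin Y (F n)" "(\<Union>n. F n) = U"
      using openin_sigma_closedin[OF U] by metis
    define E where "E n = (\<Union>i\<le>n. F i)" for n
    have E: "closedin Y (E n)" for n unfolding E_def using F(1) by (intro closedin_Union) auto
    have "incseq E" unfolding E_def by (intro monoI UN_mono) auto
    moreover have "(\<Union>n. E n) = U" using F(2) unfolding E_def by auto
    ultimately have "emeasure m U = (SUP n. emeasure m (E n))"
      using E closedin_sets_borel_of m_props by (subst SUP_emeasure_incseq) auto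
    also have "\<dots> \<le> emeasure \<eta> U"
    proof (rule SUP_least)
      fix n
      have "emeasure m (E n) \<le> emeasure \<eta> (E n)" by (rule closed_ge[OF E])
      also have "\<dots> \<le> emeasure \<eta> U"
        using \<open>(\<Union>n. E n) = U\<close> openin_sets_borel_of[OF U] by (intro emeasure_mono) (auto simp: \<eta>D)
      finally show "emeasure m (E n) \<le> emeasure \<eta> U" .
    qed
    finally show "emeasure \<eta> U = emeasure m U" using le[OF U] by (rule antisym[rotated])
  qed (simp_all add: \<eta>D m_props)
qed

end

section \<open>The Chabauty--Fell topology\<close>

lemma openin_fell_hit: "open V \<Longrightarrow> openin fell_topology {C. closed C \<and> C \<inter> V \<noteq> {}}"
  unfolding fell_topology_def by (rule topology_generated_by_Basis) blast

lemma openin_fell_miss: "compact K \<Longrightarrow> openin fell_topology {C. closed C \<and> C \<inter> K = {}}"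
  unfolding fell_topology_def by (rule topology_generated_by_Basis) blast

lemma continuous_map_into_fell:
  fixes f :: "'a \<Rightarrow> 'b::topological_space set"
  assumes "f \<in> topspace T \<rightarrow> {C. closed C}"
    and "\<And>V. open V \<Longrightarrow> openin T {x \<in> topspace T. f x \<inter> V \<noteq> {}}"
    and "\<And>K. compact K \<Longrightarrow> openin T {x \<in> topspace T. f x \<inter> K = {}}"
  shows "continuous_map T fell_topology f"
  unfolding fell_topology_def
proof (rule continuous_on_generated_topo)
  fix U :: "'b set set" assume "U \<in> {{C. closed C \<and> C \<inter> V \<noteq> {}} |V. open V} \<union> {{C. closed C \<and> C \<inter> K = {}} |K. compact K}"
  then consider V where "open V" "U = {C. closed C \<and> C \<inter> V \<noteq> {}}"
    | K where "compact K" "U = {C. closed C \<and> C \<inter> K = {}}" by blast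
  then show "openin T (f -` U \<inter> topspace T)"
  proof cases
    case 1
    have "f -` U \<inter> topspace T = {x \<in> topspace T. f x \<inter> V \<noteq> {}}" using assms(1) 1(2) by auto
    then show ?thesis using assms(2)[OF 1(1)] by simp
  next
    case 2
    have "f -` U \<inter> topspace T = {x \<in> topspace T. f x \<inter> K = {}}" using assms(1) 2(2) by auto
    then show ?thesis using assms(3)[OF 2(1)] by simp
  qed
next
  \<comment> \<open>The sets missing the empty compact set are all closed sets, so the generating
    family covers.\<close>
  have "f ` topspace T \<subseteq> {C. closed C \<and> C \<inter> {} = {}}" using assms(1) by auto
  then show "f ` topspace T \<subseteq> \<Union>({{C. closed C \<and> C \<inter> V \<noteq> {}} |V. open V} \<union> {{C. closed C \<and> C \<inter> K = {}} |K. compact K})"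
    by (rule order_trans) (intro Union_upper UnI2 CollectI exI[of _ "{}"] conjI refl compact_empty)
qed

text \<open>By Alexander's lemma only covers by hit and miss sets matter. Let \<V> collect the open
  sets whose hit sets occur. The complement of its union is closed and is hit by none of them, so a
  miss set for some compact \<open>K\<close> contains it; then \<V> covers \<open>K\<close>, and a
  finite subcover together with that miss set suffices.\<close>

lemma compact_space_fell: "compact_space (fell_topology :: 'a::topological_space set topology)"
proof -
  define \<B> :: "'a set set set" where "\<B> = {{C. closed C \<and> C \<inter> V \<noteq> {}} |V. open V} \<union> {{C. closed C \<and> C \<inter> K = {}} |K. compact K}"
  have fell: "fell_topology = topology_generated_by \<B>" by (simp add: fell_topology_def \<B>_def)
  have top: "topspace fell_topology = \<Union>\<B>" unfolding fell by simp
  have in\<B>: "openin fell_topology S" if "S \<in> \<B>" for S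
    unfolding fell by (rule topology_generated_by_Basis[OF that])
  let ?X = "topology (arbitrary union_of (finite intersection_of (\<lambda>x. x \<in> \<B>) relative_to \<Union>\<B>))"
  \<comment> \<open>\<open>Alexander_subbase\<close> presents the topology as unions of finite
    intersections relative to the union of the subbase; this has to be matched with the generated
    topology.\<close>
  have "?X = fell_topology"
    unfolding topology_eq
  proof (intro allI iffI)
    fix S assume "openin ?X S"
    then show "openin fell_topology S"
      by (rule minimal_topology_subbase[rotated 2]) (use in\<B> openin_topspace[of fell_topology] top in auto)
  next
    fix S :: "'a set set" assume "openin fell_topology S"
    then have "generate_topology_on \<B> S" unfolding fell by (rule openin_topology_generated_by)
    then show "openin ?X S"
    proof induction
      case (Basis s)
      then have "(finite intersection_of (\<lambda>x. x \<in> \<B>) relative_to \<Union>\<B>) (\<Union>\<B> \<inter> s)"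
        by (intro relative_to_inc finite_intersection_of_inc)
      moreover have "\<Union>\<B> \<inter> s = s" using Basis by blast
      ultimately show ?case unfolding openin_subbase by (simp add: arbitrary_union_of_inc)
    qed auto
  qed
  then show ?thesis
  proof (rule Alexander_subbase)
    fix \<C> assume \<C>: "\<C> \<subseteq> \<B>" "\<Union>\<C> = topspace (fell_topology :: 'a set topology)"
    define \<V> where "\<V> = {V. open V \<and> {C. closed C \<and> C \<inter> V \<noteq> {}} \<in> \<C>}"
    have "closed (- \<Union>\<V>)" unfolding \<V>_def by (intro closed_Compl open_Union) auto
    then have "- \<Union>\<V> \<in> \<Union>\<C>" unfolding \<C>(2) topspace_fell_topology by simp
    then obtain E where E: "E \<in> \<C>" "- \<Union>\<V> \<in> E" by blast
    have nothit: "E \<noteq> {C. closed C \<and> C \<inter> V \<noteq> {}}" if "open V" for V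
    proof
      assume eq: "E = {C. closed C \<and> C \<inter> V \<noteq> {}}"
      then have "V \<in> \<V>" using E(1) that unfolding \<V>_def by simp
      moreover have "- \<Union>\<V> \<inter> V \<noteq> {}" using E(2) unfolding eq by simp
      ultimately show False by blast
    qed
    have "E \<in> \<B>" using E(1) \<C>(1) by (rule subsetD[rotated])
    then obtain K where K: "compact K" "E = {C. closed C \<and> C \<inter> K = {}}"
      unfolding \<B>_def by (elim UnE CollectE exE conjE) (use nothit in simp)
    then have "K \<subseteq> \<Union>\<V>" using E(2) by blast
    then obtain \<F> where F: "\<F> \<subseteq> \<V>" "finite \<F>" "K \<subseteq> \<Union>\<F>"
      using compactE[OF K(1), of \<V>] unfolding \<V>_def by blast
    let ?C' = "insert E ((\<lambda>V. {C. closed C \<and> C \<inter> V \<noteq> {}}) ` \<F>)"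
    have sub: "?C' \<subseteq> \<C>" using E(1) F(1) unfolding \<V>_def by blast
    moreover have "topspace fell_topology \<subseteq> \<Union>?C'"
    proof
      fix C :: "'a set" assume "C \<in> topspace fell_topology"
      then have C: "closed C" by (simp add: topspace_fell_topology)
      show "C \<in> \<Union>?C'"
      proof (cases "C \<inter> K = {}")
        case True
        then show ?thesis using C K(2) by (intro UnionI[of E]) simp_all
      next
        case False
        then obtain V where "V \<in> \<F>" "C \<inter> V \<noteq> {}" using F(3) by blast
        then show ?thesis using C by (intro UnionI[of "{C. closed C \<and> C \<inter> V \<noteq> {}}"]) simp_all
      qed
    qed
    ultimately have "\<Union>?C' = topspace fell_topology" using Union_mono[OF sub] \<C>(2) by (intro equalityI) simp_all
    then show "\<exists>C'. finite C' \<and> C' \<subseteq> \<C> \<and> \<Union>C' = topspace (fell_topology :: 'a set topology)"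
      using sub F(2) by (intro exI[of _ ?C']) simp
  qed
qed

lemma closed_translate:
  fixes C :: "'a::topological_group_add set"
  assumes "closed C"
  shows "closed (translate g C)"
proof -
  have "closed ((\<lambda>x. - g + x) -` C)" by (intro closed_vimage assms continuous_intros)
  moreover have "(\<lambda>x. - g + x) -` C = translate g C" by (auto simp: mem_translate)
  ultimately show ?thesis by simp
qed

lemma G_space_fell: "G_space (fell_topology :: 'a::lcsc_group set topology) translate"
proof -
  let ?T = "prod_topology (euclidean :: 'a topology) (fell_topology :: 'a set topology)"
  have "continuous_map ?T fell_topology (\<lambda>(g, C). translate g C)"
  proof (rule continuous_map_into_fell)
    show "(\<lambda>(g, C). translate g C) \<in> topspace ?T \<rightarrow> {C. closed C}"
      by (auto simp: topspace_fell_topology closed_translate)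
  next
    fix V :: "'a set" assume V: "open V"
    let ?S = "{x \<in> topspace ?T. (case x of (g, C) \<Rightarrow> translate g C) \<inter> V \<noteq> {}}"
    show "openin ?T ?S"
    proof (subst openin_subopen, intro ballI)
      fix p assume p: "p \<in> ?S"
      then obtain g C where gC: "p = (g, C)" "closed C" "translate g C \<inter> V \<noteq> {}"
        by (auto simp: topspace_fell_topology)
      then obtain c where c: "c \<in> C" "g + c \<in> V" by (auto simp: translate_def)
      have "open ((\<lambda>(x, y). x + y) -` V :: ('a \<times> 'a) set)"
        unfolding case_prod_unfold by (intro open_vimage V continuous_intros)
      moreover have "(g, c) \<in> (\<lambda>(x, y). x + y) -` V" using c by simp
      ultimately obtain A B where AB: "open A" "open B" "(g, c) \<in> A \<times> B" "A \<times> B \<subseteq> (\<lambda>(x, y). x + y) -` V"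
        by (metis open_prod_elim)
      have "openin ?T (A \<times> {C. closed C \<and> C \<inter> B \<noteq> {}})"
        using AB(1) openin_fell_hit[OF AB(2)] unfolding openin_prod_Times_iff by simp
      moreover have "p \<in> A \<times> {C. closed C \<and> C \<inter> B \<noteq> {}}" using gC AB c by auto
      moreover have "A \<times> {C. closed C \<and> C \<inter> B \<noteq> {}} \<subseteq> ?S"
      proof
        fix q assume q: "q \<in> A \<times> {C. closed C \<and> C \<inter> B \<noteq> {}}"
        then obtain a D b where q': "q = (a, D)" "a \<in> A" "closed D" "b \<in> D" "b \<in> B" by blast
        then have "a + b \<in> translate a D \<inter> V" using AB(4) by (auto simp: translate_def)
        then show "q \<in> ?S" using q' by (auto simp: topspace_fell_topology)
      qed
      ultimately show "\<exists>T. openin ?T T \<and> p \<in> T \<and> T \<subseteq> ?S" by blast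
    qed
  next
    fix K :: "'a set" assume K: "compact K"
    let ?S = "{x \<in> topspace ?T. (case x of (g, C) \<Rightarrow> translate g C) \<inter> K = {}}"
    show "openin ?T ?S"
    proof (subst openin_subopen, intro ballI)
      fix p assume p: "p \<in> ?S"
      then obtain g C where gC: "p = (g, C)" "closed C" "translate g C \<inter> K = {}"
        by (auto simp: topspace_fell_topology)
      have "closed ((\<lambda>(k, x). - x + k) -` C :: ('a \<times> 'a) set)"
        unfolding case_prod_unfold by (intro closed_vimage gC continuous_intros)
      from closed_projection_compact[OF K this]
      have "open (- {x. \<exists>k\<in>K. - x + k \<in> C})" by (simp add: open_Compl)
      moreover have "g \<in> - {x. \<exists>k\<in>K. - x + k \<in> C}"
        using gC(3) by (auto simp: mem_translate disjoint_iff)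
      ultimately obtain A A' where A: "open A" "compact A'" "g \<in> A" "A \<subseteq> A'" "A' \<subseteq> - {x. \<exists>k\<in>K. - x + k \<in> C}"
        by (rule compact_neighbourhood)
      \<comment> \<open>Local compactness of the group enters here: the elements near
        \<open>g\<close> lie in the compact \<open>A'\<close>, so missing the single compact set
        \<open>L\<close> handles all of them at once.\<close>
      define L where "L = (\<lambda>(a, k). - a + k) ` (A' \<times> K)"
      have "compact L"
        unfolding L_def case_prod_unfold
        by (intro compact_continuous_image compact_Times A K continuous_intros)
      then have "openin ?T (A \<times> {C. closed C \<and> C \<inter> L = {}})"
        using A(1) openin_fell_miss[of L] unfolding openin_prod_Times_iff by simp
      moreover have "p \<in> A \<times> {C. closed C \<and> C \<inter> L = {}}"
        using gC A by (auto simp: L_def)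
      moreover have "A \<times> {C. closed C \<and> C \<inter> L = {}} \<subseteq> ?S"
        using A(4) by (fastforce simp: topspace_fell_topology mem_translate L_def)
      ultimately show "\<exists>T. openin ?T T \<and> p \<in> T \<and> T \<subseteq> ?S" by blast
    qed
  qed
  then show ?thesis unfolding G_space_def by (simp add: translate_translate)
qed

lemma G_space_subtopology:
  assumes "G_space T act" "S \<subseteq> topspace T" "\<And>g x. x \<in> S \<Longrightarrow> act g x \<in> S"
  shows "G_space (subtopology T S) act"
proof -
  have "continuous_map (prod_topology euclidean (subtopology T S)) (subtopology T S) (\<lambda>(g, x). act g x)"
    unfolding prod_topology_subtopology continuous_map_in_subtopology
  proof
    show "continuous_map (subtopology (prod_topology euclidean T) (topspace euclidean \<times> S)) T (\<lambda>(g, x). act g x)"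
      by (rule continuous_map_from_subtopology[OF G_spaceD(6)[OF assms(1)]])
  qed (use assms(3) in auto)
  then show ?thesis
    using G_spaceD(2,3)[OF assms(1)] by (simp add: G_space_def)
qed

lemma hull_of_translate:
  assumes "C \<in> hull_of P"
  shows "translate g C \<in> hull_of P"
proof -
  have "translate g ` orbit translate P \<subseteq> orbit translate P"
    by (auto simp: orbit_def translate_translate)
  then have "fell_topology closure_of (translate g ` orbit translate P) \<subseteq> hull_of P"
    unfolding hull_of_def by (rule closure_of_mono)
  then show ?thesis
    using continuous_map_image_closure_subset[OF G_spaceD(7)[OF G_space_fell], of g "orbit translate P"] assms
    unfolding hull_of_def by blast
qed

lemma hull_of_closed: "hull_of P \<subseteq> {C. closed C}"
  unfolding hull_of_def topspace_fell_topology[symmetric] by (rule closure_of_subset_topspace)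

lemma translate_empty_iff [simp]: "translate g C = {} \<longleftrightarrow> C = {}"
  by (simp add: translate_def)

lemma G_space_hull: "G_space (subtopology fell_topology (hull_of P)) translate"
  using hull_of_closed by (intro G_space_subtopology G_space_fell hull_of_translate) (auto simp: topspace_fell_topology)

lemma G_space_punctured_hull: "G_space (subtopology fell_topology (punctured_hull_of P)) translate"
  unfolding punctured_hull_of_def using hull_of_closed
  by (intro G_space_subtopology G_space_fell) (auto simp: topspace_fell_topology intro: hull_of_translate)

lemma topspace_punctured_hull:
  "topspace (subtopology fell_topology (punctured_hull_of P)) = punctured_hull_of P"
  using hull_of_closed by (auto simp: topspace_fell_topology punctured_hull_of_def)

lemma topspace_hull:
  "topspace (subtopology fell_topology (hull_of P)) = hull_of P"
  using hull_of_closed by (auto simp: topspace_fell_topology)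

section \<open>Model sets\<close>

locale regular_model = irreducible_lattice \<Gamma> m\<^sub>G m\<^sub>H m
  for \<Gamma> :: "('g::lcsc_group \<times> 'h::lcsc_group) set" and m\<^sub>G m\<^sub>H m +
  fixes W :: "'h set"
  assumes inj: "inj_on fst \<Gamma>" and countable: "countable \<Gamma>"
    and compact_W: "compact W" and interior_ne: "interior W \<noteq> {}"
    and frontier_null: "emeasure m\<^sub>H (frontier W) = 0"
    and dense_interior: "closure (interior W) = W"
    and stabilizer: "{h. translate h W = W} = {0}"
    and frontier_\<Gamma>: "frontier W \<inter> snd ` \<Gamma> = {}"
begin

section \<open>Inner and outer patches of a coset\<close>

definition P_cl :: "('g \<times> 'h) set \<Rightarrow> 'g set" where "P_cl y = fst ` (y \<inter> UNIV \<times> W)"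
definition P_int :: "('g \<times> 'h) set \<Rightarrow> 'g set" where "P_int y = fst ` (y \<inter> UNIV \<times> interior W)"
text \<open>Whether a limit of translates keeps a point lying over the frontier of the window
  depends on the approach. The two inclusions are what survives passage to limits.\<close>

definition between :: "'g set \<Rightarrow> ('g \<times> 'h) set \<Rightarrow> bool" where
  "between P y \<longleftrightarrow> P_int y \<subseteq> P \<and> P \<subseteq> P_cl y"

lemma mem_P_cl: "x \<in> P_cl y \<longleftrightarrow> (\<exists>h\<in>W. (x, h) \<in> y)"
  by (force simp: P_cl_def)

lemma mem_P_int: "x \<in> P_int y \<longleftrightarrow> (\<exists>h\<in>interior W. (x, h) \<in> y)"
  by (force simp: P_int_def)

lemma P_int_subset_P_cl: "P_int y \<subseteq> P_cl y"
  using interior_subset[of W] unfolding mem_P_cl mem_P_int subset_iff by blast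

lemma between_P_cl: "between (P_cl y) y"
  by (simp add: between_def P_int_subset_P_cl)

lemma closed_W: "closed W" using compact_W by (rule compact_imp_closed)

lemma P_cl_meets: "P_cl y \<inter> V \<noteq> {} \<longleftrightarrow> y \<inter> V \<times> W \<noteq> {}"
  by (fastforce simp: mem_P_cl)

lemma P_int_meets: "P_int y \<inter> V \<noteq> {} \<longleftrightarrow> y \<inter> V \<times> interior W \<noteq> {}"
  by (fastforce simp: mem_P_int)

lemma closed_P_cl: "closed (P_cl (\<pi> l))"
proof -
  have "closed (prod.swap -` \<pi> l)"
    unfolding prod.swap_def[abs_def] by (intro closed_vimage closed_coset continuous_intros)
  from closed_projection_compact[OF compact_W this]
  have "closed {x. \<exists>h\<in>W. (h, x) \<in> prod.swap -` \<pi> l}" .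
  moreover have "{x. \<exists>h\<in>W. (h, x) \<in> prod.swap -` \<pi> l} = P_cl (\<pi> l)" by (auto simp: mem_P_cl)
  ultimately show ?thesis by simp
qed

lemma P_cl_act: "P_cl (act\<^sub>G g y) = translate g (P_cl y)"
  by (auto simp: mem_P_cl mem_translate)

lemma P_int_act: "P_int (act\<^sub>G g y) = translate g (P_int y)"
  by (auto simp: mem_P_int mem_translate)

lemma between_act: "between P y \<Longrightarrow> between (translate g P) (act\<^sub>G g y)"
  unfolding between_def P_cl_act P_int_act by (simp add: translate_subset_iff)

text \<open>Density of the projection of \<Gamma> brings the second coordinate of some point of the
  coset into the interior of the window.\<close>

lemma P_int_nonempty: "P_int (\<pi> l) \<noteq> {}"
proof -
  obtain a b where l: "l = (a, b)" by (cases l)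
  obtain w where w: "w \<in> interior W" using interior_ne by blast
  have "open {d. b + d + 0 \<in> interior W}" by (rule open_translate_vimage) simp
  moreover have "- b + w \<in> {d. b + d + 0 \<in> interior W}" using w by (simp add: add.assoc[symmetric])
  ultimately obtain d where d: "d \<in> snd ` \<Gamma>" "b + d + 0 \<in> interior W"
    using dense_meets_open[OF dense] by (metis (no_types, lifting) empty_iff mem_Collect_eq)
  then obtain c where c: "(c, d) \<in> \<Gamma>" by auto
  have "(a + c, b + d) \<in> \<pi> l" using c unfolding mem_coset l by force
  then have "a + c \<in> P_int (\<pi> l)" using d(2) unfolding mem_P_int by auto
  then show ?thesis by blast
qed

lemma between_nonempty: "between P (\<pi> l) \<Longrightarrow> P \<noteq> {}"
  using P_int_nonempty unfolding between_def by blast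

text \<open>Injectivity of the first projection turns an inclusion between the two patches at a common
  point \<open>p\<close> into an inclusion between windows on the dense set \<open>snd ` \<Gamma>\<close>.\<close>

lemma window_translate_subset:
  assumes "P_int (\<pi> (p, h1)) \<subseteq> P_cl (\<pi> (p, h2))"
  shows "translate (h2 - h1) W \<subseteq> W"
proof -
  let ?f = "\<lambda>x. h2 + - h1 + x"
  have cl: "closed (?f -` W)" by (intro closed_vimage closed_W continuous_intros)
  define B where "B = {d. h1 + d + 0 \<in> interior W - ?f -` W}"
  have "open B" unfolding B_def by (intro open_translate_vimage open_Diff open_interior cl)
  moreover have "d \<notin> B" if d: "d \<in> snd ` \<Gamma>" for d
  proof
    assume "d \<in> B"
    moreover have "h2 + - h1 + (h1 + d) = h2 + d" by (simp only: add.assoc minus_add_cancel)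
    ultimately have 1: "h1 + d \<in> interior W" "h2 + d \<notin> W"
      unfolding B_def add_0_right vimage_def Diff_iff mem_Collect_eq by simp_all
    obtain c where c: "(c, d) \<in> \<Gamma>" using d by auto
    have "(p + c, h1 + d) \<in> \<pi> (p, h1)" using c unfolding mem_coset by force
    then have "p + c \<in> P_int (\<pi> (p, h1))" using 1 mem_P_int by blast
    then obtain h where h: "h \<in> W" "(p + c, h) \<in> \<pi> (p, h2)" using assms mem_P_cl by blast
    then obtain c' d' where cd': "(c', d') \<in> \<Gamma>" "(p + c, h) = (p, h2) + (c', d')"
      unfolding mem_coset by auto
    then have "c' = c" "h = h2 + d'" by auto
    moreover have "d' = d" using inj_onD[OF inj, of "(c', d')" "(c, d)"] cd'(1) c \<open>c' = c\<close> by simp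
    ultimately show False using 1 h by simp
  qed
  ultimately have "B = {}" using dense_meets_open[OF dense, of B] by blast
  have "interior W \<subseteq> ?f -` W"
  proof
    fix x assume x: "x \<in> interior W"
    have "- h1 + x \<notin> B" using \<open>B = {}\<close> by blast
    then show "x \<in> ?f -` W" using x unfolding B_def by (simp add: add.assoc[symmetric])
  qed
  \<comment> \<open>Dense interior of the window extends the inclusion from the interior to all of
    \<open>W\<close>.\<close>
  then have "W \<subseteq> ?f -` W" using closure_minimal[OF _ cl] dense_interior by metis
  then show ?thesis by (auto simp: translate_def diff_conv_add_uminus simp del: add_uminus_conv_diff)
qed

text \<open>The inner patch of the first coset lies in the outer patch of the second, so both cosets
  contain a point over a common \<open>p\<close>, and they are compared there. The two cross
  inclusions of patches become opposite inclusions of windows, and the trivial stabilizer gives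
  \<open>h1 = h2\<close>.\<close>

lemma between_unique:
  assumes "between P (\<pi> l1)" "between P (\<pi> l2)"
  shows "\<pi> l1 = \<pi> l2"
proof -
  obtain p where p: "p \<in> P_int (\<pi> l1)" using P_int_nonempty by blast
  then obtain h1 where h1: "(p, h1) \<in> \<pi> l1" by (auto simp: mem_P_int)
  have "p \<in> P_cl (\<pi> l2)" using p assms by (auto simp: between_def)
  then obtain h2 where h2: "(p, h2) \<in> \<pi> l2" by (auto simp: mem_P_cl)
  have y: "\<pi> l1 = \<pi> (p, h1)" "\<pi> l2 = \<pi> (p, h2)" using h1 h2 coset_eq_iff by blast+
  have a: "translate (h2 - h1) W \<subseteq> W"
    by (rule window_translate_subset[of p]) (use assms in \<open>auto simp: between_def y\<close>)
  have b: "translate (h1 - h2) W \<subseteq> W"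
    by (rule window_translate_subset[of p]) (use assms in \<open>auto simp: between_def y\<close>)
  have "W = translate (h2 - h1) (translate (h1 - h2) W)"
    unfolding translate_translate diff_conv_add_uminus by (simp only: add.assoc minus_add_cancel right_minus translate_0)
  also have "\<dots> \<subseteq> translate (h2 - h1) W" using b by (simp add: translate_subset_iff)
  finally have "translate (h2 - h1) W = W" using a by blast
  then have "h2 - h1 = 0" using stabilizer by blast
  then show ?thesis using y by simp
qed

text \<open>With \<open>open_P_cl_misses\<close> this explains the use of two patches: hitting an
  open set is stable for the inner patch, missing a compact set for the outer one.\<close>

lemma open_P_int_meets: "open V \<Longrightarrow> open {l. P_int (\<pi> l) \<inter> V \<noteq> {}}"
  unfolding P_int_meets by (intro open_meets open_Times open_interior)

lemma open_P_cl_misses: "compact K \<Longrightarrow> open {l. P_cl (\<pi> l) \<inter> K = {}}"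
proof -
  assume "compact K"
  then have "closed {l. P_cl (\<pi> l) \<inter> K \<noteq> {}}"
    unfolding P_cl_meets by (intro closed_meets compact_Times compact_W)
  moreover have "- {l. P_cl (\<pi> l) \<inter> K \<noteq> {}} = {l. P_cl (\<pi> l) \<inter> K = {}}" by auto
  ultimately show ?thesis using open_Compl by metis
qed

text \<open>Closedness of the relation \<open>between\<close> in both arguments jointly; it replaces
  passing to limits of sequences. Local compactness of \<open>G\<close> turns a violating point into
  an open set inside a compact one, where one side is tested by hitting and the other by
  missing.\<close>

lemma not_between_open:
  assumes P: "closed P" and n: "\<not> between P (\<pi> l)"
  shows "\<exists>N O'. openin fell_topology N \<and> P \<in> N \<and> open O' \<and> l \<in> O' \<and>
    (\<forall>P'\<in>N. \<forall>l'\<in>O'. \<not> between P' (\<pi> l'))"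
proof -
  consider p where "p \<in> P_int (\<pi> l)" "p \<in> - P" | p where "p \<in> P" "p \<in> - P_cl (\<pi> l)"
    using n by (auto simp: between_def)
  then show ?thesis
  proof cases
    case 1
    obtain V K where VK: "open V" "compact K" "p \<in> V" "V \<subseteq> K" "K \<subseteq> - P"
      using compact_neighbourhood[OF open_Compl[OF P] 1(2)] by metis
    have "\<not> between P' (\<pi> l')" if "P' \<inter> K = {}" "P_int (\<pi> l') \<inter> V \<noteq> {}" for P' l'
      using that VK(4) unfolding between_def by blast
    moreover have "P \<inter> K = {}" "P_int (\<pi> l) \<inter> V \<noteq> {}" using 1 VK by blast+
    ultimately show ?thesis
      using openin_fell_miss[OF VK(2)] open_P_int_meets[OF VK(1)] P
      by (intro exI[of _ "{C. closed C \<and> C \<inter> K = {}}"] exI[of _ "{l. P_int (\<pi> l) \<inter> V \<noteq> {}}"]) simp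
  next
    case 2
    obtain V K where VK: "open V" "compact K" "p \<in> V" "V \<subseteq> K" "K \<subseteq> - P_cl (\<pi> l)"
      using compact_neighbourhood[OF open_Compl[OF closed_P_cl] 2(2)] by metis
    have "\<not> between P' (\<pi> l')" if "P' \<inter> V \<noteq> {}" "P_cl (\<pi> l') \<inter> K = {}" for P' l'
      using that VK(4) unfolding between_def by blast
    moreover have "P \<inter> V \<noteq> {}" "P_cl (\<pi> l) \<inter> K = {}" using 2 VK by blast+
    ultimately show ?thesis
      using openin_fell_hit[OF VK(1)] open_P_cl_misses[OF VK(2)] P
      by (intro exI[of _ "{C. closed C \<and> C \<inter> V \<noteq> {}}"] exI[of _ "{l. P_cl (\<pi> l) \<inter> K = {}}"]) simp
  qed
qed

text \<open>Near a non-empty \<open>P\<close> every \<open>P'\<close> meets a fixed compact set \<open>K\<close>, so any coset associated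
  with \<open>P'\<close> has a representative in the compact set \<open>K \<times> W\<close>.\<close>

lemma between_upper_semicontinuous:
  assumes P: "closed P" "P \<noteq> {}" and U: "openin Y U" and imp: "\<And>l. between P (\<pi> l) \<Longrightarrow> \<pi> l \<in> U"
  shows "\<exists>N. openin fell_topology N \<and> P \<in> N \<and> (\<forall>P'\<in>N. \<forall>l. between P' (\<pi> l) \<longrightarrow> \<pi> l \<in> U)"
proof -
  obtain p where p: "p \<in> P" using P(2) by blast
  obtain V K where VK: "open V" "compact K" "p \<in> V" "V \<subseteq> K" using compact_neighbourhood[OF open_UNIV UNIV_I] by metis
  define Q where "Q = K \<times> W - {l. \<pi> l \<in> U}"
  have Q: "compact Q" unfolding Q_def by (intro compact_diff compact_Times VK(2) compact_W openin_vimage U)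
  have "\<exists>N O'. openin fell_topology N \<and> P \<in> N \<and> open O' \<and> l \<in> O' \<and>
    (\<forall>P'\<in>N. \<forall>l'\<in>O'. \<not> between P' (\<pi> l'))" if "l \<in> Q" for l
    by (rule not_between_open[OF P(1)]) (use imp that in \<open>auto simp: Q_def\<close>)
  then obtain N O' where NO: "\<And>l. l \<in> Q \<Longrightarrow> openin fell_topology (N l) \<and> P \<in> N l \<and> open (O' l) \<and> l \<in> O' l \<and>
    (\<forall>P'\<in>N l. \<forall>l'\<in>O' l. \<not> between P' (\<pi> l'))" by metis
  obtain D where D: "D \<subseteq> Q" "finite D" "Q \<subseteq> (\<Union>l\<in>D. O' l)"
    by (rule compactE_image[OF Q, of Q O']) (use NO in auto)
  \<comment> \<open>The hit set is inserted so that the intersection is over a non-empty family even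
    if \<open>D\<close> is empty.\<close>
  define M where "M = {C. closed C \<and> C \<inter> V \<noteq> {}} \<inter> (\<Inter>(insert {C. closed C \<and> C \<inter> V \<noteq> {}} (N ` D)))"
  have "openin fell_topology M"
    unfolding M_def using D NO openin_fell_hit[OF VK(1)] by (intro openin_Int openin_Inter) auto
  moreover have "P \<in> M" using P p VK(3) D(1) NO unfolding M_def by auto
  moreover have "\<pi> l \<in> U" if P': "P' \<in> M" and l: "between P' (\<pi> l)" for P' l
  proof (rule ccontr)
    assume nU: "\<pi> l \<notin> U"
    obtain q where q: "q \<in> P'" "q \<in> V" using P' unfolding M_def by blast
    then have "q \<in> P_cl (\<pi> l)" using l unfolding between_def by blast
    then obtain h where h: "h \<in> W" "(q, h) \<in> \<pi> l" by (auto simp: mem_P_cl)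
    then have eq: "\<pi> (q, h) = \<pi> l" using coset_eq_iff by blast
    have "(q, h) \<in> Q" unfolding Q_def using h q(2) VK(4) nU eq by auto
    then obtain d where d: "d \<in> D" "(q, h) \<in> O' d" using D(3) by blast
    moreover have "P' \<in> N d" using P' d(1) unfolding M_def by blast
    ultimately have "\<not> between P' (\<pi> (q, h))" using NO[of d] D(1) by blast
    then show False using l eq by simp
  qed
  ultimately show ?thesis by blast
qed

section \<open>From the punctured hull to the coset space\<close>

abbreviation "P0 \<equiv> P_cl \<Gamma>"
abbreviation "Xp \<equiv> punctured_hull_of P0"
abbreviation "Tp \<equiv> subtopology fell_topology Xp"

lemma coset_0: "\<pi> 0 = \<Gamma>" by simp

lemma orbit_P0: "orbit translate P0 = range (\<lambda>g. P_cl (\<pi> (g, 0)))"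
  unfolding orbit_def P_cl_act[symmetric] by simp

text \<open>Upper semicontinuity with the empty set of cosets: if no coset belonged to
  \<open>P\<close>, none would belong to any set near \<open>P\<close>, but translates of
  \<open>P0\<close> come arbitrarily near and each has its own coset.\<close>

lemma between_exists:
  assumes "P \<in> Xp"
  shows "\<exists>l. between P (\<pi> l)"
proof (rule ccontr)
  assume no: "\<not> ?thesis"
  have P: "P \<in> hull_of P0" "P \<noteq> {}" using assms by (auto simp: punctured_hull_of_def)
  have "closed P" using P(1) hull_of_closed by blast
  have "\<exists>N. openin fell_topology N \<and> P \<in> N \<and> (\<forall>P'\<in>N. \<forall>l. between P' (\<pi> l) \<longrightarrow> \<pi> l \<in> {})"
    using between_upper_semicontinuous[OF \<open>closed P\<close> P(2) openin_empty] no by blast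
  then obtain N where N: "openin fell_topology N" "P \<in> N" "\<And>P' l. P' \<in> N \<Longrightarrow> \<not> between P' (\<pi> l)" by blast
  then obtain g where "P_cl (\<pi> (g, 0)) \<in> N"
    using P(1) unfolding hull_of_def in_closure_of orbit_P0 by blast
  then show False using N(3) between_P_cl by blast
qed

definition \<beta> :: "'g set \<Rightarrow> ('g \<times> 'h) set" where
  "\<beta> P = (THE y. y \<in> range \<pi> \<and> between P y)"

lemma \<beta>_eqI:
  assumes "between P (\<pi> l)"
  shows "\<beta> P = \<pi> l"
  unfolding \<beta>_def
proof (rule the_equality)
  fix y assume y: "y \<in> range \<pi> \<and> between P y"
  then obtain k where "y = \<pi> k" by blast
  then show "y = \<pi> l" using between_unique[OF _ assms, of k] y by blast
qed (use assms in blast)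

lemma \<beta>_between: "P \<in> Xp \<Longrightarrow> between P (\<beta> P)"
  and \<beta>_range: "P \<in> Xp \<Longrightarrow> \<beta> P \<in> topspace Y"
proof -
  assume "P \<in> Xp"
  from between_exists[OF this] obtain l where "between P (\<pi> l)" ..
  then show "between P (\<beta> P)" "\<beta> P \<in> topspace Y" using \<beta>_eqI by (simp_all add: topspace_Y)
qed

lemma \<beta>_act:
  assumes "P \<in> Xp"
  shows "\<beta> (translate g P) = act\<^sub>G g (\<beta> P)"
proof -
  obtain l where l: "between P (\<pi> l)" using between_exists[OF assms] ..
  from between_act[OF this, of g] have "between (translate g P) (\<pi> ((g, 0) + l))"
    by (simp add: translate_translate)
  then show ?thesis using \<beta>_eqI[OF l] by (simp add: \<beta>_eqI translate_translate)
qed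

text \<open>For a single-valued relation upper semicontinuity is continuity.\<close>

lemma continuous_map_\<beta>: "continuous_map Tp Y \<beta>"
  unfolding continuous_map_def
proof (intro conjI allI impI)
  show "\<beta> \<in> topspace Tp \<rightarrow> topspace Y" using \<beta>_range unfolding topspace_punctured_hull by blast
  fix U assume U: "openin Y U"
  show "openin Tp {P \<in> topspace Tp. \<beta> P \<in> U}"
  proof (subst openin_subopen, intro ballI)
    fix P assume "P \<in> {P \<in> topspace Tp. \<beta> P \<in> U}"
    then have P: "P \<in> Xp" "\<beta> P \<in> U" unfolding topspace_punctured_hull by blast+
    then have "closed P" "P \<noteq> {}" using hull_of_closed by (auto simp: punctured_hull_of_def)
    then obtain N where N: "openin fell_topology N" "P \<in> N" "\<forall>P'\<in>N. \<forall>l. between P' (\<pi> l) \<longrightarrow> \<pi> l \<in> U"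
      using between_upper_semicontinuous[OF _ _ U] \<beta>_eqI P(2) by metis
    have "N \<inter> Xp \<subseteq> {P \<in> topspace Tp. \<beta> P \<in> U}"
    proof
      fix P' assume P': "P' \<in> N \<inter> Xp"
      then obtain l where l: "between P' (\<pi> l)" using between_exists by blast
      then have "\<pi> l \<in> U" using P' N(3) by blast
      then have "\<beta> P' \<in> U" unfolding \<beta>_eqI[OF l] .
      then show "P' \<in> {P \<in> topspace Tp. \<beta> P \<in> U}" using P' unfolding topspace_punctured_hull by blast
    qed
    moreover have "openin Tp (N \<inter> Xp)" using N(1) by (rule openin_subtopology_Int)
    ultimately show "\<exists>T. openin Tp T \<and> P \<in> T \<and> T \<subseteq> {P \<in> topspace Tp. \<beta> P \<in> U}"
      using N(2) P(1) by blast
  qed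
qed

section \<open>Singular and nonsingular cosets\<close>

lemma frontier_W: "frontier W = W - interior W"
  by (simp add: frontier_def closure_closed closed_W)

lemma compact_frontier_W: "compact (frontier W)"
  unfolding frontier_W by (intro compact_diff compact_W open_interior)

definition Y\<^sub>s :: "('g \<times> 'h) set set" where "Y\<^sub>s = \<pi> ` (UNIV \<times> frontier W)"

lemma mem_Y\<^sub>s: "\<pi> l \<in> Y\<^sub>s \<longleftrightarrow> (\<exists>x. \<exists>h\<in>frontier W. (x, h) \<in> \<pi> l)"
  unfolding Y\<^sub>s_def coset_mem_image by auto

lemma nonsingular_P_int:
  assumes "\<pi> l \<notin> Y\<^sub>s"
  shows "P_int (\<pi> l) = P_cl (\<pi> l)"
proof -
  have "h \<in> interior W" if "(x, h) \<in> \<pi> l" "h \<in> W" for x h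
    using assms that unfolding mem_Y\<^sub>s frontier_W by blast
  then have "P_cl (\<pi> l) \<subseteq> P_int (\<pi> l)" unfolding mem_P_cl mem_P_int subset_iff by blast
  then show ?thesis using P_int_subset_P_cl by (rule equalityI[rotated])
qed

lemma between_nonsingular: "\<pi> l \<notin> Y\<^sub>s \<Longrightarrow> between P (\<pi> l) \<longleftrightarrow> P = P_cl (\<pi> l)"
  using nonsingular_P_int unfolding between_def by auto

lemma act_Y\<^sub>s:
  assumes "y \<in> topspace Y"
  shows "act\<^sub>G g y \<in> Y\<^sub>s \<longleftrightarrow> y \<in> Y\<^sub>s"
proof -
  have imp: "act\<^sub>G g y \<in> Y\<^sub>s" if "y \<in> Y\<^sub>s" for g y
  proof -
    obtain x h where "y = \<pi> (x, h)" "h \<in> frontier W" using \<open>y \<in> Y\<^sub>s\<close> unfolding Y\<^sub>s_def by auto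
    then have "act\<^sub>G g y = \<pi> (g + x, h)" by (simp add: translate_translate)
    then show ?thesis using \<open>h \<in> frontier W\<close> unfolding Y\<^sub>s_def by blast
  qed
  show ?thesis using imp[of y g] imp[of "act\<^sub>G g y" "- g"] G_spaceD(4)[OF G_space_G assms] by auto
qed

lemma Y\<^sub>s_measurable: "Y\<^sub>s \<in> sets (borel_of Y)"
proof -
  obtain K :: "nat \<Rightarrow> 'g set" where K: "\<And>n. compact (K n)" "(\<Union>n. K n) = UNIV"
    using open_sigma_compact[OF open_UNIV] by metis
  have "Y\<^sub>s = (\<Union>n. \<pi> ` (K n \<times> frontier W))" unfolding Y\<^sub>s_def K(2)[symmetric] by blast
  moreover have "\<pi> ` (K n \<times> frontier W) \<in> sets (borel_of Y)" for n
    by (intro closedin_sets_borel_of closedin_compact_image compact_Times K compact_frontier_W)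
  ultimately show ?thesis by (auto intro!: sets.countable_UN)
qed

lemma Y\<^sub>s_null: "emeasure m Y\<^sub>s = 0"
proof (rule null_of_AE_orbit[OF G_space_H haar_H inv_H Y\<^sub>s_measurable])
  fix y assume "y \<in> topspace Y"
  then obtain g k where y: "y = \<pi> (g, k)" by (auto simp: topspace_Y)
  have fr: "frontier W \<in> sets borel" by (simp add: frontier_closed)
  have "act\<^sub>H h y \<in> Y\<^sub>s \<longleftrightarrow> (\<exists>d\<in>snd ` \<Gamma>. h + (k + d) \<in> frontier W)" for h
  proof -
    have "act\<^sub>H h y = \<pi> (g, h + k)" by (simp add: y translate_translate)
    then have "act\<^sub>H h y \<in> Y\<^sub>s \<longleftrightarrow> (\<exists>x. \<exists>h'\<in>frontier W. \<exists>\<gamma>\<in>\<Gamma>. (x, h') = (g, h + k) + \<gamma>)"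
      by (simp only: mem_Y\<^sub>s mem_coset)
    also have "\<dots> \<longleftrightarrow> (\<exists>d\<in>snd ` \<Gamma>. h + (k + d) \<in> frontier W)"
      by (force simp: add.assoc plus_prod_def prod_eq_iff)
    finally show ?thesis .
  qed
  then have "{h. act\<^sub>H h y \<in> Y\<^sub>s} = (\<Union>d\<in>snd ` \<Gamma>. (\<lambda>h. h + (k + d)) -` frontier W)" by auto
  moreover have "(\<Union>d\<in>snd ` \<Gamma>. (\<lambda>h. h + (k + d)) -` frontier W) \<in> null_sets m\<^sub>H"
  proof (rule null_sets_UN')
    fix d
    have "(\<lambda>h. h + (k + d)) \<in> borel_measurable (borel :: 'h measure)"
      by (intro borel_measurable_continuous_onI continuous_intros)
    from measurable_sets[OF this fr] have "(\<lambda>h. h + (k + d)) -` frontier W \<in> sets borel" by simp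
    then show "(\<lambda>h. h + (k + d)) -` frontier W \<in> null_sets m\<^sub>H"
      using left_haar_null_right_translate[OF haar_H fr frontier_null] left_haar_measure_sets[OF haar_H]
      by (simp add: null_sets_def)
  qed (use countable in simp)
  ultimately show "emeasure m\<^sub>H {h. act\<^sub>H h y \<in> Y\<^sub>s} = 0" by auto
qed

text \<open>This is \<Gamma>-regularity of the window. It makes \<open>P0\<close> the patch of a
  nonsingular coset, which puts \<open>P0\<close> into the orbit closure of every point of the
  punctured hull.\<close>

lemma \<Gamma>_nonsingular: "\<Gamma> \<notin> Y\<^sub>s"
  using frontier_\<Gamma> mem_Y\<^sub>s[of 0] unfolding coset_0 by force

text \<open>Representatives whose coset alone guarantees membership in \<open>N\<close>, whichever
  frontier points a sandwiched set retains. Its interior turns Fell neighbourhoods into open sets of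
  representatives.\<close>

definition forced :: "'g set set \<Rightarrow> ('g \<times> 'h) set" where
  "forced N = {l. \<forall>P. closed P \<longrightarrow> between P (\<pi> l) \<longrightarrow> P \<in> N}"

text \<open>Induction over the generation of \<open>N\<close>. A hit set is forced by the inner
  patch and a miss set by the outer one, both open conditions; at a nonsingular coset the two
  patches agree, so both are available. \<open>forced\<close> commutes with intersections and is
  monotone.\<close>

lemma nonsingular_interior_forced:
  assumes N: "openin fell_topology N" and l: "\<pi> l \<notin> Y\<^sub>s" "P_cl (\<pi> l) \<in> N"
  shows "l \<in> interior (forced N)"
proof -
  have "generate_topology_on ({{C. closed C \<and> C \<inter> V \<noteq> {}} |V. open V} \<union> {{C. closed C \<and> C \<inter> K = {}} |K. compact K}) N"
    using N unfolding fell_topology_def by (rule openin_topology_generated_by)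
  then show ?thesis using l(2)
  proof induction
    case (Int a b)
    then have "l \<in> interior (forced a \<inter> forced b)" by simp
    moreover have "forced a \<inter> forced b = forced (a \<inter> b)" unfolding forced_def by auto
    ultimately show ?case by simp
  next
    case (UN \<K>)
    then obtain k where k: "k \<in> \<K>" "P_cl (\<pi> l) \<in> k" by blast
    then have "forced k \<subseteq> forced (\<Union>\<K>)" unfolding forced_def by blast
    then show ?case using UN.IH[OF k] interior_mono by blast
  next
    case (Basis s)
    from Basis.hyps have "(\<exists>V. s = {C. closed C \<and> C \<inter> V \<noteq> {}} \<and> open V) \<or>
        (\<exists>K. s = {C. closed C \<and> C \<inter> K = {}} \<and> compact K)"
      unfolding Un_iff mem_Collect_eq .
    then consider V where "open V" "s = {C. closed C \<and> C \<inter> V \<noteq> {}}"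
      | K where "compact K" "s = {C. closed C \<and> C \<inter> K = {}}" by (elim disjE exE conjE)
    then show ?case
    proof cases
      case 1
      have "P_int (\<pi> l) \<inter> V \<noteq> {}" using Basis.prems nonsingular_P_int[OF l(1)] 1(2) by simp
      moreover have "{l. P_int (\<pi> l) \<inter> V \<noteq> {}} \<subseteq> forced s"
        unfolding forced_def between_def 1(2) by blast
      ultimately show ?thesis using interiorI[OF open_P_int_meets[OF 1(1)]] by simp
    next
      case 2
      have "P_cl (\<pi> l) \<inter> K = {}" using Basis.prems 2(2) by simp
      moreover have "{l. P_cl (\<pi> l) \<inter> K = {}} \<subseteq> forced s"
        unfolding forced_def between_def 2(2) by blast
      ultimately show ?thesis using interiorI[OF open_P_cl_misses[OF 2(1)]] by simp
    qed
  qed simp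
qed

lemma G_orbit_dense:
  assumes "open O'" "O' \<noteq> {}"
  shows "\<exists>g. \<exists>l'\<in>O'. \<pi> l' = act\<^sub>G g (\<pi> l)"
proof -
  obtain a b where ab: "(a, b) \<in> O'" using assms(2) by auto
  obtain A B where AB: "open A" "open B" "(a, b) \<in> A \<times> B" "A \<times> B \<subseteq> O'"
    by (rule open_prod_elim[OF assms(1) ab])
  obtain x h where l: "l = (x, h)" by (cases l)
  have "open {d. h + d + 0 \<in> B}" by (rule open_translate_vimage[OF AB(2)])
  moreover have "- h + b \<in> {d. h + d + 0 \<in> B}" using AB(3) by (simp add: add.assoc[symmetric])
  ultimately obtain d where d: "d \<in> snd ` \<Gamma>" "h + d + 0 \<in> B"
    using dense_meets_open[OF dense] by (metis (no_types, lifting) empty_iff mem_Collect_eq)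
  then obtain c where c: "(c, d) \<in> \<Gamma>" by auto
  \<comment> \<open>Solves \<open>g + x + c = a\<close>, so that the representative changed by
    \<open>(c, d)\<close> lands on \<open>(a, h + d)\<close>.\<close>
  define g where "g = a + - c + - x"
  have "act\<^sub>G g (\<pi> l) = \<pi> (a + - c, h)"
    by (simp add: l g_def translate_translate add.assoc)
  also have "\<dots> = \<pi> ((a + - c, h) + (c, d))" by (rule coset_add[OF c, symmetric])
  also have "\<dots> = \<pi> (a, h + d)" by (simp add: add.assoc)
  finally have "\<pi> (a, h + d) = act\<^sub>G g (\<pi> l)" by simp
  moreover have "(a, h + d) \<in> O'" using AB(3,4) d(2) by auto
  ultimately show ?thesis by blast
qed

text \<open>Some translate of \<open>P\<close> lies over the interior of \<open>forced N\<close>,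
  hence in \<open>N\<close>. With \<open>P0\<close> for \<open>P\<close> it places all nonsingular
  patches in the hull; with 0 for \<open>l0\<close> it gives minimality.\<close>

lemma orbit_closure_nonsingular:
  assumes P: "closed P" "between P (\<pi> l)" and l0: "\<pi> l0 \<notin> Y\<^sub>s"
  shows "P_cl (\<pi> l0) \<in> hull_of P"
  unfolding hull_of_def in_closure_of
proof (intro conjI allI impI)
  show "P_cl (\<pi> l0) \<in> topspace fell_topology" by (simp add: topspace_fell_topology closed_P_cl)
  fix N assume "P_cl (\<pi> l0) \<in> N \<and> openin fell_topology N"
  then have "interior (forced N) \<noteq> {}" using nonsingular_interior_forced[OF _ l0] by blast
  then obtain g l' where gl: "l' \<in> interior (forced N)" "\<pi> l' = act\<^sub>G g (\<pi> l)"
    using G_orbit_dense[OF open_interior] by blast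
  have "between (translate g P) (\<pi> l')" unfolding gl(2) by (rule between_act[OF P(2)])
  moreover have "l' \<in> forced N" using gl(1) interior_subset by blast
  ultimately have "translate g P \<in> N" using closed_translate[OF P(1)] unfolding forced_def by blast
  then show "\<exists>y. y \<in> orbit translate P \<and> y \<in> N" unfolding orbit_def by blast
qed

section \<open>An almost inverse of \<beta>\<close>

lemma P0_closed: "closed P0" using closed_P_cl[of 0] by simp

lemma nonsingular_in_Xp: "\<pi> l \<notin> Y\<^sub>s \<Longrightarrow> P_cl (\<pi> l) \<in> Xp"
  using orbit_closure_nonsingular[OF P0_closed, of 0 l] between_P_cl[of \<Gamma>] between_nonempty[OF between_P_cl]
  by (simp add: punctured_hull_of_def)

lemma P0_in_Xp: "P0 \<in> Xp" using nonsingular_in_Xp[of 0] \<Gamma>_nonsingular by simp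

text \<open>\<open>P0\<close> is a default value on the null set of singular cosets, chosen to keep
  \<sigma> inside the punctured hull; membership of the outer patch is established for nonsingular
  cosets only.\<close>

definition \<sigma> :: "('g \<times> 'h) set \<Rightarrow> 'g set" where "\<sigma> y = (if y \<in> Y\<^sub>s then P0 else P_cl y)"

lemma \<sigma>_range: "y \<in> topspace Y \<Longrightarrow> \<sigma> y \<in> Xp"
  using nonsingular_in_Xp P0_in_Xp by (auto simp: \<sigma>_def topspace_Y)

lemma \<beta>_\<sigma>: "y \<in> topspace Y \<Longrightarrow> y \<notin> Y\<^sub>s \<Longrightarrow> \<beta> (\<sigma> y) = y"
  using \<beta>_eqI[OF between_P_cl] by (auto simp: \<sigma>_def topspace_Y)

lemma \<sigma>_\<beta>: "P \<in> Xp \<Longrightarrow> \<beta> P \<notin> Y\<^sub>s \<Longrightarrow> \<sigma> (\<beta> P) = P"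
  using \<beta>_between[of P] \<beta>_range[of P] between_nonsingular by (auto simp: \<sigma>_def topspace_Y)

lemma \<sigma>_act: "y \<in> topspace Y \<Longrightarrow> y \<notin> Y\<^sub>s \<Longrightarrow> \<sigma> (act\<^sub>G g y) = translate g (\<sigma> y)"
  by (simp add: \<sigma>_def act_Y\<^sub>s P_cl_act)

text \<open>Off the singular cosets \<sigma> is continuous: there the preimage of \<open>N\<close>
  is the image of the open set \<open>interior (forced N)\<close>. On the singular cosets it is
  constant.\<close>

lemma \<sigma>_measurable: "\<sigma> \<in> borel_of Y \<rightarrow>\<^sub>M borel_of Tp"
proof (rule measurable_into_borel_of)
  show "\<sigma> \<in> space (borel_of Y) \<rightarrow> topspace Tp"
    using \<sigma>_range unfolding topspace_punctured_hull space_borel_of by blast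
  fix U assume "openin Tp U"
  then obtain N where N: "openin fell_topology N" "U = N \<inter> Xp" by (auto simp: openin_subtopology)
  define O' where "O' = interior (forced N)"
  have iff: "P_cl (\<pi> l) \<in> N \<longleftrightarrow> \<pi> l \<in> \<pi> ` O'" if l: "\<pi> l \<notin> Y\<^sub>s" for l
  proof
    assume "P_cl (\<pi> l) \<in> N"
    then show "\<pi> l \<in> \<pi> ` O'" using nonsingular_interior_forced[OF N(1) l] unfolding O'_def by blast
  next
    assume "\<pi> l \<in> \<pi> ` O'"
    then obtain l' where l': "\<pi> l = \<pi> l'" "l' \<in> O'" by blast
    then have "l' \<in> forced N" unfolding O'_def using interior_subset by blast
    then have "P_cl (\<pi> l') \<in> N" using closed_P_cl between_P_cl unfolding forced_def by blast
    then show "P_cl (\<pi> l) \<in> N" using l' by simp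
  qed
  have "\<sigma> -` U \<inter> space (borel_of Y) = (\<pi> ` O' - Y\<^sub>s) \<union> (if P0 \<in> U then Y\<^sub>s else {})"
  proof (intro set_eqI)
    fix y
    show "y \<in> \<sigma> -` U \<inter> space (borel_of Y) \<longleftrightarrow> y \<in> (\<pi> ` O' - Y\<^sub>s) \<union> (if P0 \<in> U then Y\<^sub>s else {})"
    proof (cases "y \<in> Y\<^sub>s")
      case True
      then have "y \<in> topspace Y" unfolding Y\<^sub>s_def topspace_Y by blast
      then show ?thesis using True by (auto simp: \<sigma>_def)
    next
      case ns: False
      show ?thesis
      proof (cases "y \<in> topspace Y")
        case True
        then obtain l where y: "y = \<pi> l" by (auto simp: topspace_Y)
        then show ?thesis using ns iff[of l] nonsingular_in_Xp[of l] N(2) True by (auto simp: \<sigma>_def)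
      next
        case False
        then show ?thesis using ns by (auto simp: topspace_Y)
      qed
    qed
  qed
  moreover have "\<pi> ` O' \<in> sets (borel_of Y)"
    unfolding O'_def by (intro openin_sets_borel_of open_image open_interior)
  ultimately show "\<sigma> -` U \<inter> space (borel_of Y) \<in> sets (borel_of Y)" using Y\<^sub>s_measurable by auto
qed

text \<open>Cosets whose inner patch meets a given relatively compact open set form an open set, and
  such sets cover \<open>Y\<close> because inner patches are non-empty. A finite subcover yields one
  compact set met by every translate of \<open>P0\<close>, that is, \<open>P0\<close> is relatively
  dense.\<close>

lemma empty_not_in_hull:
  assumes "compact_space Y"
  shows "{} \<notin> hull_of P0"
proof
  assume e: "{} \<in> hull_of P0"
  define \<U> where "\<U> = {\<pi> ` {l. P_int (\<pi> l) \<inter> V \<noteq> {}} |V. open V \<and> (\<exists>K. compact K \<and> V \<subseteq> K)}"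
  have "openin Y U" if "U \<in> \<U>" for U
    using that open_image[OF open_P_int_meets] unfolding \<U>_def by blast
  moreover have "topspace Y \<subseteq> \<Union>\<U>"
  proof
    fix y assume "y \<in> topspace Y"
    then obtain l where y: "y = \<pi> l" by (auto simp: topspace_Y)
    obtain p where p: "p \<in> P_int (\<pi> l)" using P_int_nonempty by blast
    obtain V K where VK: "open V" "compact K" "p \<in> V" "V \<subseteq> K" using compact_neighbourhood[OF open_UNIV UNIV_I] by metis
    have "y \<in> \<pi> ` {l. P_int (\<pi> l) \<inter> V \<noteq> {}}" using y p VK(3) by blast
    then show "y \<in> \<Union>\<U>" unfolding \<U>_def using VK by blast
  qed
  ultimately obtain \<F> where F: "finite \<F>" "\<F> \<subseteq> \<U>" "topspace Y \<subseteq> \<Union>\<F>"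
    using assms unfolding compact_space_alt by meson
  have "\<exists>K. compact K \<and> (\<forall>l. \<pi> l \<in> U \<longrightarrow> P_int (\<pi> l) \<inter> K \<noteq> {})" if U: "U \<in> \<F>" for U
  proof -
    have "U \<in> \<U>" using U F(2) by blast
    then obtain V K where VK: "U = \<pi> ` {l. P_int (\<pi> l) \<inter> V \<noteq> {}}" "compact K" "V \<subseteq> K"
      unfolding \<U>_def by blast
    have "P_int (\<pi> l) \<inter> K \<noteq> {}" if l: "\<pi> l \<in> U" for l
    proof -
      obtain l' where "\<pi> l = \<pi> l'" "P_int (\<pi> l') \<inter> V \<noteq> {}" using l unfolding VK(1) by blast
      then show ?thesis using VK(3) by auto
    qed
    then show ?thesis using VK(2) by blast
  qed
  then obtain K where K: "\<And>U. U \<in> \<F> \<Longrightarrow> compact (K U) \<and> (\<forall>l. \<pi> l \<in> U \<longrightarrow> P_int (\<pi> l) \<inter> K U \<noteq> {})"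
    by metis
  let ?K = "\<Union>U\<in>\<F>. K U"
  have "compact ?K" using K F(1) by (intro compact_UN) auto
  then have "openin fell_topology {C. closed C \<and> C \<inter> ?K = {}}" by (rule openin_fell_miss)
  moreover have "{} \<in> {C. closed C \<and> C \<inter> ?K = {}}" by simp
  ultimately obtain C where "C \<in> orbit translate P0" "C \<in> {C. closed C \<and> C \<inter> ?K = {}}"
    using e unfolding hull_of_def in_closure_of by meson
  then have C: "C \<in> orbit translate P0" "C \<inter> ?K = {}" by simp_all
  then obtain g where g: "C = P_cl (\<pi> (g, 0))" unfolding orbit_P0 by blast
  have "\<pi> (g, 0) \<in> topspace Y" by (simp add: topspace_Y)
  then obtain U where U: "U \<in> \<F>" "\<pi> (g, 0) \<in> U" using F(3) by blast
  then have "P_int (\<pi> (g, 0)) \<inter> K U \<noteq> {}" using K by blast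
  then show False using C(2) U(1) P_int_subset_P_cl[of "\<pi> (g, 0)"] unfolding g by blast
qed

text \<open>The hull is closed in the compact Fell space. For minimality, the orbit closure of any
  \<open>P\<close> contains \<open>P0\<close> because \<Gamma> is nonsingular, hence contains the
  whole hull.\<close>

lemma uniform_hull:
  assumes "compact_space Y"
  shows "Xp = hull_of P0" "compact_space (subtopology fell_topology (hull_of P0))"
    "minimal_G_space (subtopology fell_topology (hull_of P0)) translate"
proof -
  show eq: "Xp = hull_of P0"
    using empty_not_in_hull[OF assms] by (auto simp: punctured_hull_of_def)
  have cl: "closedin fell_topology (hull_of P0)" unfolding hull_of_def by simp
  show "compact_space (subtopology fell_topology (hull_of P0))"
    using closedin_compact_space[OF compact_space_fell cl] by (rule compact_space_subtopology)
  show "minimal_G_space (subtopology fell_topology (hull_of P0)) translate"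
    unfolding minimal_G_space_def topspace_hull
  proof (intro conjI ballI G_space_hull)
    fix P assume P: "P \<in> hull_of P0"
    obtain l where l: "between P (\<pi> l)" using between_exists P eq by blast
    have "closed P" using P hull_of_closed by blast
    from orbit_closure_nonsingular[OF this l, of 0] have "P0 \<in> hull_of P"
      using \<Gamma>_nonsingular by simp
    then have "orbit translate P0 \<subseteq> hull_of P" using hull_of_translate unfolding orbit_def by blast
    then have "hull_of P0 \<subseteq> hull_of P"
      unfolding hull_of_def[of P0] by (rule closure_of_minimal) (simp add: hull_of_def)
    moreover have "orbit translate P \<subseteq> hull_of P0" using hull_of_translate[OF P] unfolding orbit_def by blast
    ultimately show "subtopology fell_topology (hull_of P0) closure_of orbit translate P = hull_of P0"
      unfolding closure_of_subtopology by (simp add: hull_of_def[of P, symmetric] Int_absorb1 Int_absorb2)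
  qed
qed

end

section \<open>Isomorphic actions have equivalent Koopman representations\<close>

lemma square_integrable_add:
  assumes "f \<in> square_integrable M" "g \<in> square_integrable M"
  shows "(\<lambda>x. f x + g x) \<in> square_integrable M"
proof -
  have f: "f \<in> borel_measurable M" "integrable M (\<lambda>x. (cmod (f x))\<^sup>2)"
    and g: "g \<in> borel_measurable M" "integrable M (\<lambda>x. (cmod (g x))\<^sup>2)"
    using assms by (auto simp: square_integrable_def)
  have "integrable M (\<lambda>x. (cmod (f x + g x))\<^sup>2)"
  proof (rule Bochner_Integration.integrable_bound)
    show "integrable M (\<lambda>x. 2 * (cmod (f x))\<^sup>2 + 2 * (cmod (g x))\<^sup>2)" using f g by auto
    show "(\<lambda>x. (cmod (f x + g x))\<^sup>2) \<in> borel_measurable M" using f g by measurable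
    have "(cmod (f x + g x))\<^sup>2 \<le> 2 * (cmod (f x))\<^sup>2 + 2 * (cmod (g x))\<^sup>2" for x
    proof -
      have "(cmod (f x + g x))\<^sup>2 \<le> (cmod (f x) + cmod (g x))\<^sup>2"
        by (intro power_mono norm_triangle_ineq) simp
      also have "\<dots> \<le> 2 * (cmod (f x))\<^sup>2 + 2 * (cmod (g x))\<^sup>2"
        using sum_squares_bound[of "cmod (f x)" "cmod (g x)"] by (simp add: power2_sum)
      finally show ?thesis .
    qed
    then show "AE x in M. norm ((cmod (f x + g x))\<^sup>2) \<le> norm (2 * (cmod (f x))\<^sup>2 + 2 * (cmod (g x))\<^sup>2)"
      by (auto intro!: AE_I2 order_trans[OF _ abs_ge_self])
  qed
  then show ?thesis using f g by (auto simp: square_integrable_def)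
qed

lemma square_integrable_scale:
  assumes "f \<in> square_integrable M"
  shows "(\<lambda>x. c * f x) \<in> square_integrable M"
  using assms by (auto simp: square_integrable_def norm_mult power_mult_distrib)

lemma square_integrable_compose:
  assumes s: "s \<in> N \<rightarrow>\<^sub>M M" "distr N M s = M" and f: "f \<in> square_integrable M"
  shows "(\<lambda>y. f (s y)) \<in> square_integrable N"
proof -
  have f': "f \<in> borel_measurable M" "integrable (distr N M s) (\<lambda>x. (cmod (f x))\<^sup>2)"
    using f s(2) by (auto simp: square_integrable_def)
  have m: "(\<lambda>x. (cmod (f x))\<^sup>2) \<in> borel_measurable M" using f' by measurable
  show ?thesis
    using f' measurable_compose[OF s(1) f'(1)] integrable_distr_eq[OF s(1) m]
    by (simp add: square_integrable_def)
qed

lemma AE_compose: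
  assumes "s \<in> N \<rightarrow>\<^sub>M M" "distr N M s = M" "AE x in M. P x"
  shows "AE y in N. P (s y)"
  by (rule AE_distrD[OF assms(1)]) (simp only: assms(2,3))

lemma L2_class_self: "f \<in> square_integrable M \<Longrightarrow> f \<in> L2_class M f"
  by (simp add: L2_class_def)

lemma L2_class_eq: "AE x in M. f x = g x \<Longrightarrow> L2_class M f = L2_class M g"
  unfolding L2_class_def by (auto elim: eventually_elim2)

lemma L2_classD:
  assumes "f' \<in> L2_class M f"
  shows "f' \<in> square_integrable M" "AE x in M. f' x = f x"
  using assms by (auto simp: L2_class_def)

lemma L2_class_eqD:
  assumes "L2_class M f = L2_class M g" "f \<in> square_integrable M"
  shows "AE x in M. f x = g x"
  using L2_class_self[OF assms(2)] assms(1) L2_classD(2) by auto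

lemma L2I: "f \<in> square_integrable M \<Longrightarrow> L2_class M f \<in> L2 M"
  by (simp add: L2_def)

lemma UN_L2_class:
  assumes "f \<in> square_integrable M" "\<And>f'. f' \<in> L2_class M f \<Longrightarrow> F f' = C"
  shows "(\<Union>f'\<in>L2_class M f. F f') = C"
  using L2_class_self[OF assms(1)] assms(2) by blast

lemma L2_add_class:
  assumes "f \<in> square_integrable M" "g \<in> square_integrable M"
  shows "L2_add M (L2_class M f) (L2_class M g) = L2_class M (\<lambda>x. f x + g x)"
  unfolding L2_add_def
proof (intro UN_L2_class assms L2_class_eq)
  fix f' g' assume "f' \<in> L2_class M f" "g' \<in> L2_class M g"
  from L2_classD(2)[OF this(1)] L2_classD(2)[OF this(2)]
  show "AE x in M. f' x + g' x = f x + g x" by eventually_elim simp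
qed

lemma L2_scale_class:
  assumes "f \<in> square_integrable M"
  shows "L2_scale M c (L2_class M f) = L2_class M (\<lambda>x. c * f x)"
  unfolding L2_scale_def
proof (intro UN_L2_class assms L2_class_eq)
  fix f' assume "f' \<in> L2_class M f"
  from L2_classD(2)[OF this] show "AE x in M. c * f' x = c * f x" by eventually_elim simp
qed

lemma L2_inner_class:
  assumes f: "f \<in> square_integrable M" and g: "g \<in> square_integrable M"
  shows "L2_inner M (L2_class M f) (L2_class M g) = (\<integral>x. f x * cnj (g x) \<partial>M)"
  unfolding L2_inner_def
proof (rule the_equality)
  show "\<forall>f'\<in>L2_class M f. \<forall>g'\<in>L2_class M g. (\<integral>x. f x * cnj (g x) \<partial>M) = (\<integral>x. f' x * cnj (g' x) \<partial>M)"
  proof (intro ballI integral_cong_AE)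
    fix f' g' assume *: "f' \<in> L2_class M f" "g' \<in> L2_class M g"
    from L2_classD(2)[OF this(1)] L2_classD(2)[OF this(2)]
    show "AE x in M. f x * cnj (g x) = f' x * cnj (g' x)" by eventually_elim simp
    have cnj: "cnj \<in> borel_measurable borel"
      by (intro borel_measurable_continuous_onI continuous_intros)
    show "(\<lambda>x. f x * cnj (g x)) \<in> borel_measurable M" "(\<lambda>x. f' x * cnj (g' x)) \<in> borel_measurable M"
      using L2_classD(1)[OF *(1)] L2_classD(1)[OF *(2)] f g
      by (auto simp: square_integrable_def intro!: borel_measurable_times measurable_compose[OF _ cnj])
  qed
qed (use L2_class_self[OF f] L2_class_self[OF g] in blast)

text \<open>The unitary is composition with \<open>s\<close>, inverted by composition with
  \<open>b\<close>. Working with maps defined everywhere and inverse to each other almost everywhere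
  avoids extending functions from conull subsets.\<close>

lemma L2_unitarily_equivalent_of_factor:
  assumes s: "s \<in> N \<rightarrow>\<^sub>M M" "distr N M s = M"
    and b: "b \<in> M \<rightarrow>\<^sub>M N"
    and bs: "AE y in N. b (s y) = y" and sb: "AE x in M. s (b x) = x"
    and aM: "\<And>g. aM g \<in> M \<rightarrow>\<^sub>M M" "\<And>g. distr M M (aM g) = M"
    and aN: "\<And>g. aN g \<in> N \<rightarrow>\<^sub>M N" "\<And>g. distr N N (aN g) = N"
    and equi: "\<And>g. AE y in N. s (aN g y) = aM g (s y)"
  shows "L2_unitarily_equivalent aM M aN N"
proof -
  have "distr M N b = distr (distr N M s) N b" by (simp add: s(2))
  also have "\<dots> = distr N N (b \<circ> s)" by (rule distr_distr[OF b s(1)])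
  also have "\<dots> = distr N N (\<lambda>y. y)"
    by (intro distr_cong_AE) (use bs b s measurable_comp[OF s(1) b] in auto)
  finally have b': "distr M N b = N" by (simp add: distr_id2)
  define U where "U A = (\<Union>f\<in>A. L2_class N (\<lambda>y. f (s y)))" for A
  have U: "U (L2_class M f) = L2_class N (\<lambda>y. f (s y))" if f: "f \<in> square_integrable M" for f
    unfolding U_def
  proof (intro UN_L2_class f L2_class_eq)
    fix f' assume "f' \<in> L2_class M f"
    from AE_compose[OF s L2_classD(2)[OF this]] show "AE y in N. f' (s y) = f (s y)" .
  qed
  have sq: "(\<lambda>y. f (s y)) \<in> square_integrable N" if "f \<in> square_integrable M" for f
    by (rule square_integrable_compose[OF s that])
  show ?thesis unfolding L2_unitarily_equivalent_def
  proof (intro exI[of _ U] conjI ballI allI)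
    show "bij_betw U (L2 M) (L2 N)"
      unfolding bij_betw_def
    proof
      show "inj_on U (L2 M)"
      proof (rule inj_onI)
        fix A B assume "A \<in> L2 M" "B \<in> L2 M" and eq: "U A = U B"
        then obtain f g where f: "f \<in> square_integrable M" "A = L2_class M f"
          and g: "g \<in> square_integrable M" "B = L2_class M g" by (auto simp: L2_def)
        have "AE y in N. f (s y) = g (s y)"
          using eq U[OF f(1)] U[OF g(1)] f g by (intro L2_class_eqD sq) simp_all
        from AE_compose[OF b b' this] sb have "AE x in M. f x = g x"
          by eventually_elim simp
        then show "A = B" using f g L2_class_eq by blast
      qed
      show "U ` L2 M = L2 N"
      proof (intro equalityI subsetI)
        fix B assume "B \<in> U ` L2 M"
        then show "B \<in> L2 N" using U sq by (auto simp: L2_def)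
      next
        fix B assume "B \<in> L2 N"
        then obtain g where g: "g \<in> square_integrable N" "B = L2_class N g" by (auto simp: L2_def)
        have gb: "(\<lambda>x. g (b x)) \<in> square_integrable M" by (rule square_integrable_compose[OF b b' g(1)])
        have "L2_class N (\<lambda>y. g (b (s y))) = B" unfolding g(2)
          by (rule L2_class_eq) (use bs in eventually_elim, simp)
        then have "U (L2_class M (\<lambda>x. g (b x))) = B" by (simp add: U[OF gb])
        then show "B \<in> U ` L2 M" using L2I[OF gb] by blast
      qed
    qed
  next
    fix A B assume "A \<in> L2 M" "B \<in> L2 M"
    then obtain f g where f: "f \<in> square_integrable M" "A = L2_class M f"
      and g: "g \<in> square_integrable M" "B = L2_class M g" by (auto simp: L2_def)
    show "U (L2_add M A B) = L2_add N (U A) (U B)"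
      using f g by (simp add: L2_add_class U square_integrable_add sq)
    have m: "(\<lambda>x. f x * cnj (g x)) \<in> borel_measurable M"
    proof -
      have cnj: "cnj \<in> borel_measurable borel"
        by (intro borel_measurable_continuous_onI continuous_intros)
      show ?thesis using f g
        by (auto simp: square_integrable_def intro!: borel_measurable_times measurable_compose[OF _ cnj])
    qed
    show "L2_inner N (U A) (U B) = L2_inner M A B"
      using f g integral_distr[OF s(1) m] by (simp add: U L2_inner_class sq s(2))
  next
    fix c A assume "A \<in> L2 M"
    then obtain f where f: "f \<in> square_integrable M" "A = L2_class M f" by (auto simp: L2_def)
    show "U (L2_scale M c A) = L2_scale N c (U A)"
      using f by (simp add: L2_scale_class U square_integrable_scale sq)
  next
    fix g A assume "A \<in> L2 M"
    then obtain f where f: "f \<in> square_integrable M" "A = L2_class M f" by (auto simp: L2_def)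
    have kM: "koopman M aM g A = L2_class M (\<lambda>x. f (aM (- g) x))"
      unfolding koopman_def f(2)
    proof (intro UN_L2_class f L2_class_eq)
      fix f' assume "f' \<in> L2_class M f"
      from AE_compose[OF aM L2_classD(2)[OF this]] show "AE x in M. f' (aM (- g) x) = f (aM (- g) x)" .
    qed
    have kN: "koopman N aN g (U A) = L2_class N (\<lambda>y. f (s (aN (- g) y)))"
      unfolding koopman_def f(2) U[OF f(1)]
    proof (intro UN_L2_class sq f L2_class_eq)
      fix f' assume "f' \<in> L2_class N (\<lambda>y. f (s y))"
      from AE_compose[OF aN L2_classD(2)[OF this]] show "AE y in N. f' (aN (- g) y) = f (s (aN (- g) y))" .
    qed
    have "U (koopman M aM g A) = L2_class N (\<lambda>y. f (aM (- g) (s y)))"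
      unfolding kM by (rule U[OF square_integrable_compose[OF aM f(1)]])
    also have "\<dots> = koopman N aN g (U A)"
      unfolding kN by (rule L2_class_eq) (use equi[of "- g"] in eventually_elim, simp)
    finally show "U (koopman M aM g A) = koopman N aN g (U A)" .
  qed
qed

text \<open>Normalize a strictly positive integrable function to a density. Haar measure charges
  non-empty open sets, so the support is the whole group. One such law turns uniqueness of
  stationary measures into uniqueness of invariant ones.\<close>

lemma ex_admissible:
  assumes k: "left_haar_measure (k :: 'g::lcsc_group measure)"
  shows "\<exists>\<mu>. admissible k \<mu>"
proof -
  interpret sigma_finite_measure k by (rule left_haar_measure_sigma_finite[OF k])
  note sk = left_haar_measure_sets[OF k]
  obtain h where h: "h \<in> borel_measurable k" "integral\<^sup>N k h \<noteq> \<infinity>" "\<And>x. 0 < h x"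
    using Ex_finite_integrable_function sk by auto
  define c where "c = integral\<^sup>N k h"
  have "\<not> (AE x in k. False)"
    using AE_iff_null_sets[of UNIV k] sk left_haar_measure_UNIV[OF k] by (auto simp: null_sets_def)
  then have "c \<noteq> 0"
    unfolding c_def nn_integral_0_iff_AE[OF h(1)] using h(3) by (auto elim!: eventually_mono simp: less_le)
  have "c \<noteq> \<infinity>" using h(2) by (simp add: c_def)
  define \<mu> where "\<mu> = density k (\<lambda>x. h x / c)"
  have hc: "(\<lambda>x. h x / c) \<in> borel_measurable k" using h(1) by measurable
  have sets: "sets \<mu> = sets borel" by (simp add: \<mu>_def sk)
  have "emeasure \<mu> (space \<mu>) = (\<integral>\<^sup>+x. h x / c \<partial>k)"
    unfolding \<mu>_def using hc by (subst emeasure_density) (auto intro!: nn_integral_cong)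
  also have "\<dots> = 1"
    using nn_integral_divide[OF h(1), of c] \<open>c \<noteq> 0\<close> \<open>c \<noteq> \<infinity>\<close>
    by (simp add: c_def[symmetric] ennreal_divide_self top.not_eq_extremum)
  finally have "prob_space \<mu>" by (rule prob_spaceI)
  moreover have "absolutely_continuous k \<mu>"
    unfolding \<mu>_def by (rule absolutely_continuousI_density[OF hc])
  moreover have "measure_support \<mu> = UNIV"
  proof -
    have "emeasure \<mu> U \<noteq> 0" if U: "open U" "x \<in> U" for U x
    proof
      have [measurable]: "U \<in> sets k" using U sk by simp
      have m: "(\<lambda>x. h x / c * indicator U x) \<in> borel_measurable k" using hc by measurable
      assume "emeasure \<mu> U = 0"
      then have "(\<integral>\<^sup>+x. h x / c * indicator U x \<partial>k) = 0"
        unfolding \<mu>_def using U sk hc by (subst (asm) emeasure_density) auto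
      then have "AE x in k. h x / c * indicator U x = 0"
        using nn_integral_0_iff_AE[OF m] by simp
      then have "AE x in k. x \<notin> U"
      proof eventually_elim
        case (elim x)
        have "h x / c \<noteq> 0" using h(3)[of x] \<open>c \<noteq> \<infinity>\<close> by (auto simp: ennreal_divide_eq_0_iff)
        then show ?case using elim by (auto simp: indicator_def)
      qed
      then have "emeasure k U = 0" using AE_iff_null_sets[of U k] U(1) sk by auto
      then show False using left_haar_open_pos[OF k U(1)] U(2) by blast
    qed
    then show ?thesis unfolding measure_support_def by auto
  qed
  moreover have "add_subgroup hull (UNIV :: 'g set) = UNIV"
    using hull_subset[of "UNIV :: 'g set" add_subgroup] by (simp add: top.extremum_unique)
  ultimately show ?thesis using sets by (auto simp: admissible_def)
qed

section \<open>Measures on the punctured hull\<close>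

context regular_model
begin

definition \<nu> :: "'g set measure" where "\<nu> = distr m (borel_of Tp) \<sigma>"

lemma \<sigma>_measurable': "\<sigma> \<in> m \<rightarrow>\<^sub>M borel_of Tp"
  using \<sigma>_measurable by (subst measurable_cong_sets[OF m_props(2) refl])

lemma sets_\<nu>: "sets \<nu> = sets (borel_of Tp)" by (simp add: \<nu>_def)

lemma space_\<nu>: "space \<nu> = Xp" using sets_eq_imp_space_eq[OF sets_\<nu>] unfolding space_borel_of topspace_punctured_hull .

lemma borel_prob_\<nu>: "borel_prob_on Tp \<nu>"
  unfolding borel_prob_on_def using m.prob_space_distr[OF \<sigma>_measurable'] sets_\<nu> by (simp add: \<nu>_def)

lemma G_space_Tp: "G_space Tp translate" by (rule G_space_punctured_hull)

lemma emeasure_\<nu>: "A \<in> sets (borel_of Tp) \<Longrightarrow> emeasure \<nu> A = emeasure m (\<sigma> -` A \<inter> topspace Y)"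
  unfolding \<nu>_def using emeasure_distr[OF \<sigma>_measurable'] by (simp add: m_props)

lemma AE_nonsingular: "AE y in m. y \<in> topspace Y \<and> y \<notin> Y\<^sub>s"
proof -
  have "Y\<^sub>s \<in> null_sets m" using Y\<^sub>s_null Y\<^sub>s_measurable by (simp add: null_sets_def m_props)
  from AE_not_in[OF this] AE_space show ?thesis by eventually_elim (simp add: m_props)
qed

text \<open>Equivariance of \<sigma> holds off the singular cosets, so the two preimages are
  compared up to a null set.\<close>

lemma invariant_\<nu>: "invariant_prob Tp translate \<nu>"
  unfolding invariant_prob_iff[OF G_space_Tp]
proof (intro conjI allI ballI borel_prob_\<nu>)
  fix g A assume A: "A \<in> sets (borel_of Tp)"
  have \<sigma>A: "\<sigma> -` B \<inter> topspace Y \<in> sets (borel_of Y)" if "B \<in> sets (borel_of Tp)" for B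
    using measurable_sets[OF \<sigma>_measurable that] by simp
  have tA: "translate g -` A \<inter> topspace Tp \<in> sets (borel_of Tp)"
    by (rule act_set_measurable[OF G_space_Tp A])
  have "emeasure m (\<sigma> -` (translate g -` A \<inter> topspace Tp) \<inter> topspace Y)
      = emeasure m (act\<^sub>G g -` (\<sigma> -` A \<inter> topspace Y) \<inter> topspace Y)"
  proof (rule emeasure_eq_AE)
    show "AE y in m. y \<in> \<sigma> -` (translate g -` A \<inter> topspace Tp) \<inter> topspace Y \<longleftrightarrow>
        y \<in> act\<^sub>G g -` (\<sigma> -` A \<inter> topspace Y) \<inter> topspace Y"
      using AE_nonsingular
    proof eventually_elim
      case (elim y)
      then show ?case
        using \<sigma>_range[of y] \<sigma>_act[of y g] G_spaceD(1)[OF G_space_G, of y g]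
        unfolding topspace_punctured_hull by auto
    qed
    show "\<sigma> -` (translate g -` A \<inter> topspace Tp) \<inter> topspace Y \<in> sets m"
      unfolding m_props(2) by (rule \<sigma>A[OF tA])
    show "act\<^sub>G g -` (\<sigma> -` A \<inter> topspace Y) \<inter> topspace Y \<in> sets m"
      unfolding m_props(2) by (rule act_set_measurable[OF G_space_G \<sigma>A[OF A]])
  qed
  also have "\<dots> = emeasure m (\<sigma> -` A \<inter> topspace Y)" by (rule m_act[OF \<sigma>A[OF A]])
  finally show "emeasure \<nu> (translate g -` A \<inter> topspace Tp) = emeasure \<nu> A"
    unfolding emeasure_\<nu>[OF A] emeasure_\<nu>[OF tA] .
qed

lemma \<beta>_measurable: "\<beta> \<in> borel_of Tp \<rightarrow>\<^sub>M borel_of Y"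
  by (rule measurable_borel_of_continuous_map[OF continuous_map_\<beta>])

text \<open>The image of \<open>n\<close> under \<beta> is stationary on \<open>Y\<close>, hence
  equal to \<open>m\<close>. So \<beta> avoids \<open>Y\<^sub>s\<close> almost surely, and there
  \<open>\<sigma> (\<beta> P) = P\<close>; thus \<open>n\<close> is the image of \<open>m\<close>
  under \<sigma>.\<close>

lemma stationary_eq_\<nu>:
  assumes \<mu>: "admissible m\<^sub>G \<mu>" and n: "stationary_prob Tp translate \<mu> n"
  shows "n = \<nu>"
proof -
  have \<mu>': "sets \<mu> = sets borel" using \<mu> by (simp add: admissible_def)
  note n' = n[unfolded stationary_prob_iff[OF G_space_Tp \<mu>']]
  note nD = borel_prob_onD[OF conjunct1[OF n']]
  have sp: "space n = Xp" using nD(3) unfolding topspace_punctured_hull .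
  interpret n: prob_space n by (rule nD)
  define \<eta> where "\<eta> = distr n (borel_of Y) \<beta>"
  have \<beta>n: "\<beta> \<in> n \<rightarrow>\<^sub>M borel_of Y"
    using \<beta>_measurable by (subst measurable_cong_sets[OF nD(2) refl])
  have \<eta>_prob: "borel_prob_on Y \<eta>"
    unfolding borel_prob_on_def \<eta>_def using n.prob_space_distr[OF \<beta>n] by simp
  have \<eta>: "emeasure \<eta> A = emeasure n (\<beta> -` A \<inter> Xp)" if "A \<in> sets (borel_of Y)" for A
    unfolding \<eta>_def using emeasure_distr[OF \<beta>n that] sp by simp
  have \<beta>A: "\<beta> -` A \<inter> Xp \<in> sets (borel_of Tp)" if "A \<in> sets (borel_of Y)" for A
    using measurable_sets[OF \<beta>_measurable that] unfolding space_borel_of topspace_punctured_hull .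
  have "stationary_prob Y act\<^sub>G \<mu> \<eta>"
    unfolding stationary_prob_iff[OF G_space_G \<mu>']
  proof (intro conjI ballI \<eta>_prob)
    fix A assume A: "A \<in> sets (borel_of Y)"
    have eq: "\<beta> -` (act\<^sub>G g -` A \<inter> topspace Y) \<inter> Xp = translate g -` (\<beta> -` A \<inter> Xp) \<inter> topspace Tp" for g
      using \<beta>_act \<beta>_range G_spaceD(1)[OF G_space_Tp] unfolding topspace_punctured_hull by auto
    have "emeasure \<eta> (act\<^sub>G g -` A \<inter> topspace Y) = emeasure n (translate g -` (\<beta> -` A \<inter> Xp) \<inter> topspace Tp)" for g
      unfolding \<eta>[OF act_set_measurable[OF G_space_G A]] eq ..
    then show "(\<integral>\<^sup>+ g. emeasure \<eta> (act\<^sub>G g -` A \<inter> topspace Y) \<partial>\<mu>) = emeasure \<eta> A"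
      using n'[THEN conjunct2, rule_format, OF \<beta>A[OF A]] by (simp add: \<eta>[OF A])
  qed
  then have "\<eta> = m" by (rule stationary_unique[OF \<mu>])
  show ?thesis
  proof (rule measure_eqI)
    show "sets n = sets \<nu>" by (simp add: nD sets_\<nu>)
    fix A assume "A \<in> sets n"
    then have A: "A \<in> sets (borel_of Tp)" by (simp add: nD)
    have \<sigma>A: "\<sigma> -` A \<inter> topspace Y \<in> sets (borel_of Y)"
      using measurable_sets[OF \<sigma>_measurable A] by simp
    have "\<beta> -` Y\<^sub>s \<inter> Xp \<in> null_sets n"
      using Y\<^sub>s_null \<eta>[OF Y\<^sub>s_measurable] \<beta>A[OF Y\<^sub>s_measurable] \<open>\<eta> = m\<close> by (simp add: null_sets_def nD)
    from AE_not_in[OF this] AE_space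
    have "AE P in n. P \<in> A \<longleftrightarrow> P \<in> \<beta> -` (\<sigma> -` A \<inter> topspace Y) \<inter> Xp"
      by eventually_elim (use \<sigma>_\<beta> \<beta>_range sp in auto)
    then have "emeasure n A = emeasure n (\<beta> -` (\<sigma> -` A \<inter> topspace Y) \<inter> Xp)"
      using A \<beta>A[OF \<sigma>A] by (intro emeasure_eq_AE) (auto simp: nD)
    also have "\<dots> = emeasure \<nu> A" using \<eta>[OF \<sigma>A] \<open>\<eta> = m\<close> emeasure_\<nu>[OF A] by simp
    finally show "emeasure n A = emeasure \<nu> A" .
  qed
qed

text \<open>An invariant measure is stationary for every law on \<open>G\<close>, so a single
  admissible law decides.\<close>

lemma invariant_eq_\<nu>:
  assumes "invariant_prob Tp translate n"
  shows "n = \<nu>"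
proof -
  obtain \<mu> where \<mu>: "admissible m\<^sub>G \<mu>" using ex_admissible[OF haar_G] ..
  then show ?thesis
    using assms by (intro stationary_eq_\<nu>[OF \<mu>] invariant_imp_stationary[OF G_space_Tp]) (auto simp: admissible_def)
qed

lemma distr_\<sigma>: "distr m \<nu> \<sigma> = \<nu>"
  unfolding \<nu>_def by (rule distr_cong) auto

lemma \<sigma>_meas_\<nu>: "\<sigma> \<in> m \<rightarrow>\<^sub>M \<nu>"
  using \<sigma>_measurable' by (subst measurable_cong_sets[OF refl sets_\<nu>])

lemma \<beta>_meas_\<nu>: "\<beta> \<in> \<nu> \<rightarrow>\<^sub>M m"
  using \<beta>_measurable by (subst measurable_cong_sets[OF sets_\<nu> m_props(2)])

lemma AE_\<beta>_nonsingular: "AE P in \<nu>. P \<in> Xp \<and> \<beta> P \<notin> Y\<^sub>s"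
proof -
  have "AE P in distr m \<nu> \<sigma>. P \<in> Xp \<and> \<beta> P \<notin> Y\<^sub>s"
  proof (subst AE_distr_iff[OF \<sigma>_meas_\<nu>])
    show "AE y in m. \<sigma> y \<in> Xp \<and> \<beta> (\<sigma> y) \<notin> Y\<^sub>s"
      using AE_nonsingular by eventually_elim (simp add: \<sigma>_range \<beta>_\<sigma>)
    have "\<beta> -` Y\<^sub>s \<inter> space \<nu> \<in> sets \<nu>"
      by (rule measurable_sets[OF \<beta>_meas_\<nu>]) (simp add: Y\<^sub>s_measurable m_props)
    then have "space \<nu> - (\<beta> -` Y\<^sub>s \<inter> space \<nu>) \<in> sets \<nu>" by (rule sets.compl_sets)
    moreover have "space \<nu> - (\<beta> -` Y\<^sub>s \<inter> space \<nu>) = {P \<in> space \<nu>. P \<in> Xp \<and> \<beta> P \<notin> Y\<^sub>s}"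
      by (auto simp: space_\<nu>)
    ultimately show "{P \<in> space \<nu>. P \<in> Xp \<and> \<beta> P \<notin> Y\<^sub>s} \<in> sets \<nu>" by simp
  qed
  then show ?thesis unfolding distr_\<sigma> .
qed

text \<open>On the nonsingular parts \<beta> and \<sigma> are mutually inverse, so measurability of
  the inverse of \<beta> is that of \<sigma>.\<close>

lemma isomorphic: "measurably_isomorphic translate \<nu> act\<^sub>G m"
proof -
  define X' where "X' = {P \<in> Xp. \<beta> P \<notin> Y\<^sub>s}"
  define Y' where "Y' = topspace Y - Y\<^sub>s"
  have X': "X' \<in> sets \<nu>"
  proof -
    have "\<beta> -` Y\<^sub>s \<inter> space \<nu> \<in> sets \<nu>"
      by (rule measurable_sets[OF \<beta>_meas_\<nu>]) (simp add: Y\<^sub>s_measurable m_props)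
    then have "space \<nu> - (\<beta> -` Y\<^sub>s \<inter> space \<nu>) \<in> sets \<nu>" by (rule sets.compl_sets)
    moreover have "space \<nu> - (\<beta> -` Y\<^sub>s \<inter> space \<nu>) = X'" by (auto simp: space_\<nu> X'_def)
    ultimately show ?thesis by simp
  qed
  have Y': "Y' \<in> sets m"
    using sets.compl_sets[OF Y\<^sub>s_measurable] by (simp add: Y'_def m_props)
  have \<beta>X: "\<beta> P \<in> Y'" "\<sigma> (\<beta> P) = P" if "P \<in> X'" for P
    using that \<beta>_range \<sigma>_\<beta> by (auto simp: X'_def Y'_def)
  have \<sigma>Y: "\<sigma> y \<in> X'" "\<beta> (\<sigma> y) = y" if "y \<in> Y'" for y
    using that \<sigma>_range \<beta>_\<sigma> by (auto simp: X'_def Y'_def)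
  have bij: "bij_betw \<beta> X' Y'"
    by (rule bij_betw_byWitness[where f'=\<sigma>]) (use \<beta>X \<sigma>Y in auto)
  have tX: "translate g P \<in> X'" if "P \<in> X'" for g P
    using that G_spaceD(1)[OF G_space_Tp, of P g] \<beta>_act[of P g] act_Y\<^sub>s[OF \<beta>_range, of P g]
    unfolding topspace_punctured_hull X'_def by simp
  have aY: "act\<^sub>G g y \<in> Y'" if "y \<in> Y'" for g y
    using that G_spaceD(1)[OF G_space_G, of y g] act_Y\<^sub>s[of y g] by (simp add: Y'_def)
  have inv: "the_inv_into X' \<beta> y = \<sigma> y" if "y \<in> Y'" for y
    by (rule the_inv_into_f_eq[OF bij_betw_imp_inj_on[OF bij]]) (use \<sigma>Y that in auto)
  have m1: "\<beta> \<in> restrict_space \<nu> X' \<rightarrow>\<^sub>M restrict_space m Y'"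
    by (rule measurable_restrict_space3[OF \<beta>_meas_\<nu>]) (use \<beta>X in auto)
  have "\<sigma> \<in> restrict_space m Y' \<rightarrow>\<^sub>M restrict_space \<nu> X'"
    by (rule measurable_restrict_space3[OF \<sigma>_meas_\<nu>]) (use \<sigma>Y in auto)
  then have m2: "the_inv_into X' \<beta> \<in> restrict_space m Y' \<rightarrow>\<^sub>M restrict_space \<nu> X'"
    by (subst measurable_cong[OF inv]) (auto simp: space_restrict_space)
  show ?thesis unfolding measurably_isomorphic_def
  proof (intro exI[of _ X'] exI[of _ Y'] exI[of _ \<beta>] conjI allI ballI X' Y' bij m1 m2)
    show "AE P in \<nu>. P \<in> X'" using AE_\<beta>_nonsingular by (simp add: X'_def)
    show "AE y in m. y \<in> Y'" using AE_nonsingular by (simp add: Y'_def)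
    show "translate g ` X' = X'" for g
    proof (intro equalityI subsetI)
      fix P assume P: "P \<in> X'"
      have "P = translate g (translate (- g) P)" by (simp add: translate_translate)
      then show "P \<in> translate g ` X'" using tX[OF P] by (rule image_eqI)
    qed (use tX in auto)
    show "act\<^sub>G g ` Y' = Y'" for g
    proof (intro equalityI subsetI)
      fix y assume y: "y \<in> Y'"
      then have "y = act\<^sub>G g (act\<^sub>G (- g) y)" using G_spaceD(5)[OF G_space_G, of y g] by (simp add: Y'_def)
      then show "y \<in> act\<^sub>G g ` Y'" using aY[OF y] by (rule image_eqI)
    qed (use aY in auto)
    show "\<beta> (translate g P) = act\<^sub>G g (\<beta> P)" if "P \<in> X'" for g P
      using that \<beta>_act by (simp add: X'_def)
    show "distr (restrict_space \<nu> X') (restrict_space m Y') \<beta> = restrict_space m Y'"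
    proof (rule measure_eqI)
      fix A assume "A \<in> sets (distr (restrict_space \<nu> X') (restrict_space m Y') \<beta>)"
      then have A: "A \<in> sets (restrict_space m Y')" by simp
      then have Am: "A \<in> sets m" "A \<subseteq> Y'" using Y' by (auto simp: sets_restrict_space_iff)
      have sX: "space (restrict_space \<nu> X') = X'"
        using sets.sets_into_space[OF X'] by (auto simp: space_restrict_space)
      have B: "\<beta> -` A \<inter> X' \<in> sets \<nu>"
        using measurable_sets[OF m1 A] X' unfolding sX by (simp add: sets_restrict_space_iff)
      have "emeasure (distr (restrict_space \<nu> X') (restrict_space m Y') \<beta>) A
          = emeasure (restrict_space \<nu> X') (\<beta> -` A \<inter> X')"
        by (simp add: emeasure_distr[OF m1 A] sX)
      also have "\<dots> = emeasure \<nu> (\<beta> -` A \<inter> X')"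
        using X' by (intro emeasure_restrict_space) auto
      also have "\<dots> = emeasure m (\<sigma> -` (\<beta> -` A \<inter> X') \<inter> topspace Y)"
        using B by (intro emeasure_\<nu>) (simp add: sets_\<nu>)
      also have "\<dots> = emeasure m A"
      proof (rule emeasure_eq_AE)
        show "AE y in m. y \<in> \<sigma> -` (\<beta> -` A \<inter> X') \<inter> topspace Y \<longleftrightarrow> y \<in> A"
          using AE_nonsingular by eventually_elim (use \<sigma>Y in \<open>auto simp: Y'_def\<close>)
        show "\<sigma> -` (\<beta> -` A \<inter> X') \<inter> topspace Y \<in> sets m"
          using measurable_sets[OF \<sigma>_meas_\<nu> B] by (simp add: m_props)
      qed (rule Am(1))
      also have "\<dots> = emeasure (restrict_space m Y') A"
        using Y' Am by (intro emeasure_restrict_space[symmetric]) auto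
      finally show "emeasure (distr (restrict_space \<nu> X') (restrict_space m Y') \<beta>) A = emeasure (restrict_space m Y') A" .
    qed simp
  qed
qed

lemma L2_equivalent: "L2_unitarily_equivalent translate \<nu> act\<^sub>G m"
proof (rule L2_unitarily_equivalent_of_factor[OF \<sigma>_meas_\<nu> distr_\<sigma> \<beta>_meas_\<nu>])
  show "AE y in m. \<beta> (\<sigma> y) = y" using AE_nonsingular by eventually_elim (simp add: \<beta>_\<sigma>)
  show "AE P in \<nu>. \<sigma> (\<beta> P) = P" using AE_\<beta>_nonsingular by eventually_elim (simp add: \<sigma>_\<beta>)
  show "translate g \<in> \<nu> \<rightarrow>\<^sub>M \<nu>" for g by (rule G_space_measurable'(2)[OF G_space_Tp refl sets_\<nu>])
  show "distr \<nu> \<nu> (translate g) = \<nu>" for g using invariant_\<nu> by (simp add: invariant_prob_def)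
  show "act\<^sub>G g \<in> m \<rightarrow>\<^sub>M m" for g by (rule G_space_measurable'(2)[OF G_space_G refl m_props(2)])
  show "distr m m (act\<^sub>G g) = m" for g using inv_G by (simp add: invariant_prob_def)
  show "AE y in m. \<sigma> (act\<^sub>G g y) = translate g (\<sigma> y)" for g
    using AE_nonsingular by eventually_elim (simp add: \<sigma>_act)
qed

end

lemma model_set_eq:
  assumes "inj_on fst \<Gamma>"
  shows "model_set \<Gamma> W = fst ` (\<Gamma> \<inter> UNIV \<times> W)"
proof -
  have "star_map \<Gamma> (fst \<gamma>) = snd \<gamma>" if "\<gamma> \<in> \<Gamma>" for \<gamma>
    using the_inv_into_f_f[OF assms that] by (simp add: star_map_def)
  then show ?thesis by (force simp: model_set_def)
qed

theorem theorem1p1: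
  fixes m\<^sub>G :: "'g::lcsc_group measure"
    and m\<^sub>H :: "'h::lcsc_group measure"
    and \<Gamma> :: "('g \<times> 'h) set"
    and W\<^sub>0 :: "'h set"
    and P\<^sub>0 :: "'g set"
    and X X\<^sub>p :: "'g set set"
    and T\<^sub>X T\<^sub>p :: "'g set topology"
    and Y :: "('g \<times> 'h) set topology"
    and act\<^sub>Y :: "'g \<Rightarrow> ('g \<times> 'h) set \<Rightarrow> ('g \<times> 'h) set"
    and m\<^sub>Y :: "('g \<times> 'h) set measure"
  assumes "left_haar_measure m\<^sub>G"
    and "left_haar_measure m\<^sub>H"
    and "regular_model_set_data m\<^sub>H \<Gamma> W\<^sub>0"
    and "P\<^sub>0 = model_set \<Gamma> W\<^sub>0"
    and "X = hull_of P\<^sub>0"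
    and "X\<^sub>p = punctured_hull_of P\<^sub>0"
    and "T\<^sub>X = subtopology fell_topology X"
    and "T\<^sub>p = subtopology fell_topology X\<^sub>p"
    and "Y = coset_topology \<Gamma>"
    and "act\<^sub>Y = (\<lambda>g. translate (g, 0))"
    and "invariant_prob Y translate m\<^sub>Y"
  shows "(\<exists>\<nu>. invariant_prob T\<^sub>p translate \<nu> \<and>
            (\<forall>\<nu>'. invariant_prob T\<^sub>p translate \<nu>' \<longrightarrow> \<nu>' = \<nu>) \<and>
            (\<forall>\<mu>. admissible m\<^sub>G \<mu> \<longrightarrow>
               stationary_prob T\<^sub>p translate \<mu> \<nu> \<and>
               (\<forall>\<nu>'. stationary_prob T\<^sub>p translate \<mu> \<nu>' \<longrightarrow> \<nu>' = \<nu>)) \<and>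
            measurably_isomorphic translate \<nu> act\<^sub>Y m\<^sub>Y \<and>
            L2_unitarily_equivalent translate \<nu> act\<^sub>Y m\<^sub>Y) \<and>
         (uniform_lattice \<Gamma> \<longrightarrow>
            X\<^sub>p = X \<and> compact_space T\<^sub>X \<and> minimal_G_space T\<^sub>X translate)"
proof -
  note data = assms(3)[unfolded regular_model_set_data_def cut_and_project_scheme_def lattice_in_def]
  note lattice = data[THEN conjunct1, THEN conjunct1]
  note \<Gamma> = lattice[THEN conjunct1] lattice[THEN conjunct2, THEN conjunct1]
    data[THEN conjunct1, THEN conjunct2, THEN conjunct1] data[THEN conjunct1, THEN conjunct2, THEN conjunct2]
  \<comment> \<open>Discreteness of \<Gamma> enters through two consequences: \<Gamma> is closed,
    for the topology of cosets and patches, and countable, for the nullity of the singular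
    cosets.\<close>
  interpret regular_model \<Gamma> m\<^sub>G m\<^sub>H m\<^sub>Y W\<^sub>0
  proof unfold_locales
    show "closed \<Gamma>" using \<Gamma>(1,2) by (rule closed_discrete_subgroup)
    show "closure (snd ` \<Gamma>) = UNIV" by (rule \<Gamma>(4))
    show "countable \<Gamma>" using \<Gamma>(2) by (rule countable_discrete)
  qed (use data assms in auto)
  have P: "P\<^sub>0 = P0" unfolding assms(4) model_set_eq[OF \<Gamma>(3)] P_cl_def ..
  have "invariant_prob Tp translate \<nu> \<and>
      (\<forall>\<nu>'. invariant_prob Tp translate \<nu>' \<longrightarrow> \<nu>' = \<nu>) \<and>
      (\<forall>\<mu>. admissible m\<^sub>G \<mu> \<longrightarrow> stationary_prob Tp translate \<mu> \<nu> \<and>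
        (\<forall>\<nu>'. stationary_prob Tp translate \<mu> \<nu>' \<longrightarrow> \<nu>' = \<nu>)) \<and>
      measurably_isomorphic translate \<nu> act\<^sub>G m\<^sub>Y \<and> L2_unitarily_equivalent translate \<nu> act\<^sub>G m\<^sub>Y"
  proof (intro conjI allI impI invariant_\<nu> isomorphic L2_equivalent)
    show "\<nu>' = \<nu>" if "invariant_prob Tp translate \<nu>'" for \<nu>'
      by (rule invariant_eq_\<nu>[OF that])
    fix \<mu> assume \<mu>: "admissible m\<^sub>G \<mu>"
    show "stationary_prob Tp translate \<mu> \<nu>"
      using \<mu> by (intro invariant_imp_stationary[OF G_space_Tp _ _ invariant_\<nu>]) (auto simp: admissible_def)
    show "\<nu>' = \<nu>" if "stationary_prob Tp translate \<mu> \<nu>'" for \<nu>'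
      by (rule stationary_eq_\<nu>[OF \<mu> that])
  qed
  then show ?thesis
    unfolding assms(5-10) P uniform_lattice_def using uniform_hull by blast
qed

end
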